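(* Let $(Z_n)_{n\ge 0}$ be a supercritical branching process in random environment with linear fractional offspring distributions, started from $Z_0=1$. Assume that $\mathbb{E}[Xe^{-X}]=0$. Assume further that with respect to $\mathbf{P}$, $X$ has finite variance (in which case $\alpha=2$) or, more generally, belongs to the domain of attraction of some strictly stable law $s$ with index $\alpha\in(0,2]$, and that there is an $\varepsilon>0$ such that $\mathbf{E}\big[|\log(1-Q(0))|^{\alpha+\varepsilon}\big]<\infty$. Then for every $c\in\mathbb{N}$ and $1\le k\le c$, $$\lim_{n\to\infty}\mathbb{P}(Z_n=k\mid 1\le Z_n\le c)=\frac1c ,$$ i.e. the limiting distribution is uniform on $\{1,\dots,c\}$.
   Context: Let $\Delta$ be the space of probability distributions on $\mathbb{N}_0=\{0,1,2,\dots\}$, and $\mathbb{N}=\{1,2,\dots\}$; for $q\in\Delta$ write $q(y):=q(\{y\})$ and $m(q):=\sum_{y\ge 0} y\,q(y)$. Let $Q$ be a $\Delta$-valued random variable. Throughout, $Q$ is a.s. linear fractional: $Q(0)=a$ and $Q(k)=\frac{(1-a)(1-p)}{p}p^k$ for $k\ge 1$, where $a\in[0,1)$ and $p\in(0,1)$ are random parameters. A random environment is an i.i.d. sequence $\Pi=(Q_1,Q_2,\dots)$ of copies of $Q$. The branching process $(Z_n)_{n\ge0}$ in the environment $\Pi$: $Z_0$ is independent of $\Pi$ and, given $\Pi$, $(Z_n)$ is a Markov chain with $\mathcal{L}(Z_n\mid Z_{n-1}=z,\Pi=(q_1,q_2,\dots))=q_n^{*z}$ ($z$-fold convolution). $\mathbb{P}$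 denotes the law with $Z_0=1$. Let $X:=\log m(Q)$. Supercritical means $\mathbb{E}[X]>0$. Change of measure: with $\gamma:=\mathbb{E}[e^{-X}]$ (finite under the hypotheses), $\mathbf{P}$ (with expectation $\mathbf{E}$) is the measure determined by $\mathbf{E}[\phi(Q)]:=\gamma^{-1}\mathbb{E}[e^{-X}\phi(Q)]$ for bounded measurable $\phi:\Delta\to\mathbb{R}$; under $\mathbf{P}$ the environment $Q_1,Q_2,\dots$ is i.i.d. with this tilted law, and the conditional law of $(Z_n)$ given $\Pi$ is unchanged. If $\mathbb{E}[Xe^{-X}]=0$ then $\mathbf{E}[X]=0$. *)

theory Defs
  imports "HOL-Probability.Probability"
begin

section \<open>Offspring distributions\<close>

text \<open>
  A distribution on the nonnegative integers is a \<^typ>\<open>nat pmf\<close>, and the space of all of them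
  carries the coarsest sigma-algebra that makes every evaluation \<open>q \<mapsto> q(y)\<close> measurable
  (which is also the Borel sigma-algebra of the total variation distance).
\<close>

definition offspring_space :: "nat pmf measure" where
  "offspring_space = vimage_algebra UNIV (pmf :: nat pmf \<Rightarrow> nat \<Rightarrow> real) (Pi\<^sub>M UNIV (\<lambda>_. borel))"

definition offspring_mean :: "nat pmf \<Rightarrow> real" where
  "offspring_mean q = measure_pmf.expectation q real"

definition log_mean :: "nat pmf \<Rightarrow> real" where
  "log_mean q = ln (offspring_mean q)"

definition linear_fractional :: "nat pmf \<Rightarrow> bool" where
  "linear_fractional q \<longleftrightarrow>
     (\<exists>a p. 0 \<le> a \<and> a < 1 \<and> 0 < p \<and> p < 1 \<and> pmf q 0 = a \<and>
        (\<forall>k\<ge>1. pmf q k = (1 - a) * (1 - p) / p * p ^ k))"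

text \<open>The \<open>z\<close>-fold convolution of \<open>q\<close> (the point mass at 0 if \<open>z = 0\<close>).\<close>

definition conv_power :: "nat pmf \<Rightarrow> nat \<Rightarrow> nat pmf" where
  "conv_power q z = map_pmf (\<lambda>x. \<Sum>i<z. x i) (Pi_pmf {..<z} 0 (\<lambda>_. q))"


section \<open>Branching processes in random environment\<close>

text \<open>The sigma-algebra generated by the whole environment together with \<open>Z\<^sub>0, \<dots>, Z\<^sub>n\<close>.\<close>

definition env_history ::
    "'w measure \<Rightarrow> (nat \<Rightarrow> 'w \<Rightarrow> nat pmf) \<Rightarrow> (nat \<Rightarrow> 'w \<Rightarrow> nat) \<Rightarrow> nat \<Rightarrow> 'w measure" where
  "env_history M Q Z n =
     vimage_algebra (space M) (\<lambda>\<omega>. (\<lambda>i. Q i \<omega>, \<lambda>j\<in>{..n}. Z j \<omega>))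
       (Pi\<^sub>M UNIV (\<lambda>_. offspring_space) \<Otimes>\<^sub>M Pi\<^sub>M {..n} (\<lambda>_. count_space UNIV))"

text \<open>
  The environment is indexed from 0: \<open>Q n\<close> is the offspring distribution of the individuals of
  generation \<open>n\<close>, so the environment \<open>(Q\<^sub>1, Q\<^sub>2, \<dots>)\<close> of the literature is \<open>(Q 0, Q 1, \<dots>)\<close>.
  The measure \<open>\<nu>\<close> is the common law of the \<open>Q n\<close>.  The last assumption says that, given the
  environment, \<open>Z\<close> is a Markov chain with transition laws
  \<open>L(Z\<^sub>n\<^sub>+\<^sub>1 | Z\<^sub>n = z) = (Q n)\<^sup>*\<^sup>z\<close>.
\<close>

locale branching_process_random_env = prob_space M
  for M :: "'w measure"
    and \<nu> :: "nat pmf measure"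
    and Q :: "nat \<Rightarrow> 'w \<Rightarrow> nat pmf"
    and Z :: "nat \<Rightarrow> 'w \<Rightarrow> nat" +
  assumes env_measurable: "\<And>n. Q n \<in> M \<rightarrow>\<^sub>M offspring_space"
    and env_law: "\<And>n. distr M offspring_space (Q n) = \<nu>"
    and env_indep: "indep_vars (\<lambda>_. offspring_space) Q UNIV"
    and pop_measurable: "\<And>n. Z n \<in> M \<rightarrow>\<^sub>M count_space UNIV"
    and initial_indep:
      "indep_set (sets (vimage_algebra (space M) (Z 0) (count_space UNIV)))
         (sets (vimage_algebra (space M) (\<lambda>\<omega> i. Q i \<omega>) (Pi\<^sub>M UNIV (\<lambda>_. offspring_space))))"
    and transition:
      "\<And>n k. AE \<omega> in M.
         real_cond_exp M (env_history M Q Z n) (indicator {\<omega> \<in> space M. Z (Suc n) \<omega> = k}) \<omega>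
           = pmf (conv_power (Q n \<omega>) (Z n \<omega>)) k"

text \<open>
  \<open>E[X] > 0\<close> where \<open>E[X]\<close> exists in \<open>(-\<infinity>, \<infinity>]\<close>: the strict inequality forces the negative part to be
  integrable, but the positive part may have infinite expectation.
\<close>

definition supercritical :: "nat pmf measure \<Rightarrow> bool" where
  "supercritical \<nu> \<longleftrightarrow>
     (\<integral>\<^sup>+q. ennreal (- log_mean q) \<partial>\<nu>) < (\<integral>\<^sup>+q. ennreal (log_mean q) \<partial>\<nu>)"

text \<open>
  The law of the random offspring distribution under the tilted probability measure with density
  \<open>e\<^sup>-\<^sup>X / E[e\<^sup>-\<^sup>X]\<close>.
\<close>

definition tilted_law :: "nat pmf measure \<Rightarrow> nat pmf measure" where
  "tilted_law \<nu> =
     density \<nu> (\<lambda>q. ennreal (exp (- log_mean q) / (LINT q|\<nu>. exp (- log_mean q))))"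


section \<open>Stable laws\<close>

text \<open>
  Strict stability with index \<open>\<alpha>\<close>: if \<open>Y, Y'\<close> are independent with law \<open>\<mu>\<close>, then
  \<open>a\<^sup>1\<^sup>/\<^sup>\<alpha> Y + b\<^sup>1\<^sup>/\<^sup>\<alpha> Y'\<close> is distributed as \<open>(a + b)\<^sup>1\<^sup>/\<^sup>\<alpha> Y\<close>.  Point masses are excluded,
  as is customary.
\<close>

definition strictly_stable :: "real \<Rightarrow> real measure \<Rightarrow> bool" where
  "strictly_stable \<alpha> \<mu> \<longleftrightarrow>
     0 < \<alpha> \<and> \<alpha> \<le> 2 \<and> real_distribution \<mu> \<and> (\<nexists>x. \<mu> = return borel x) \<and>
     (\<forall>a>0. \<forall>b>0.
        convolution (distr \<mu> borel (\<lambda>x. a powr (1 / \<alpha>) * x)) (distr \<mu> borel (\<lambda>x. b powr (1 / \<alpha>) * x))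
          = distr \<mu> borel (\<lambda>x. (a + b) powr (1 / \<alpha>) * x))"

text \<open>
  Attraction to \<open>s\<close> without centering: \<open>S\<^sub>n / a\<^sub>n\<close> converges in law to \<open>s\<close> for suitable \<open>a\<^sub>n > 0\<close>,
  where \<open>S\<^sub>n\<close> is a sum of \<open>n\<close> independent variables with law \<open>\<mu>\<close>.
\<close>

definition in_domain_of_attraction :: "real measure \<Rightarrow> real measure \<Rightarrow> bool" where
  "in_domain_of_attraction \<mu> s \<longleftrightarrow>
     (\<exists>a :: nat \<Rightarrow> real. (\<forall>n. 0 < a n) \<and>
        weak_conv_m (\<lambda>n. distr (Pi\<^sub>M {..<n} (\<lambda>_. \<mu>)) borel (\<lambda>x. (\<Sum>i<n. x i) / a n)) s)"

end

theory Submission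
  imports Defs
begin

text \<open>
  Let \<open>e\<^sub>H(k) = (1 - H)\<^sup>k\<^sup>-\<^sup>1\<close> for \<open>k \<ge> 1\<close> and \<open>0 < H \<le> 1\<close>, so that \<open>e\<^sub>1\<close> is the point mass at 1.
  A linear fractional law turns the start measure \<open>e\<^sub>H\<close> into a multiple of another \<open>e\<^sub>H\<^sub>'\<close>
  (\<open>linear_fractional_geometric_mixture\<close>), and the multiple contains the factor \<open>e\<^sup>-\<^sup>X\<close> that defines the
  tilted law.  Averaging over the environment, \<open>\<gamma>\<^sup>-\<^sup>n P(Z\<^sub>n = k)\<close> is the value at \<open>H = 1\<close> of the \<open>n\<close>-th
  iterate of an operator \<open>\<T>\<close> (\<open>geom_step\<close>) applied to \<open>H \<mapsto> e\<^sub>H(k)\<close>; in this picture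
  \<open>\<gamma>\<^sup>-\<^sup>n P(Z\<^sub>n = 1)\<close> is \<open>u\<^sub>n = \<T>\<^sup>n 1\<close>.

  The operator gives two inequalities.  Since \<open>1 - \<T> 1 \<ge> \<kappa> H\<close> with \<open>\<kappa> > 0\<close>, the sequence \<open>u\<close> decreases
  and \<open>\<kappa> \<T>\<^sup>n H \<le> u\<^sub>n - u\<^sub>n\<^sub>+\<^sub>1\<close>.  Since \<open>1 - e\<^sub>H(k) \<le> (k - 1) H\<close>, the difference
  \<open>\<gamma>\<^sup>-\<^sup>n (P(Z\<^sub>n = 1) - P(Z\<^sub>n = k))\<close> is at most \<open>(k - 1) \<T>\<^sup>n H\<close>.  So all \<open>P(Z\<^sub>n = k)\<close> are asymptotically
  equal as soon as \<open>u\<^sub>n\<^sub>+\<^sub>1 / u\<^sub>n \<rightarrow> 1\<close> (\<open>geometric_profile_flat\<close>).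

  The annealed population is a Markov chain, hence \<open>u\<close> is a renewal sequence (last visit to 1).  A
  decreasing renewal sequence with divergent sum has ratio limit 1 (\<open>renewal_ratio_tendsto_1\<close>), so it
  remains to show that \<open>\<Sum>n. u\<^sub>n = \<infinity>\<close>, that is, recurrence.

  In the coordinate \<open>s = - ln H\<close> the operator dominates a random walk with step \<open>X\<close> that is killed below 0
  and, softly, when \<open>\<xi> = - ln (1 - Q(0))\<close> exceeds the position.  Under the tilted law \<open>X\<close> is centred, so
  without soft killing the position is a martingale up to a favourable overshoot.  A concave power of
  the position is a Lyapunov function whose gain, which is a truncated second moment of \<open>X\<close>, pays
  for the soft killing (\<open>recurrence_criterion\<close>); being sublinear, it cannot absorb the linear
  martingale, which forces the Green function to be infinite (\<open>green_function_infinite\<close>).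

  The Lyapunov function needs three consequences of attraction to a stable law of index \<open>\<alpha>\<close>: truncated
  second moments at level \<open>y\<close> are at least \<open>y\<^sup>-\<^sup>\<alpha>\<^sup>-\<^sup>\<delta>\<close> (\<open>spread\<close>), moments of order less than \<open>\<alpha>\<close> are
  finite (\<open>moments\<close>), and \<open>\<alpha> > 1\<close> (\<open>index_gt_1\<close>).  They are read off from characteristic functions
  along the times \<open>2\<^sup>j\<close>.  For \<open>\<alpha> = 1\<close> the light left tail \<open>X \<ge> -\<xi>\<close> is decisive: the limit would have only
  upward jumps of index 1, and then the centring cannot stay bounded.
\<close>

section \<open>Ratio limits of monotone renewal sequences\<close>

text \<open>
  In the renewal equation for \<open>u (Suc n)\<close>, every term except the most recent one contains some
  \<open>u j \<ge> u (Suc n)\<close>.  Hence \<open>u (Suc n) * (f 1 + \<epsilon>) \<ge> u n * f 1\<close>, where \<open>\<epsilon>\<close> is what the first \<open>Suc n\<close> values of \<open>f\<close>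
  lack to total mass 1.  Divergence of the sum says that nothing is lacking in the limit.
\<close>

lemma renewal_ratio_tendsto_1:
  fixes u f :: "nat \<Rightarrow> real"
  assumes u0: "u 0 = 1" and f_nonneg: "\<And>n. 0 \<le> f n" and f1: "0 < f 1"
    and renewal: "\<And>n. u (Suc n) = (\<Sum>j\<le>n. u j * f (Suc n - j))"
    and dec: "decseq u" and diverges: "\<not> summable u"
  shows "(\<lambda>n. u (Suc n) / u n) \<longlonglongrightarrow> 1"
proof -
  define F where "F n = (\<Sum>j<n. f (Suc j))" for n
  have u_pos: "0 < u n" for n
  proof (induction n rule: less_induct)
    case (less n)
    show ?case
    proof (cases n)
      case (Suc m)
      have "0 < u m * f 1"
        using less Suc f1 by simp
      also have "\<dots> = u m * f (Suc m - m)" by simp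
      also have "\<dots> \<le> (\<Sum>j\<le>m. u j * f (Suc m - j))"
        using less Suc f_nonneg by (intro member_le_sum) (auto intro!: mult_nonneg_nonneg simp: less_imp_le)
      finally show ?thesis using Suc renewal by simp
    qed (simp add: u0)
  qed
  have u_le_1: "u n \<le> 1" for n
    using decseqD[OF dec, of 0 n] u0 by simp
  have F_mono: "F m \<le> F n" if "m \<le> n" for m n
    unfolding F_def using that f_nonneg by (intro sum_mono2) auto
  \<comment> \<open>Otherwise iterating the renewal equation bounds the partial sums of \<open>u\<close> by a geometric series.\<close>
  have F_large: "\<exists>n. c < F n" if "c < 1" for c
  proof (rule ccontr)
    assume "\<nexists>n. c < F n"
    then have F_le: "F n \<le> c" for n by (meson not_le)
    have partial: "(1 - c) * (\<Sum>n<N. u n) \<le> 1" for N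
    proof (cases N)
      case (Suc M)
      have "(\<Sum>n<Suc M. u n) = 1 + (\<Sum>n<M. u (Suc n))"
        by (subst sum.lessThan_Suc_shift) (simp add: u0)
      also have "(\<Sum>n<M. u (Suc n)) = (\<Sum>n<M. \<Sum>j\<le>n. u j * f (Suc (n - j)))"
        unfolding renewal by (intro sum.cong refl) (simp add: Suc_diff_le)
      also have "\<dots> = (\<Sum>(j, i) \<in> {(j, i). j + i < M}. u j * f (Suc i))"
        by (rule sum.triangle_reindex[symmetric])
      also have "\<dots> \<le> (\<Sum>(j, i) \<in> {..<M} \<times> {..<M}. u j * f (Suc i))"
        using f_nonneg u_pos
        by (intro sum_mono2) (auto intro!: mult_nonneg_nonneg simp: less_imp_le)
      also have "\<dots> = (\<Sum>j<M. u j) * F M"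
        by (simp add: F_def sum_product sum.cartesian_product)
      also have "\<dots> \<le> (\<Sum>j<Suc M. u j) * c"
        using u_pos F_le f_nonneg unfolding F_def
        by (intro mult_mono sum_mono2 sum_nonneg) (auto simp: less_imp_le)
      finally show ?thesis using Suc by (simp add: algebra_simps)
    qed simp
    have "summable u"
    proof (rule summableI_nonneg_bounded)
      show "0 \<le> u n" for n using u_pos less_imp_le by blast
      show "(\<Sum>n<N. u n) \<le> 1 / (1 - c)" for N
        using partial[of N] that by (simp add: field_simps)
    qed
    with diverges show False ..
  qed
  have lower: "u (Suc n) * (1 - F (Suc n) + f 1) \<ge> u n * f 1" for n
  proof -
    have "u (Suc n) * (\<Sum>j<n. f (Suc n - j)) \<le> (\<Sum>j<n. u j * f (Suc n - j))"
      unfolding sum_distrib_left using f_nonneg decseqD[OF dec]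
      by (intro sum_mono mult_right_mono) auto
    moreover have "(\<Sum>j<n. f (Suc n - j)) = F (Suc n) - f 1"
    proof -
      have "F (Suc n) = f 1 + (\<Sum>i<n. f (Suc (Suc i)))"
        unfolding F_def by (subst sum.lessThan_Suc_shift) simp
      also have "(\<Sum>i<n. f (Suc (Suc i))) = (\<Sum>j<n. f (Suc (Suc (n - Suc j))))"
        by (rule sum.nat_diff_reindex[symmetric])
      also have "\<dots> = (\<Sum>j<n. f (Suc n - j))"
        by (intro sum.cong refl arg_cong[where f=f]) auto
      finally show ?thesis by simp
    qed
    moreover have "u (Suc n) = u n * f 1 + (\<Sum>j<n. u j * f (Suc n - j))"
      unfolding renewal by (simp add: lessThan_Suc_atMost[symmetric])
    ultimately show ?thesis by (simp add: algebra_simps)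
  qed
  show ?thesis
  proof (rule LIMSEQ_I)
    fix r :: real assume r: "0 < r"
    define e where "e = r * f 1"
    have e: "0 < e" using r f1 by (simp add: e_def)
    obtain N where N: "1 - e < F N" using F_large[of "1 - e"] e by auto
    show "\<exists>no. \<forall>n\<ge>no. norm (u (Suc n) / u n - 1) < r"
    proof (intro exI allI impI)
      fix n assume n: "N \<le> n"
      have "1 - e < F (Suc n)" using N F_mono[of N "Suc n"] n by simp
      then have "u (Suc n) * (1 - F (Suc n) + f 1) < u (Suc n) * (e + f 1)"
        using u_pos by (intro mult_strict_left_mono) auto
      then have *: "u n * f 1 < u (Suc n) * (e + f 1)" using lower[of n] by linarith
      have le: "u (Suc n) \<le> u n" using decseqD[OF dec] by simp
      have "u n * f 1 < u (Suc n) * f 1 + u n * e"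
        using * mult_right_mono[OF le, of e] e unfolding distrib_left by linarith
      then have "(u n - u (Suc n)) * f 1 < r * u n * f 1" by (simp add: e_def algebra_simps)
      then have "u n - u (Suc n) < r * u n" using f1 by (simp add: mult_less_cancel_right)
      then show "norm (u (Suc n) / u n - 1) < r"
        using le u_pos[of n] r by (simp add: field_simps abs_if)
    qed
  qed
qed

section \<open>A killed random walk and its Green function\<close>

text \<open>
  One generation of the environment under the tilted law: \<open>X\<close> is the logarithm of the offspring mean,
  \<open>\<xi> = - ln (1 - Q(0))\<close>, and \<open>X \<ge> -\<xi>\<close> because the mean is at least the probability of having children.
\<close>

locale random_step = prob_space \<mu> for \<mu> :: "'a measure" +
  fixes X \<xi> :: "'a \<Rightarrow> real"
  assumes X_meas [measurable]: "X \<in> borel_measurable \<mu>"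
    and \<xi>_meas [measurable]: "\<xi> \<in> borel_measurable \<mu>"
    and \<xi>_nonneg: "AE w in \<mu>. 0 \<le> \<xi> w"
    and X_lower: "AE w in \<mu>. - \<xi> w \<le> X w"
begin

definition survival :: "real \<Rightarrow> real \<Rightarrow> 'a \<Rightarrow> real" where
  "survival b s w = 1 / (1 + exp (\<xi> w - (s + b)))\<^sup>2"

text \<open>
  The walk lives on \<open>[0, \<infinity>)\<close>; the barrier level \<open>b\<close> shifts it away from the region where the Lyapunov
  estimate fails, so that the true coordinate is \<open>s + b\<close>.
\<close>

definition killed_step :: "real \<Rightarrow> (real \<Rightarrow> ennreal) \<Rightarrow> real \<Rightarrow> ennreal" where
  "killed_step b \<phi> s = (\<integral>\<^sup>+w. ennreal (survival b s w) * (indicator {0..} (s + X w) * \<phi> (s + X w)) \<partial>\<mu>)"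

lemma survival_nonneg: "0 \<le> survival b s w"
  by (simp add: survival_def)

lemma survival_le_1: "survival b s w \<le> 1"
  unfolding survival_def by (simp add: divide_le_eq add_pos_pos one_le_power)

lemma survival_measurable [measurable]: "(\<lambda>(s, w). survival b s w) \<in> borel_measurable (borel \<Otimes>\<^sub>M \<mu>)"
  unfolding survival_def split_beta by measurable

lemma survival_measurable2 [measurable]: "survival b s \<in> borel_measurable \<mu>"
  unfolding survival_def by measurable

lemma step_measurable [measurable]:
  assumes [measurable]: "\<phi> \<in> borel_measurable borel"
  shows "killed_step b \<phi> \<in> borel_measurable borel"
proof -
  have [measurable]: "(\<lambda>x. survival b (fst x) (snd x)) \<in> borel_measurable (borel \<Otimes>\<^sub>M \<mu>)"
    using survival_measurable[of b] by (simp add: split_beta)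
  show ?thesis unfolding killed_step_def by measurable
qed

lemma step_iterate_measurable [measurable]:
  "\<phi> \<in> borel_measurable borel \<Longrightarrow> (killed_step b ^^ n) \<phi> \<in> borel_measurable borel"
  by (induction n) auto

lemma step_mono:
  assumes "\<And>s. 0 \<le> s \<Longrightarrow> \<phi> s \<le> \<psi> s"
  shows "killed_step b \<phi> s \<le> killed_step b \<psi> s"
  unfolding killed_step_def
proof (rule nn_integral_mono, rule mult_left_mono)
  fix w
  show "indicator {0..} (s + X w) * \<phi> (s + X w) \<le> indicator {0..} (s + X w) * \<psi> (s + X w)"
    using assms by (cases "0 \<le> s + X w") simp_all
qed simp

lemma step_iterate_mono:
  assumes "\<And>s. 0 \<le> s \<Longrightarrow> \<phi> s \<le> \<psi> s" and "0 \<le> s"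
  shows "(killed_step b ^^ n) \<phi> s \<le> (killed_step b ^^ n) \<psi> s"
  using assms(2) by (induction n arbitrary: s) (auto intro: assms step_mono)

lemma step_add:
  assumes [measurable]: "\<phi> \<in> borel_measurable borel" "\<psi> \<in> borel_measurable borel"
  shows "killed_step b (\<lambda>s. \<phi> s + \<psi> s) s = killed_step b \<phi> s + killed_step b \<psi> s"
  unfolding killed_step_def by (simp add: distrib_left nn_integral_add)

lemma step_iterate_add:
  assumes [measurable]: "\<phi> \<in> borel_measurable borel" "\<psi> \<in> borel_measurable borel"
  shows "(killed_step b ^^ n) (\<lambda>s. \<phi> s + \<psi> s) s = (killed_step b ^^ n) \<phi> s + (killed_step b ^^ n) \<psi> s"
proof (induction n arbitrary: s)
  case (Suc n)
  have "(killed_step b ^^ n) (\<lambda>s. \<phi> s + \<psi> s) = (\<lambda>s. (killed_step b ^^ n) \<phi> s + (killed_step b ^^ n) \<psi> s)"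
    using Suc by auto
  then show ?case by (simp add: step_add)
qed simp

lemma step_cmult:
  assumes [measurable]: "\<phi> \<in> borel_measurable borel"
  shows "killed_step b (\<lambda>s. c * \<phi> s) s = c * killed_step b \<phi> s"
  unfolding killed_step_def
  by (subst nn_integral_cmult[symmetric]) (auto simp: mult_ac)

lemma step_iterate_cmult:
  assumes [measurable]: "\<phi> \<in> borel_measurable borel"
  shows "(killed_step b ^^ n) (\<lambda>s. c * \<phi> s) s = c * (killed_step b ^^ n) \<phi> s"
proof (induction n arbitrary: s)
  case (Suc n)
  have "(killed_step b ^^ n) (\<lambda>s. c * \<phi> s) = (\<lambda>s. c * (killed_step b ^^ n) \<phi> s)"
    using Suc by auto
  then show ?case by (simp add: step_cmult)
qed simp

lemma step_bound:
  assumes "\<And>s. \<phi> s \<le> c"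
  shows "killed_step b \<phi> s \<le> c"
proof -
  have "killed_step b \<phi> s \<le> (\<integral>\<^sup>+w. c \<partial>\<mu>)"
    unfolding killed_step_def
  proof (intro nn_integral_mono)
    fix w
    have "ennreal (survival b s w) * (indicator {0..} (s + X w) * \<phi> (s + X w)) \<le> 1 * (1 * c)"
      using survival_le_1[of b s w] assms
      by (intro mult_mono) (auto simp: indicator_def ennreal_le_1)
    then show "ennreal (survival b s w) * (indicator {0..} (s + X w) * \<phi> (s + X w)) \<le> c"
      by simp
  qed
  then show ?thesis by (simp add: emeasure_space_1)
qed

lemma step_iterate_bound:
  assumes "\<And>s. \<phi> s \<le> c"
  shows "(killed_step b ^^ n) \<phi> s \<le> c"
  by (induction n arbitrary: s) (auto intro: assms step_bound)

lemma step_iterate_tendsto_0: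
  assumes [measurable]: "\<And>K. r K \<in> borel_measurable borel"
    and bound: "\<And>K s. r K s \<le> c" and "c < \<infinity>"
    and lim: "\<And>s. (\<lambda>K::nat. r K s) \<longlonglongrightarrow> 0"
  shows "(\<lambda>K. (killed_step b ^^ n) (r K) s) \<longlonglongrightarrow> 0"
proof (induction n arbitrary: s)
  case (Suc n)
  define F where "F K w = ennreal (survival b s w) * (indicator {0..} (s + X w) * (killed_step b ^^ n) (r K) (s + X w))" for K w
  have F_le: "F K w \<le> c" for K w
  proof -
    have "F K w \<le> 1 * (1 * c)"
      unfolding F_def using survival_le_1[of b s w] bound
      by (intro mult_mono step_iterate_bound) (auto simp: indicator_def ennreal_le_1)
    then show ?thesis by simp
  qed
  have F_lim: "(\<lambda>K. F K w) \<longlonglongrightarrow> 0" for w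
  proof -
    have "(\<lambda>K. F K w) \<longlonglongrightarrow> ennreal (survival b s w) * (indicator {0..} (s + X w) * 0)"
      unfolding F_def by (intro ennreal_tendsto_cmult Suc) (auto simp: indicator_def)
    then show ?thesis by simp
  qed
  have "(\<lambda>K. \<integral>\<^sup>+w. F K w \<partial>\<mu>) \<longlonglongrightarrow> (\<integral>\<^sup>+w. 0 \<partial>\<mu>)"
    by (rule nn_integral_dominated_convergence[where w = "\<lambda>_. c"])
       (use F_le F_lim \<open>c < \<infinity>\<close> in \<open>auto simp: F_def emeasure_space_1\<close>)
  then have "(\<lambda>K. killed_step b ((killed_step b ^^ n) (r K)) s) \<longlonglongrightarrow> 0"
    by (simp add: killed_step_def F_def)
  then show ?case by simp
qed (simp add: lim)

text \<open>
  The part of the mean position that soft killing removes in one step.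
\<close>

definition loss :: "real \<Rightarrow> real \<Rightarrow> ennreal" where
  "loss b s = (\<integral>\<^sup>+w. ennreal (1 - survival b s w) * ennreal (s + X w) \<partial>\<mu>)"

text \<open>
  \<open>X\<close> is centred and \<open>(s + X)\<^sup>+ \<ge> s + X\<close>.
\<close>

lemma id_le_step:
  assumes X_int: "integrable \<mu> X" and X_mean: "(\<integral>w. X w \<partial>\<mu>) = 0" and s: "0 \<le> s"
  shows "ennreal s \<le> killed_step b (\<lambda>s. ennreal s) s + loss b s"
proof -
  have "killed_step b (\<lambda>s. ennreal s) s + loss b s
      = (\<integral>\<^sup>+w. ennreal (survival b s w) * (indicator {0..} (s + X w) * ennreal (s + X w))
            + ennreal (1 - survival b s w) * ennreal (s + X w) \<partial>\<mu>)"
    unfolding killed_step_def loss_def by (rule nn_integral_add[symmetric]) auto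
  also have "\<dots> = (\<integral>\<^sup>+w. ennreal (s + X w) \<partial>\<mu>)"
  proof (rule nn_integral_cong)
    fix w
    have "ennreal (survival b s w) * (indicator {0..} (s + X w) * ennreal (s + X w))
        = ennreal (survival b s w) * ennreal (s + X w)"
      by (auto simp: indicator_def ennreal_neg)
    then have "ennreal (survival b s w) * (indicator {0..} (s + X w) * ennreal (s + X w))
        + ennreal (1 - survival b s w) * ennreal (s + X w)
        = (ennreal (survival b s w) + ennreal (1 - survival b s w)) * ennreal (s + X w)"
      by (simp add: distrib_right)
    also have "ennreal (survival b s w) + ennreal (1 - survival b s w) = 1"
      using survival_nonneg[of b s w] survival_le_1[of b s w]
      by (simp flip: ennreal_plus)
    finally show "ennreal (survival b s w) * (indicator {0..} (s + X w) * ennreal (s + X w))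
        + ennreal (1 - survival b s w) * ennreal (s + X w) = ennreal (s + X w)" by simp
  qed
  also have "\<dots> = (\<integral>\<^sup>+w. ennreal (max 0 (s + X w)) \<partial>\<mu>)"
    by (intro nn_integral_cong) (simp add: max_def ennreal_neg)
  also have "\<dots> = ennreal (\<integral>w. max 0 (s + X w) \<partial>\<mu>)"
    using X_int by (intro nn_integral_eq_integral) auto
  also have "\<dots> \<ge> ennreal s"
  proof (rule ennreal_leI)
    have "s = (\<integral>w. s + X w \<partial>\<mu>)" using X_int X_mean by (simp add: prob_space)
    also have "\<dots> \<le> (\<integral>w. max 0 (s + X w) \<partial>\<mu>)"
      using X_int by (intro integral_mono) auto
    finally show "s \<le> (\<integral>w. max 0 (s + X w) \<partial>\<mu>)" .
  qed
  finally show ?thesis .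
qed

text \<open>
  If \<open>V\<close> dominates the loss and its own image, then all losses up to time \<open>n\<close> together cost at most \<open>V s\<close>.
  All terms stand on the side of the sum because differences of extended nonnegative reals truncate at 0.
\<close>

lemma id_le_step_iterate:
  assumes X_int: "integrable \<mu> X" and X_mean: "(\<integral>w. X w \<partial>\<mu>) = 0"
    and [measurable]: "V \<in> borel_measurable borel"
    and V: "\<And>s. 0 \<le> s \<Longrightarrow> killed_step b V s + loss b s \<le> V s" and s: "0 \<le> s"
  shows "ennreal s \<le> (killed_step b ^^ n) (\<lambda>s. ennreal s) s + V s"
  using s
proof (induction n arbitrary: s)
  case (Suc n)
  have "ennreal s \<le> killed_step b (\<lambda>s. ennreal s) s + loss b s"
    by (rule id_le_step[OF X_int X_mean Suc.prems])
  also have "\<dots> \<le> killed_step b (\<lambda>s. (killed_step b ^^ n) (\<lambda>s. ennreal s) s + V s) s + loss b s"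
    by (intro add_right_mono step_mono Suc.IH)
  also have "\<dots> = (killed_step b ^^ Suc n) (\<lambda>s. ennreal s) s + (killed_step b V s + loss b s)"
    by (simp add: step_add add.assoc)
  also have "\<dots> \<le> (killed_step b ^^ Suc n) (\<lambda>s. ennreal s) s + V s"
    by (intro add_left_mono V Suc.prems)
  finally show ?case .
qed simp

definition overshoot :: "nat \<Rightarrow> real \<Rightarrow> ennreal" where
  "overshoot K s = (\<integral>\<^sup>+w. ennreal (\<bar>X w\<bar> - \<bar>s - real K\<bar>) \<partial>\<mu>)"

lemma overshoot_measurable [measurable]: "overshoot K \<in> borel_measurable borel"
  unfolding overshoot_def by measurable

lemma overshoot_le: "overshoot K s \<le> (\<integral>\<^sup>+w. ennreal \<bar>X w\<bar> \<partial>\<mu>)"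
  unfolding overshoot_def by (intro nn_integral_mono ennreal_leI) auto

lemma overshoot_tendsto_0:
  assumes "integrable \<mu> X"
  shows "(\<lambda>K. overshoot K s) \<longlonglongrightarrow> 0"
proof -
  have fin: "(\<integral>\<^sup>+w. ennreal \<bar>X w\<bar> \<partial>\<mu>) < \<infinity>"
    using assms by (simp add: integrable_iff_bounded)
  have "(\<lambda>K. overshoot K s) \<longlonglongrightarrow> (\<integral>\<^sup>+w. 0 \<partial>\<mu>)"
    unfolding overshoot_def
  proof (rule nn_integral_dominated_convergence[where w = "\<lambda>w. ennreal \<bar>X w\<bar>"])
    show "AE w in \<mu>. (\<lambda>K. ennreal (\<bar>X w\<bar> - \<bar>s - real K\<bar>)) \<longlonglongrightarrow> 0"
    proof (rule AE_I2)
      fix w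
      obtain N :: nat where N: "\<bar>X w\<bar> + \<bar>s\<bar> \<le> real N" using real_arch_simple by blast
      have "\<forall>K\<ge>N. ennreal (\<bar>X w\<bar> - \<bar>s - real K\<bar>) = 0"
      proof (intro allI impI)
        fix K assume "N \<le> K"
        then have "real N \<le> real K" by simp
        with N have "\<bar>X w\<bar> - \<bar>s - real K\<bar> \<le> 0" by linarith
        then show "ennreal (\<bar>X w\<bar> - \<bar>s - real K\<bar>) = 0" by (rule ennreal_neg)
      qed
      then show "(\<lambda>K. ennreal (\<bar>X w\<bar> - \<bar>s - real K\<bar>)) \<longlonglongrightarrow> 0"
        by (intro tendsto_eventually) (auto simp: eventually_sequentially)
    qed
  qed (use fin in \<open>auto intro!: ennreal_leI\<close>)
  then show ?thesis by simp
qed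

text \<open>
  Away from its kink at \<open>K\<close>, the function \<open>s \<mapsto> (s - K)\<^sup>+\<close> is affine, so a centred step increases it only when
  the step reaches the kink.
\<close>

lemma step_excess:
  assumes X_int: "integrable \<mu> X" and X_mean: "(\<integral>w. X w \<partial>\<mu>) = 0"
  shows "killed_step b (\<lambda>s. ennreal (s - real K)) s \<le> ennreal (s - real K) + overshoot K s"
proof -
  have "killed_step b (\<lambda>s. ennreal (s - real K)) s \<le> (\<integral>\<^sup>+w. ennreal (max 0 (s + X w - real K)) \<partial>\<mu>)"
    unfolding killed_step_def
  proof (rule nn_integral_mono)
    fix w
    have "ennreal (survival b s w) * (indicator {0..} (s + X w) * ennreal (s + X w - real K))
        \<le> 1 * (1 * ennreal (max 0 (s + X w - real K)))"
      using survival_le_1[of b s w]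
      by (intro mult_mono ennreal_leI) (auto simp: indicator_def ennreal_le_1)
    then show "ennreal (survival b s w) * (indicator {0..} (s + X w) * ennreal (s + X w - real K))
        \<le> ennreal (max 0 (s + X w - real K))" by simp
  qed
  also have "\<dots> = ennreal (\<integral>w. max 0 (s + X w - real K) \<partial>\<mu>)"
    using X_int by (intro nn_integral_eq_integral) auto
  also have "\<dots> \<le> ennreal (max 0 (s - real K) + (\<integral>w. max 0 (\<bar>X w\<bar> - \<bar>s - real K\<bar>) \<partial>\<mu>))"
  proof (rule ennreal_leI)
    show "(\<integral>w. max 0 (s + X w - real K) \<partial>\<mu>) \<le> max 0 (s - real K) + (\<integral>w. max 0 (\<bar>X w\<bar> - \<bar>s - real K\<bar>) \<partial>\<mu>)"
    proof (cases "real K \<le> s")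
      case True
      have "(\<integral>w. max 0 (s + X w - real K) \<partial>\<mu>)
          \<le> (\<integral>w. (s - real K) + X w + max 0 (\<bar>X w\<bar> - \<bar>s - real K\<bar>) \<partial>\<mu>)"
        using X_int True by (intro integral_mono) auto
      also have "\<dots> = (s - real K) + (\<integral>w. max 0 (\<bar>X w\<bar> - \<bar>s - real K\<bar>) \<partial>\<mu>)"
        using X_int X_mean by (simp add: prob_space)
      finally show ?thesis using True by simp
    next
      case False
      then show ?thesis
        using X_int by (simp, intro integral_mono) auto
    qed
  qed
  also have "\<dots> = ennreal (max 0 (s - real K)) + ennreal (\<integral>w. max 0 (\<bar>X w\<bar> - \<bar>s - real K\<bar>) \<partial>\<mu>)"
    by (intro ennreal_plus integral_nonneg_AE) auto
  also have "ennreal (\<integral>w. max 0 (\<bar>X w\<bar> - \<bar>s - real K\<bar>) \<partial>\<mu>)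
       = (\<integral>\<^sup>+w. ennreal (max 0 (\<bar>X w\<bar> - \<bar>s - real K\<bar>)) \<partial>\<mu>)"
    using X_int by (intro nn_integral_eq_integral[symmetric]) auto
  also have "\<dots> = overshoot K s"
    unfolding overshoot_def by (intro nn_integral_cong) (simp add: max_def ennreal_neg)
  also have "ennreal (max 0 (s - real K)) = ennreal (s - real K)"
    by (simp add: max_def ennreal_neg)
  finally show ?thesis .
qed

lemma step_iterate_excess:
  assumes X_int: "integrable \<mu> X" and X_mean: "(\<integral>w. X w \<partial>\<mu>) = 0" and s: "0 \<le> s"
  shows "(killed_step b ^^ n) (\<lambda>s. ennreal (s - real K)) s
     \<le> ennreal (s - real K) + (\<Sum>k<n. (killed_step b ^^ k) (overshoot K) s)"
proof (induction n)
  case (Suc n)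
  have "(killed_step b ^^ Suc n) (\<lambda>s. ennreal (s - real K)) s
      = (killed_step b ^^ n) (killed_step b (\<lambda>s. ennreal (s - real K))) s"
    by (simp add: funpow_swap1)
  also have "\<dots> \<le> (killed_step b ^^ n) (\<lambda>s. ennreal (s - real K) + overshoot K s) s"
    by (intro step_iterate_mono step_excess X_int X_mean s)
  also have "\<dots> = (killed_step b ^^ n) (\<lambda>s. ennreal (s - real K)) s + (killed_step b ^^ n) (overshoot K) s"
    by (rule step_iterate_add) auto
  also have "\<dots> \<le> ennreal (s - real K) + (\<Sum>k<n. (killed_step b ^^ k) (overshoot K) s) + (killed_step b ^^ n) (overshoot K) s"
    by (intro add_right_mono Suc)
  finally show ?case by (simp add: add.assoc)
qed simp

text \<open>
  If the Green function of the constant 1 were finite at \<open>x\<close>, then the mean position would tend to 0: below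
  a level \<open>K\<close> because the survival probability vanishes, and above it because the excess over \<open>K\<close> is
  generated by rare long steps, whose total contribution is small for large \<open>K\<close>.  But the mean position
  stays above \<open>x - V x > 0\<close>.
\<close>

theorem green_function_infinite:
  assumes X_int: "integrable \<mu> X" and X_mean: "(\<integral>w. X w \<partial>\<mu>) = 0"
    and [measurable]: "V \<in> borel_measurable borel"
    and V: "\<And>s. 0 \<le> s \<Longrightarrow> killed_step b V s + loss b s \<le> V s"
    and x: "0 \<le> x" "V x < ennreal x"
  shows "(\<Sum>n. (killed_step b ^^ n) (\<lambda>_. 1) x) = \<infinity>"
proof (rule ccontr)
  assume "(\<Sum>n. (killed_step b ^^ n) (\<lambda>_. 1) x) \<noteq> \<infinity>"
  then have fin: "(\<Sum>n. (killed_step b ^^ n) (\<lambda>_. 1) x) < \<infinity>" by (simp add: less_top)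
  define c where "c = (\<integral>\<^sup>+w. ennreal \<bar>X w\<bar> \<partial>\<mu>)"
  have c: "c < \<infinity>" using X_int unfolding c_def by (simp add: integrable_iff_bounded)
  have one0: "(\<lambda>n. (killed_step b ^^ n) (\<lambda>_. 1) x) \<longlonglongrightarrow> 0"
  proof -
    define h where "h n = enn2real ((killed_step b ^^ n) (\<lambda>_. 1) x)" for n
    have h: "(killed_step b ^^ n) (\<lambda>_. 1) x = ennreal (h n)" for n
      unfolding h_def using step_iterate_bound[of "\<lambda>_. 1" 1 n b x]
      by (subst ennreal_enn2real) (auto simp: order_le_less_trans)
    have "summable h"
      using fin unfolding h by (intro summable_suminf_not_top) (auto simp: h_def)
    then have "h \<longlonglongrightarrow> 0" by (rule summable_LIMSEQ_zero)
    then show ?thesis unfolding h by (simp add: tendsto_ennrealI flip: ennreal_0)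
  qed
  define R where "R K = (\<Sum>k. (killed_step b ^^ k) (overshoot K) x)" for K
  have tail_c: "(killed_step b ^^ k) (overshoot K) x \<le> c * (killed_step b ^^ k) (\<lambda>_. 1) x" for k K
  proof -
    have "(killed_step b ^^ k) (overshoot K) x \<le> (killed_step b ^^ k) (\<lambda>s. c * 1) x"
      using overshoot_le x unfolding c_def by (intro step_iterate_mono) auto
    also have "\<dots> = c * (killed_step b ^^ k) (\<lambda>_. 1) x" by (rule step_iterate_cmult) simp
    finally show ?thesis .
  qed
  have R0: "R \<longlonglongrightarrow> 0"
  proof -
    have "(\<lambda>K. \<integral>\<^sup>+k. (killed_step b ^^ k) (overshoot K) x \<partial>count_space UNIV) \<longlonglongrightarrow> (\<integral>\<^sup>+(k::nat). 0 \<partial>count_space UNIV)"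
    proof (rule nn_integral_dominated_convergence[where w = "\<lambda>k. c * (killed_step b ^^ k) (\<lambda>_. 1) x"])
      show "(\<integral>\<^sup>+k. c * (killed_step b ^^ k) (\<lambda>_. 1) x \<partial>count_space UNIV) < \<infinity>"
        using fin c by (simp add: nn_integral_cmult nn_integral_count_space_nat ennreal_mult_less_top)
      show "AE k in count_space UNIV. (\<lambda>K. (killed_step b ^^ k) (overshoot K) x) \<longlonglongrightarrow> 0"
        by (intro AE_I2 step_iterate_tendsto_0[where c = c] overshoot_tendsto_0 X_int)
           (use c overshoot_le in \<open>auto simp: c_def\<close>)
    qed (use tail_c in auto)
    then show ?thesis by (simp add: R_def[abs_def] nn_integral_count_space_nat)
  qed
  have bound: "ennreal x \<le> of_nat K * (killed_step b ^^ n) (\<lambda>_. 1) x + (R K + V x)" if "x \<le> real K" for K n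
  proof -
    have "ennreal x \<le> (killed_step b ^^ n) (\<lambda>s. ennreal s) x + V x"
      by (rule id_le_step_iterate[OF X_int X_mean _ V x(1)]) auto
    also have "(killed_step b ^^ n) (\<lambda>s. ennreal s) x \<le> (killed_step b ^^ n) (\<lambda>s. of_nat K * 1 + ennreal (s - real K)) x"
    proof (intro step_iterate_mono x)
      fix s :: real
      have "ennreal s \<le> ennreal (real K + max 0 (s - real K))" by (intro ennreal_leI) auto
      also have "\<dots> = ennreal (real K) + ennreal (s - real K)"
        by (subst ennreal_plus) (auto simp: max_def ennreal_neg)
      finally show "ennreal s \<le> of_nat K * 1 + ennreal (s - real K)"
        by (simp add: ennreal_of_nat_eq_real_of_nat)
    qed
    also have "\<dots> = of_nat K * (killed_step b ^^ n) (\<lambda>_. 1) x + (killed_step b ^^ n) (\<lambda>s. ennreal (s - real K)) x"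
      using step_iterate_cmult[of "\<lambda>_. 1" n b "of_nat K" x]
      by (subst step_iterate_add) auto
    also have "(killed_step b ^^ n) (\<lambda>s. ennreal (s - real K)) x
        \<le> ennreal (x - real K) + (\<Sum>k<n. (killed_step b ^^ k) (overshoot K) x)"
      by (rule step_iterate_excess[OF X_int X_mean x(1)])
    also have "\<dots> \<le> R K"
      using that by (simp add: R_def ennreal_neg sum_le_suminf)
    finally show ?thesis by (simp add: add_left_mono add_right_mono add.assoc)
  qed
  have bound2: "ennreal x \<le> R K + V x" if "x \<le> real K" for K
  proof (rule LIMSEQ_le_const)
    have "(\<lambda>n. of_nat K * (killed_step b ^^ n) (\<lambda>_. 1) x + (R K + V x)) \<longlonglongrightarrow> of_nat K * 0 + (R K + V x)"
      by (intro tendsto_add tendsto_const ennreal_tendsto_cmult one0) (simp add: of_nat_less_top)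
    then show "(\<lambda>n. of_nat K * (killed_step b ^^ n) (\<lambda>_. 1) x + (R K + V x)) \<longlonglongrightarrow> R K + V x" by simp
    show "\<exists>N. \<forall>n\<ge>N. ennreal x \<le> of_nat K * (killed_step b ^^ n) (\<lambda>_. 1) x + (R K + V x)"
      using bound that by blast
  qed
  have "ennreal x \<le> V x"
  proof (rule LIMSEQ_le_const)
    have "(\<lambda>K. R K + V x) \<longlonglongrightarrow> 0 + V x" by (intro tendsto_add tendsto_const R0)
    then show "(\<lambda>K. R K + V x) \<longlonglongrightarrow> V x" by simp
    obtain N :: nat where "x \<le> real N" using real_arch_simple by blast
    then show "\<exists>N. \<forall>n\<ge>N. ennreal x \<le> R n + V x"
      using bound2 by (intro exI[of _ N]) (auto intro!: bound2)
  qed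
  with x show False by simp
qed

end

text \<open>
  Strict concavity of the power, quantified; the last term corrects for the region \<open>z < -1\<close>, where the power is
  cut off at 0 and the tangent becomes negative.
\<close>

lemma powr_concavity_gap:
  fixes \<beta> :: real
  assumes \<beta>: "0 < \<beta>" "\<beta> < 1"
  obtains c where "0 < c"
    and "\<And>z. max 0 (1 + z) powr \<beta> \<le> 1 + \<beta> * z - c * min 1 (z\<^sup>2) + 2 * (\<bar>z\<bar> * indicator {..< -1} z)"
proof
  define c where "c = \<beta> * (1 - \<beta>) / 8"
  show c: "0 < c" using \<beta> by (simp add: c_def)
  have c_le: "c \<le> 1 - \<beta>" using \<beta> mult_right_mono[of "\<beta> / 8" 1 "1 - \<beta>"] by (simp add: c_def)
  define h where "h z = 1 + \<beta> * z - c * z\<^sup>2 - (1 + z) powr \<beta>" for z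
  have mid: "(1 + z) powr \<beta> \<le> 1 + \<beta> * z - c * z\<^sup>2" if z: "-1 < z" "z \<le> 1" for z
  proof -
    have conv: "convex_on {-1<..1} h"
    proof (rule f''_ge0_imp_convex)
      fix x :: real assume x: "x \<in> {-1<..1}"
      show "DERIV h x :> \<beta> - 2 * c * x - \<beta> * (1 + x) powr (\<beta> - 1)"
        unfolding h_def using x by (auto intro!: derivative_eq_intros)
      show "DERIV (\<lambda>x. \<beta> - 2 * c * x - \<beta> * (1 + x) powr (\<beta> - 1)) x
          :> - 2 * c + \<beta> * (1 - \<beta>) * (1 + x) powr (\<beta> - 2)"
        using x by (auto intro!: derivative_eq_intros simp: algebra_simps)
      have "1 / 4 = (2::real) powr (- 2)" by (simp add: powr_minus powr_numeral)
      also have "\<dots> \<le> 2 powr (\<beta> - 2)" using \<beta> by (intro powr_mono) auto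
      also have "\<dots> \<le> (1 + x) powr (\<beta> - 2)"
        using x \<beta> by (intro powr_mono2') auto
      finally have "\<beta> * (1 - \<beta>) * (1 / 4) \<le> \<beta> * (1 - \<beta>) * (1 + x) powr (\<beta> - 2)"
        using \<beta> by (intro mult_left_mono) auto
      then show "0 \<le> - 2 * c + \<beta> * (1 - \<beta>) * (1 + x) powr (\<beta> - 2)"
        by (simp add: c_def)
    qed auto
    have "0 * (z - 0) \<le> h z - h 0"
    proof (rule convex_on_imp_above_tangent[OF conv])
      show "0 \<in> interior {-1<..1::real}"
        by (rule interiorI[of "{-1<..<1}"]) auto
      show "(h has_real_derivative 0) (at 0 within {- 1<..1})"
        unfolding h_def by (auto intro!: derivative_eq_intros)
    qed (use z in auto)
    then show ?thesis by (simp add: h_def)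
  qed
  show "max 0 (1 + z) powr \<beta> \<le> 1 + \<beta> * z - c * min 1 (z\<^sup>2) + 2 * (\<bar>z\<bar> * indicator {..< -1} z)" for z
  proof -
    consider "z < -1" | "z = -1" | "-1 < z" "z \<le> 1" | "1 < z" by linarith
    then show ?thesis
    proof cases
      case 1
      then have "min 1 (z\<^sup>2) = 1" using power_mono[of 1 "- z" 2] by simp
      moreover have "max 0 (1 + z) powr \<beta> = 0" "\<bar>z\<bar> * indicator {..< -1} z = - z"
        using 1 by simp_all
      moreover have bz: "z \<le> \<beta> * z" using 1 \<beta> mult_right_mono_neg[of \<beta> 1 z] by simp
      have "0 \<le> 1 + \<beta> * z - c * 1 + 2 * (- z)" using 1 bz c_le \<beta> by linarith
      ultimately show ?thesis by (simp only:)
    next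
      case 2
      then show ?thesis using c_le by simp
    next
      case 3
      have "z\<^sup>2 \<le> 1" using 3 by (simp add: abs_square_le_1)
      then show ?thesis using 3 mid[OF 3] by (simp add: max_def min_def)
    next
      case 4
      define k where "k z = 1 + \<beta> * z - (1 + z) powr \<beta>" for z
      have "k 1 \<le> k z"
      proof (rule DERIV_nonneg_imp_nondecreasing[of 1 z k])
        fix x :: real assume x: "1 \<le> x" "x \<le> z"
        have "(1 + x) powr (\<beta> - 1) \<le> 1 powr (\<beta> - 1)"
          using x \<beta> by (intro powr_mono2') auto
        then have "0 \<le> \<beta> * (1 - (1 + x) powr (\<beta> - 1))" using \<beta> by simp
        moreover have "DERIV k x :> \<beta> * (1 - (1 + x) powr (\<beta> - 1))"
          unfolding k_def using x by (auto intro!: derivative_eq_intros simp: algebra_simps)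
        ultimately show "\<exists>y. DERIV k x :> y \<and> 0 \<le> y" by blast
      qed (use 4 in simp)
      moreover have "c \<le> k 1" using mid[of 1] by (simp add: k_def)
      moreover have "1 \<le> z\<^sup>2" using 4 by (simp add: one_le_power)
      ultimately show ?thesis using 4 by (simp add: k_def max_def min_def)
    qed
  qed
qed

lemma powr_mult_exp_le:
  fixes r y :: real
  assumes "0 < r" "0 < y"
  shows "exp (- y / 2) \<le> (2 * r) powr r * y powr (- r)"
proof -
  have "ln (y / (2 * r)) \<le> y / (2 * r) - 1" using assms by (intro ln_le_minus_one) auto
  then have "r * ln (y / (2 * r)) \<le> r * (y / (2 * r))"
    using assms by (intro mult_left_mono) auto
  then have "r * (ln y - ln (2 * r)) \<le> y / 2" using assms by (simp add: ln_div)
  then have "exp (- y / 2) \<le> exp (r * ln (2 * r) - r * ln y)"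
    by (simp add: algebra_simps)
  then show ?thesis using assms by (simp add: powr_def exp_diff exp_minus field_simps)
qed

context random_step begin

text \<open>
  Soft killing is noticeable only if \<open>\<xi>\<close> is comparable to the position; up to constants this is bounded by any
  power of \<open>(1 + \<xi>) / (s + b)\<close>.
\<close>

lemma loss_weight_le:
  assumes r: "0 < r"
  obtains C where "0 < C"
    and "\<And>s b w. 1 \<le> s + b \<Longrightarrow> 0 \<le> \<xi> w \<Longrightarrow> 1 - survival b s w \<le> C * ((1 + \<xi> w) powr r * (s + b) powr (- r))"
proof
  define C where "C = 2 powr r + 2 * (2 * r) powr r"
  show "0 < C" using r by (simp add: C_def add_pos_nonneg)
  fix s b :: real and w assume y: "1 \<le> s + b" and \<xi>: "0 \<le> \<xi> w"
  define y where "y = s + b"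
  have y1: "1 \<le> y" using y by (simp add: y_def)
  show "1 - survival b s w \<le> C * ((1 + \<xi> w) powr r * (s + b) powr (- r))"
  proof (cases "y \<le> 2 * (1 + \<xi> w)")
    case True
    have "1 - survival b s w \<le> 1" using survival_nonneg[of b s w] by simp
    also have "1 = 2 powr r * (1 / 2) powr r" using r by (simp flip: powr_mult)
    also have "\<dots> \<le> C * ((1 + \<xi> w) / y) powr r"
      using True y1 r \<xi> by (intro mult_mono powr_mono2) (auto simp: C_def field_simps)
    also have "((1 + \<xi> w) / y) powr r = (1 + \<xi> w) powr r * y powr (- r)"
      using y1 \<xi> by (simp add: powr_divide powr_minus_divide)
    finally show ?thesis by (simp add: y_def)
  next
    case False
    define t where "t = exp (\<xi> w - y)"
    have t: "0 < t" by (simp add: t_def)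
    have "1 - survival b s w = 1 - 1 / (1 + t)\<^sup>2" by (simp add: survival_def t_def y_def)
    also have "\<dots> \<le> 2 * t"
    proof -
      have "(1 - 2 * t) * (1 + t)\<^sup>2 = 1 - (3 * t\<^sup>2 + 2 * t ^ 3)"
        by (simp add: power2_eq_square power3_eq_cube algebra_simps)
      then have "(1 - 2 * t) * (1 + t)\<^sup>2 \<le> 1" using t zero_less_power[of t 2] zero_less_power[of t 3] by linarith
      then have "1 - 2 * t \<le> 1 / (1 + t)\<^sup>2" using t by (subst pos_le_divide_eq) auto
      then show ?thesis by simp
    qed
    also have "t \<le> exp (- y / 2)" using False by (simp add: t_def)
    also have "exp (- y / 2) \<le> (2 * r) powr r * y powr (- r)"
      by (rule powr_mult_exp_le) (use r y1 in auto)
    also have "2 * ((2 * r) powr r * y powr (- r)) \<le> C * ((1 + \<xi> w) powr r * y powr (- r))"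
    proof -
      have "2 * (2 * r) powr r \<le> C" by (simp add: C_def)
      moreover have "1 \<le> (1 + \<xi> w) powr r" using \<xi> r by (simp add: ge_one_powr_ge_zero)
      ultimately have "2 * (2 * r) powr r * 1 \<le> C * (1 + \<xi> w) powr r"
        by (intro mult_mono) (auto simp: C_def)
      then have "2 * (2 * r) powr r * y powr (- r) \<le> C * (1 + \<xi> w) powr r * y powr (- r)"
        by (intro mult_right_mono) auto
      then show ?thesis by (simp add: mult_ac)
    qed
    finally show ?thesis by (simp add: y_def)
  qed
qed

text \<open>
  The Lyapunov function is \<open>V s = M (s + b)\<^sup>\<beta>\<close> with \<open>\<beta> = 1 - \<delta> < 1\<close>.  At \<open>y = s + b\<close> the concavity gap gives a gain of
  order \<open>y\<^sup>\<beta> y\<^sup>-\<^sup>\<alpha>\<^sup>-\<^sup>\<delta>\<close>, the truncated second moment at level \<open>y\<close>.  The two kinds of loss are of smaller or equal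
  order: falling below 0 requires \<open>\<xi> > y\<close>, and soft killing costs at most \<open>y\<^sup>1\<^sup>-\<^sup>\<alpha>\<^sup>-\<^sup>\<epsilon> + y\<^sup>-\<^sup>p\<close>.
\<close>

theorem recurrence_criterion:
  fixes \<alpha> \<epsilon> p :: real
  assumes X_int: "integrable \<mu> X" and X_mean: "(\<integral>w. X w \<partial>\<mu>) = 0"
    and \<alpha>: "1 < \<alpha>" and \<epsilon>: "0 < \<epsilon>"
    and \<xi>_int: "integrable \<mu> (\<lambda>w. (1 + \<xi> w) powr (\<alpha> + \<epsilon>))"
    and p: "\<alpha> - 1 < p" and \<xi>X_int: "integrable \<mu> (\<lambda>w. (1 + \<xi> w) powr p * \<bar>X w\<bar>)"
    and spread: "\<And>\<delta>. 0 < \<delta> \<Longrightarrow> \<exists>c>0. \<exists>y1. \<forall>y\<ge>y1. c * y powr (- (\<alpha> + \<delta>)) \<le> (\<integral>w. min 1 ((X w / y)\<^sup>2) \<partial>\<mu>)"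
  obtains b x where "0 \<le> b" "0 \<le> x" "(\<Sum>n. (killed_step b ^^ n) (\<lambda>_. 1) x) = \<infinity>"
proof -
  \<comment> \<open>The factor 1/2 leaves room for the loss of \<open>\<delta>\<close> both in \<open>\<beta>\<close> and in the truncated second moment.\<close>
  define \<delta> where "\<delta> = min (min (p - \<alpha> + 1) \<epsilon>) 1 / 2"
  have \<delta>: "0 < \<delta>" "\<delta> < 1" "2 * \<delta> \<le> p - \<alpha> + 1" "2 * \<delta> \<le> \<epsilon>" "\<delta> < \<epsilon>"
    using p \<epsilon> by (auto simp: \<delta>_def)
  define \<beta> where "\<beta> = 1 - \<delta>"
  have \<beta>: "0 < \<beta>" "\<beta> < 1" using \<delta> by (auto simp: \<beta>_def)
  define e where "e = 1 - \<alpha> - 2 * \<delta>"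
  define m1 where "m1 = (\<integral>w. (1 + \<xi> w) powr (\<alpha> + \<epsilon>) \<partial>\<mu>)"
  define m2 where "m2 = (\<integral>w. (1 + \<xi> w) powr p * \<bar>X w\<bar> \<partial>\<mu>)"
  have m1: "0 \<le> m1" unfolding m1_def by (intro integral_nonneg_AE) auto
  have m2: "0 \<le> m2" unfolding m2_def by (intro integral_nonneg_AE) auto
  obtain C where C: "0 < C" "\<And>s b w. 1 \<le> s + b \<Longrightarrow> 0 \<le> \<xi> w \<Longrightarrow> 1 - survival b s w \<le> C * ((1 + \<xi> w) powr (\<alpha> + \<epsilon>) * (s + b) powr (- (\<alpha> + \<epsilon>)))"
    using loss_weight_le[of "\<alpha> + \<epsilon>"] \<alpha> \<epsilon> by auto
  obtain C' where C': "0 < C'" "\<And>s b w. 1 \<le> s + b \<Longrightarrow> 0 \<le> \<xi> w \<Longrightarrow> 1 - survival b s w \<le> C' * ((1 + \<xi> w) powr p * (s + b) powr (- p))"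
    using loss_weight_le[of p] \<alpha> p by auto
  define C1 where "C1 = C * m1 + C' * m2 + 1"
  have C1: "0 < C1" using C(1) C'(1) m1 m2 by (simp add: C1_def add_nonneg_pos)
  have loss_le: "loss b s \<le> ennreal (C1 * (s + b) powr e)" if s: "0 \<le> s" and b: "1 \<le> b" for s b
  proof -
    define y where "y = s + b"
    have y: "1 \<le> y" "s \<le> y" using s b by (auto simp: y_def)
    have "loss b s \<le> (\<integral>\<^sup>+w. ennreal (C * y powr (1 - \<alpha> - \<epsilon>) * (1 + \<xi> w) powr (\<alpha> + \<epsilon>)
                      + C' * y powr (- p) * ((1 + \<xi> w) powr p * \<bar>X w\<bar>)) \<partial>\<mu>)"
      unfolding loss_def
    proof (rule nn_integral_mono_AE, use \<xi>_nonneg in eventually_elim)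
      case (elim w)
      define d where "d = 1 - survival b s w"
      have d: "0 \<le> d" using survival_le_1 by (simp add: d_def)
      have "ennreal d * ennreal (s + X w) \<le> ennreal d * ennreal (y + \<bar>X w\<bar>)"
        using y by (intro mult_left_mono ennreal_leI) auto
      also have "\<dots> = ennreal (d * y + d * \<bar>X w\<bar>)"
        using d y by (simp add: distrib_left flip: ennreal_mult)
      also have "\<dots> \<le> ennreal (C * ((1 + \<xi> w) powr (\<alpha> + \<epsilon>) * y powr (- (\<alpha> + \<epsilon>))) * y
           + C' * ((1 + \<xi> w) powr p * y powr (- p)) * \<bar>X w\<bar>)"
        using C(2)[of s b w] C'(2)[of s b w] elim y
        by (intro ennreal_leI add_mono mult_right_mono) (auto simp: d_def y_def)
      also have "C * ((1 + \<xi> w) powr (\<alpha> + \<epsilon>) * y powr (- (\<alpha> + \<epsilon>))) * y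
          = C * y powr (1 - \<alpha> - \<epsilon>) * (1 + \<xi> w) powr (\<alpha> + \<epsilon>)"
      proof -
        have "y * y powr (- (\<alpha> + \<epsilon>)) = y powr (1 - \<alpha> - \<epsilon>)"
          using y powr_mult_base[of y "- (\<alpha> + \<epsilon>)"] by (simp add: algebra_simps)
        then show ?thesis by (simp add: mult_ac)
      qed
      finally show ?case by (simp add: d_def mult_ac)
    qed
    also have "\<dots> = ennreal (\<integral>w. C * y powr (1 - \<alpha> - \<epsilon>) * (1 + \<xi> w) powr (\<alpha> + \<epsilon>)
                      + C' * y powr (- p) * ((1 + \<xi> w) powr p * \<bar>X w\<bar>) \<partial>\<mu>)"
      using C(1) C'(1) \<xi>_int \<xi>X_int
      by (intro nn_integral_eq_integral Bochner_Integration.integrable_add integrable_mult_right) auto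
    also have "(\<integral>w. C * y powr (1 - \<alpha> - \<epsilon>) * (1 + \<xi> w) powr (\<alpha> + \<epsilon>)
                      + C' * y powr (- p) * ((1 + \<xi> w) powr p * \<bar>X w\<bar>) \<partial>\<mu>)
         = C * y powr (1 - \<alpha> - \<epsilon>) * m1 + C' * y powr (- p) * m2"
      unfolding m1_def m2_def
      by (subst Bochner_Integration.integral_add) (auto intro!: integrable_mult_right \<xi>_int \<xi>X_int)
    also have "\<dots> \<le> C * y powr e * m1 + C' * y powr e * m2"
      using y \<delta> C(1) C'(1) m1 m2
      by (intro add_mono mult_right_mono mult_left_mono powr_mono) (auto simp: e_def)
    also have "\<dots> \<le> C1 * y powr e" by (simp add: C1_def algebra_simps)
    finally show ?thesis by (simp add: y_def ennreal_leI)
  qed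
  obtain c where c: "0 < c"
    and gap: "\<And>z. max 0 (1 + z) powr \<beta> \<le> 1 + \<beta> * z - c * min 1 (z\<^sup>2) + 2 * (\<bar>z\<bar> * indicator {..< -1} z)"
    using powr_concavity_gap[OF \<beta>] by blast
  obtain c2 y1 where c2: "0 < c2"
    and D: "\<And>y. y1 \<le> y \<Longrightarrow> c2 * y powr (- (\<alpha> + \<delta>)) \<le> (\<integral>w. min 1 ((X w / y)\<^sup>2) \<partial>\<mu>)"
    using spread[OF \<delta>(1)] by blast
  \<comment> \<open>Above this level, steps below \<open>-y\<close> cost at most half of the gain.\<close>
  define b where "b = max (max 1 y1) ((4 * m1 / (c * c2)) powr (1 / (\<epsilon> - \<delta>)))"
  have b: "1 \<le> b" "y1 \<le> b" "(4 * m1 / (c * c2)) powr (1 / (\<epsilon> - \<delta>)) \<le> b" by (auto simp: b_def)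
  define c3 where "c3 = c * c2 / 2"
  have c3: "0 < c3" using c c2 by (simp add: c3_def)
  define M where "M = C1 / c3"
  have M: "0 < M" using C1 c3 by (simp add: M_def)
  define V where "V s = ennreal (M * (s + b) powr \<beta>)" for s
  have V: "killed_step b V s + loss b s \<le> V s" if s: "0 \<le> s" for s
  proof -
    define y where "y = s + b"
    have y: "1 \<le> y" "b \<le> y" "y1 \<le> y" using s b by (auto simp: y_def)
    define I where "I = (\<integral>w. \<bar>X w / y\<bar> * indicator {..< -1} (X w / y) \<partial>\<mu>)"
    define Dy where "Dy = (\<integral>w. min 1 ((X w / y)\<^sup>2) \<partial>\<mu>)"
    have I_int: "integrable \<mu> (\<lambda>w. \<bar>X w / y\<bar> * indicator {..< -1} (X w / y))"
      by (rule Bochner_Integration.integrable_bound[OF integrable_divide[OF X_int, of y]])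
         (auto simp: indicator_def)
    have D_int: "integrable \<mu> (\<lambda>w. min 1 ((X w / y)\<^sup>2))"
      by (rule integrable_const_bound[of _ 1]) auto
    have I_le: "I \<le> y powr (- (\<alpha> + \<epsilon>)) * m1"
    proof -
      have "I \<le> (\<integral>w. y powr (- (\<alpha> + \<epsilon>)) * (1 + \<xi> w) powr (\<alpha> + \<epsilon>) \<partial>\<mu>)"
        unfolding I_def
      proof (intro integral_mono_AE I_int integrable_mult_right \<xi>_int)
        show "AE w in \<mu>. \<bar>X w / y\<bar> * indicator {..<- 1} (X w / y) \<le> y powr (- (\<alpha> + \<epsilon>)) * (1 + \<xi> w) powr (\<alpha> + \<epsilon>)"
          using \<xi>_nonneg X_lower
        proof eventually_elim
          case (elim w)
          show ?case
          proof (cases "X w / y < -1")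
            case True
            then have "X w < - y" using y by (simp add: field_simps)
            then have le: "\<bar>X w\<bar> \<le> 1 + \<xi> w" "y < 1 + \<xi> w" using elim y by auto
            have "\<bar>X w / y\<bar> \<le> ((1 + \<xi> w) / y) powr 1"
              using le y by (simp add: divide_right_mono)
            also have "\<dots> \<le> ((1 + \<xi> w) / y) powr (\<alpha> + \<epsilon>)"
              using le y \<alpha> \<epsilon> by (intro powr_mono) auto
            also have "\<dots> = y powr (- (\<alpha> + \<epsilon>)) * (1 + \<xi> w) powr (\<alpha> + \<epsilon>)"
              using y elim powr_minus_divide[of y "\<alpha> + \<epsilon>"] by (simp add: powr_divide)
            finally show ?thesis by (auto simp: indicator_def)
          qed simp
        qed
      qed
      also have "\<dots> = y powr (- (\<alpha> + \<epsilon>)) * m1" by (simp add: m1_def)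
      finally show ?thesis .
    qed
    have "killed_step b V s \<le> (\<integral>\<^sup>+w. ennreal (M * y powr \<beta> * (1 + \<beta> * (X w / y) - c * min 1 ((X w / y)\<^sup>2)
             + 2 * (\<bar>X w / y\<bar> * indicator {..< -1} (X w / y)))) \<partial>\<mu>)"
      unfolding killed_step_def
    proof (rule nn_integral_mono)
      fix w
      have "ennreal (survival b s w) * (indicator {0..} (s + X w) * V (s + X w))
          \<le> 1 * ennreal (M * max 0 (y + X w) powr \<beta>)"
      proof (rule mult_mono)
        show "ennreal (survival b s w) \<le> 1" using survival_le_1 by (simp add: ennreal_le_1)
        show "indicator {0..} (s + X w) * V (s + X w) \<le> ennreal (M * max 0 (y + X w) powr \<beta>)"
          using b M by (auto simp: indicator_def V_def y_def max_def add_ac intro!: ennreal_leI mult_left_mono)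
      qed auto
      also have "max 0 (y + X w) = y * max 0 (1 + X w / y)"
        using y by (auto simp: max_def field_simps)
      also have "\<dots> powr \<beta> = y powr \<beta> * max 0 (1 + X w / y) powr \<beta>"
        by (rule powr_mult)
      also have "1 * ennreal (M * (y powr \<beta> * max 0 (1 + X w / y) powr \<beta>))
         \<le> ennreal (M * y powr \<beta> * (1 + \<beta> * (X w / y) - c * min 1 ((X w / y)\<^sup>2)
             + 2 * (\<bar>X w / y\<bar> * indicator {..< -1} (X w / y))))"
      proof -
        have "M * y powr \<beta> * max 0 (1 + X w / y) powr \<beta> \<le> M * y powr \<beta> * (1 + \<beta> * (X w / y) - c * min 1 ((X w / y)\<^sup>2)
             + 2 * (\<bar>X w / y\<bar> * indicator {..< -1} (X w / y)))"
          using M by (intro mult_left_mono gap) auto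
        then show ?thesis by (simp add: ennreal_leI mult.assoc)
      qed
      finally show "ennreal (survival b s w) * (indicator {0..} (s + X w) * V (s + X w))
         \<le> ennreal (M * y powr \<beta> * (1 + \<beta> * (X w / y) - c * min 1 ((X w / y)\<^sup>2)
             + 2 * (\<bar>X w / y\<bar> * indicator {..< -1} (X w / y))))" .
    qed
    also have "\<dots> = ennreal (\<integral>w. M * y powr \<beta> * (1 + \<beta> * (X w / y) - c * min 1 ((X w / y)\<^sup>2)
             + 2 * (\<bar>X w / y\<bar> * indicator {..< -1} (X w / y))) \<partial>\<mu>)"
    proof (rule nn_integral_eq_integral)
      show "integrable \<mu> (\<lambda>w. M * y powr \<beta> * (1 + \<beta> * (X w / y) - c * min 1 ((X w / y)\<^sup>2)
             + 2 * (\<bar>X w / y\<bar> * indicator {..< -1} (X w / y))))"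
        by (intro integrable_mult_right Bochner_Integration.integrable_add Bochner_Integration.integrable_diff
              integrable_const integrable_divide X_int D_int I_int)
      show "AE w in \<mu>. 0 \<le> M * y powr \<beta> * (1 + \<beta> * (X w / y) - c * min 1 ((X w / y)\<^sup>2)
             + 2 * (\<bar>X w / y\<bar> * indicator {..< -1} (X w / y)))"
      proof (rule AE_I2)
        fix w
        have "0 \<le> max 0 (1 + X w / y) powr \<beta>" by simp
        then show "0 \<le> M * y powr \<beta> * (1 + \<beta> * (X w / y) - c * min 1 ((X w / y)\<^sup>2)
             + 2 * (\<bar>X w / y\<bar> * indicator {..< -1} (X w / y)))"
          using M order_trans[OF _ gap[of "X w / y"]] by simp
      qed
    qed
    also have "(\<integral>w. M * y powr \<beta> * (1 + \<beta> * (X w / y) - c * min 1 ((X w / y)\<^sup>2)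
             + 2 * (\<bar>X w / y\<bar> * indicator {..< -1} (X w / y))) \<partial>\<mu>)
         = M * y powr \<beta> * (1 - c * Dy + 2 * I)"
    proof -
      have "(\<integral>w. 1 + \<beta> * (X w / y) - c * min 1 ((X w / y)\<^sup>2)
             + 2 * (\<bar>X w / y\<bar> * indicator {..< -1} (X w / y)) \<partial>\<mu>)
          = (\<integral>w. 1 + \<beta> * (X w / y) \<partial>\<mu>) - c * Dy + 2 * I"
        unfolding Dy_def I_def
        by (subst Bochner_Integration.integral_add Bochner_Integration.integral_diff;
            (intro integrable_mult_right Bochner_Integration.integrable_add Bochner_Integration.integrable_diff
              integrable_const integrable_divide X_int D_int I_int)?; simp)+
      also have "(\<integral>w. 1 + \<beta> * (X w / y) \<partial>\<mu>) = 1"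
        using X_int X_mean by (simp add: prob_space)
      finally show ?thesis by simp
    qed
    finally have step_le: "killed_step b V s \<le> ennreal (M * y powr \<beta> * (1 - c * Dy + 2 * I))" .
    have gain: "C1 * y powr e \<le> M * y powr \<beta> * (c * Dy - 2 * I)"
    proof -
      have small: "2 * (y powr (- (\<alpha> + \<epsilon>)) * m1) \<le> c3 * y powr (- (\<alpha> + \<delta>))"
      proof (cases "m1 = 0")
        case False
        then have m1: "0 < m1" using m1 by simp
        have "4 * m1 / (c * c2) = ((4 * m1 / (c * c2)) powr (1 / (\<epsilon> - \<delta>))) powr (\<epsilon> - \<delta>)"
          using \<delta> m1 c c2 by (simp add: powr_powr)
        also have "\<dots> \<le> y powr (\<epsilon> - \<delta>)"
          using b y \<delta> by (intro powr_mono2) auto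
        finally have "2 * m1 \<le> c3 * y powr (\<epsilon> - \<delta>)"
          using c c2 by (simp add: c3_def field_simps)
        then have "2 * m1 * y powr (- (\<alpha> + \<epsilon>)) \<le> c3 * y powr (\<epsilon> - \<delta>) * y powr (- (\<alpha> + \<epsilon>))"
          by (intro mult_right_mono) auto
        also have "\<dots> = c3 * y powr (- (\<alpha> + \<delta>))"
        proof -
          have "\<epsilon> - \<delta> + - (\<alpha> + \<epsilon>) = - (\<alpha> + \<delta>)" by simp
          then show ?thesis by (simp only: mult.assoc powr_add[symmetric])
        qed
        finally show ?thesis by (simp add: mult_ac)
      qed (use c3 in simp)
      have "c3 * y powr (- (\<alpha> + \<delta>)) = c * (c2 * y powr (- (\<alpha> + \<delta>))) - c3 * y powr (- (\<alpha> + \<delta>))"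
        by (simp add: c3_def)
      also have "\<dots> \<le> c * Dy - 2 * I"
        using D[OF y(3)] small I_le c unfolding Dy_def by (intro diff_mono mult_left_mono) auto
      finally have "M * y powr \<beta> * (c3 * y powr (- (\<alpha> + \<delta>))) \<le> M * y powr \<beta> * (c * Dy - 2 * I)"
        using M by (intro mult_left_mono) auto
      moreover have "M * y powr \<beta> * (c3 * y powr (- (\<alpha> + \<delta>))) = C1 * (y powr \<beta> * y powr (- (\<alpha> + \<delta>)))"
        using c3 by (simp add: M_def)
      moreover have "y powr \<beta> * y powr (- (\<alpha> + \<delta>)) = y powr e"
        by (simp flip: powr_add add: \<beta>_def e_def)
      ultimately show ?thesis by (simp only:)
    qed
    have nonneg: "0 \<le> M * y powr \<beta> * (1 - c * Dy + 2 * I)"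
    proof -
      have "0 \<le> (\<integral>w. 1 + \<beta> * (X w / y) - c * min 1 ((X w / y)\<^sup>2)
             + 2 * (\<bar>X w / y\<bar> * indicator {..< -1} (X w / y)) \<partial>\<mu>)"
      proof (intro integral_nonneg_AE AE_I2)
        fix w
        have "0 \<le> max 0 (1 + X w / y) powr \<beta>" by simp
        also note gap[of "X w / y"]
        finally show "0 \<le> 1 + \<beta> * (X w / y) - c * min 1 ((X w / y)\<^sup>2)
             + 2 * (\<bar>X w / y\<bar> * indicator {..< -1} (X w / y))" .
      qed
      also have "\<dots> = (\<integral>w. 1 + \<beta> * (X w / y) \<partial>\<mu>) - c * Dy + 2 * I"
        unfolding Dy_def I_def
        by (subst Bochner_Integration.integral_add Bochner_Integration.integral_diff;
            (intro integrable_mult_right Bochner_Integration.integrable_add Bochner_Integration.integrable_diff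
              integrable_const integrable_divide X_int D_int I_int)?; simp)+
      also have "(\<integral>w. 1 + \<beta> * (X w / y) \<partial>\<mu>) = 1"
        using X_int X_mean by (simp add: prob_space)
      finally show ?thesis using M by simp
    qed
    have "killed_step b V s + loss b s \<le> ennreal (M * y powr \<beta> * (1 - c * Dy + 2 * I)) + ennreal (C1 * y powr e)"
      using step_le loss_le[OF s b(1)] by (intro add_mono) (auto simp: y_def)
    also have "\<dots> = ennreal (M * y powr \<beta> * (1 - c * Dy + 2 * I) + C1 * y powr e)"
      using nonneg C1 by (intro ennreal_plus[symmetric]) auto
    also have "\<dots> \<le> ennreal (M * y powr \<beta>)"
      using gain by (intro ennreal_leI) (simp add: algebra_simps)
    finally show ?thesis by (simp add: V_def y_def)
  qed
  \<comment> \<open>A start so high that the sublinear \<open>V\<close> lies below the identity.\<close>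
  define x where "x = max b ((2 * M + 1) powr (1 / \<delta>))"
  have x: "b \<le> x" "(2 * M + 1) powr (1 / \<delta>) \<le> x" by (auto simp: x_def)
  have x1: "1 \<le> x" using x b by simp
  have "M * (x + b) powr \<beta> < x"
  proof -
    have "2 * M + 1 = ((2 * M + 1) powr (1 / \<delta>)) powr \<delta>" using \<delta> M by (simp add: powr_powr)
    also have "\<dots> \<le> x powr \<delta>" using x \<delta> by (intro powr_mono2) auto
    finally have "2 * M < x powr \<delta>" by simp
    then have "2 * M * x powr \<beta> < x powr \<delta> * x powr \<beta>" using x1 by (intro mult_strict_right_mono) auto
    also have "\<dots> = x" using x1 by (simp add: \<beta>_def flip: powr_add)
    finally have less: "2 * M * x powr \<beta> < x" .
    have "(x + b) powr \<beta> \<le> (2 * x) powr \<beta>" using x b \<beta> by (intro powr_mono2) auto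
    also have "\<dots> = 2 powr \<beta> * x powr \<beta>" by (rule powr_mult)
    also have "\<dots> \<le> 2 powr 1 * x powr \<beta>" using \<beta> by (intro mult_right_mono powr_mono) auto
    finally have "M * (x + b) powr \<beta> \<le> M * (2 * x powr \<beta>)" using M by (intro mult_left_mono) auto
    with less show ?thesis by (simp add: mult_ac)
  qed
  then have Vx: "V x < ennreal x" using M x1 by (simp add: V_def ennreal_less_iff)
  have [measurable]: "V \<in> borel_measurable borel" unfolding V_def by measurable
  show ?thesis
    by (rule that[of b x]) (use b x1 green_function_infinite[OF X_int X_mean _ V _ Vx] in auto)
qed

end

section \<open>The operator on geometric weights\<close>

context random_step begin

definition thinning :: "real \<Rightarrow> 'a \<Rightarrow> real" where
  "thinning H w = 1 + H * (exp (\<xi> w) - 1)"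

text \<open>
  If a population is started with weights \<open>(1 - H)\<^sup>k\<^sup>-\<^sup>1\<close>, one generation multiplies the weights by
  \<open>e\<^sup>-\<^sup>X / thinning\<^sup>2\<close> and replaces \<open>H\<close> by \<open>H e\<^sup>-\<^sup>X / thinning\<close>; the factor \<open>e\<^sup>-\<^sup>X\<close> is absorbed in the tilted law.
\<close>

definition geom_step :: "(real \<Rightarrow> ennreal) \<Rightarrow> real \<Rightarrow> ennreal" where
  "geom_step \<phi> H = (\<integral>\<^sup>+w. ennreal (1 / (thinning H w)\<^sup>2) * \<phi> (H * exp (- X w) / thinning H w) \<partial>\<mu>)"

lemma thinning_measurable [measurable]:
  "thinning H \<in> borel_measurable \<mu>"
  "(\<lambda>x. thinning (fst x) (snd x)) \<in> borel_measurable (borel \<Otimes>\<^sub>M \<mu>)"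
  unfolding thinning_def by measurable

lemma geom_step_measurable [measurable]:
  assumes [measurable]: "\<phi> \<in> borel_measurable borel"
  shows "geom_step \<phi> \<in> borel_measurable borel"
  unfolding geom_step_def by measurable

lemma geom_step_iterate_measurable [measurable]:
  "\<phi> \<in> borel_measurable borel \<Longrightarrow> (geom_step ^^ n) \<phi> \<in> borel_measurable borel"
  by (induction n) auto

lemma thinning_ge_1: "0 \<le> H \<Longrightarrow> 0 \<le> \<xi> w \<Longrightarrow> 1 \<le> thinning H w"
  by (simp add: thinning_def)

lemma parameter_in_unit_interval:
  assumes "0 < H" "H \<le> 1" "0 \<le> \<xi> w" "- \<xi> w \<le> X w"
  shows "0 < H * exp (- X w) / thinning H w" "H * exp (- X w) / thinning H w \<le> 1"
proof -
  have t: "1 \<le> thinning H w" using assms by (intro thinning_ge_1) auto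
  then show "0 < H * exp (- X w) / thinning H w" using assms by simp
  have "H * exp (- X w) \<le> H * exp (\<xi> w)" using assms by simp
  also have "\<dots> \<le> thinning H w" using assms by (simp add: thinning_def algebra_simps)
  finally show "H * exp (- X w) / thinning H w \<le> 1" using t by (simp add: divide_le_eq)
qed

lemma geom_step_mono:
  assumes "\<And>H. 0 < H \<Longrightarrow> H \<le> 1 \<Longrightarrow> \<phi> H \<le> \<psi> H" and H: "0 < H" "H \<le> 1"
  shows "geom_step \<phi> H \<le> geom_step \<psi> H"
  unfolding geom_step_def
proof (rule nn_integral_mono_AE, use \<xi>_nonneg X_lower in eventually_elim)
  case (elim w)
  then show ?case
    using parameter_in_unit_interval[OF H] by (intro mult_left_mono assms) auto
qed

lemma geom_step_iterate_mono:
  assumes "\<And>H. 0 < H \<Longrightarrow> H \<le> 1 \<Longrightarrow> \<phi> H \<le> \<psi> H" and "0 < H" "H \<le> 1"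
  shows "(geom_step ^^ n) \<phi> H \<le> (geom_step ^^ n) \<psi> H"
  using assms(2,3) by (induction n arbitrary: H) (auto intro: assms(1) geom_step_mono)

lemma geom_step_iterate_cong:
  assumes "\<And>H. 0 < H \<Longrightarrow> H \<le> 1 \<Longrightarrow> \<phi> H = \<psi> H" and "0 < H" "H \<le> 1"
  shows "(geom_step ^^ n) \<phi> H = (geom_step ^^ n) \<psi> H"
  using assms by (intro antisym geom_step_iterate_mono) auto

lemma geom_step_add:
  assumes [measurable]: "\<phi> \<in> borel_measurable borel" "\<psi> \<in> borel_measurable borel"
  shows "geom_step (\<lambda>H. \<phi> H + \<psi> H) = (\<lambda>H. geom_step \<phi> H + geom_step \<psi> H)"
  unfolding geom_step_def by (simp add: distrib_left nn_integral_add)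

lemma geom_step_iterate_add:
  assumes [measurable]: "\<phi> \<in> borel_measurable borel" "\<psi> \<in> borel_measurable borel"
  shows "(geom_step ^^ n) (\<lambda>H. \<phi> H + \<psi> H) = (\<lambda>H. (geom_step ^^ n) \<phi> H + (geom_step ^^ n) \<psi> H)"
  by (induction n) (simp_all add: geom_step_add)

lemma geom_step_cmult:
  assumes [measurable]: "\<phi> \<in> borel_measurable borel"
  shows "geom_step (\<lambda>H. c * \<phi> H) = (\<lambda>H. c * geom_step \<phi> H)"
proof
  fix H
  have "geom_step (\<lambda>H. c * \<phi> H) H
      = (\<integral>\<^sup>+w. c * (ennreal (1 / (thinning H w)\<^sup>2) * \<phi> (H * exp (- X w) / thinning H w)) \<partial>\<mu>)"
    unfolding geom_step_def by (intro nn_integral_cong) (simp add: mult_ac)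
  also have "\<dots> = c * geom_step \<phi> H"
    unfolding geom_step_def by (rule nn_integral_cmult) measurable
  finally show "geom_step (\<lambda>H. c * \<phi> H) H = c * geom_step \<phi> H" .
qed

lemma geom_step_iterate_cmult:
  assumes [measurable]: "\<phi> \<in> borel_measurable borel"
  shows "(geom_step ^^ n) (\<lambda>H. c * \<phi> H) = (\<lambda>H. c * (geom_step ^^ n) \<phi> H)"
  by (induction n) (simp_all add: geom_step_cmult)

lemma geom_step_suminf:
  assumes [measurable]: "\<And>j::nat. \<phi> j \<in> borel_measurable borel"
  shows "geom_step (\<lambda>H. \<Sum>j. \<phi> j H) = (\<lambda>H. \<Sum>j. geom_step (\<phi> j) H)"
  unfolding geom_step_def by (simp add: nn_integral_suminf[symmetric])

lemma geom_step_iterate_suminf: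
  assumes [measurable]: "\<And>j::nat. \<phi> j \<in> borel_measurable borel"
  shows "(geom_step ^^ n) (\<lambda>H. \<Sum>j. \<phi> j H) = (\<lambda>H. \<Sum>j. (geom_step ^^ n) (\<phi> j) H)"
  by (induction n) (simp_all add: geom_step_suminf)

text \<open>
  With \<open>c = e\<^sup>\<xi> - 1\<close> this is \<open>1 - (1 + H c)\<^sup>-\<^sup>2 \<ge> H c / (1 + H c) \<ge> H c / (1 + c)\<close>.
\<close>

lemma geom_step_one_defect:
  assumes H: "0 < H" "H \<le> 1"
  shows "geom_step (\<lambda>_. 1) H + ennreal (\<integral>w. 1 - exp (- \<xi> w) \<partial>\<mu>) * ennreal H \<le> 1"
proof -
  have int: "integrable \<mu> (\<lambda>w. 1 - exp (- \<xi> w))"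
    by (rule integrable_const_bound[of _ 1]) (use \<xi>_nonneg in auto)
  have "ennreal (\<integral>w. 1 - exp (- \<xi> w) \<partial>\<mu>) * ennreal H = ennreal (\<integral>w. H * (1 - exp (- \<xi> w)) \<partial>\<mu>)"
    using H int \<xi>_nonneg by (subst ennreal_mult[symmetric]) (auto intro!: integral_nonneg_AE simp: mult_ac)
  also have "\<dots> = (\<integral>\<^sup>+w. ennreal (H * (1 - exp (- \<xi> w))) \<partial>\<mu>)"
    using H int \<xi>_nonneg by (intro nn_integral_eq_integral[symmetric]) auto
  finally have "geom_step (\<lambda>_. 1) H + ennreal (\<integral>w. 1 - exp (- \<xi> w) \<partial>\<mu>) * ennreal H
      = (\<integral>\<^sup>+w. ennreal (1 / (thinning H w)\<^sup>2) + ennreal (H * (1 - exp (- \<xi> w))) \<partial>\<mu>)"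
    unfolding geom_step_def by (simp add: nn_integral_add)
  also have "\<dots> \<le> (\<integral>\<^sup>+w. 1 \<partial>\<mu>)"
  proof (rule nn_integral_mono_AE, use \<xi>_nonneg in eventually_elim)
    case (elim w)
    define c where "c = exp (\<xi> w) - 1"
    have c: "0 \<le> c" using elim by (simp add: c_def)
    have t: "thinning H w = 1 + H * c" by (simp add: thinning_def c_def)
    have Hc: "0 \<le> H * c" using H c by simp
    have "1 / (1 + H * c)\<^sup>2 \<le> 1 / (1 + H * c)"
      using Hc by (intro divide_left_mono) (auto simp: power2_eq_square mult_le_cancel_left1)
    moreover have "H * (1 - exp (- \<xi> w)) = H * c / (1 + c)"
      using elim by (simp add: c_def exp_minus field_simps)
    moreover have "H * c / (1 + c) \<le> H * c / (1 + H * c)"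
      using Hc c H by (intro divide_left_mono) (auto simp: mult_left_le_one_le intro!: mult_pos_pos add_pos_nonneg)
    moreover have "1 / (1 + H * c) + H * c / (1 + H * c) = 1"
      using Hc by (simp add: add_divide_distrib[symmetric])
    ultimately have "1 / (thinning H w)\<^sup>2 + H * (1 - exp (- \<xi> w)) \<le> 1"
      unfolding t by linarith
    moreover have "ennreal (1 / (thinning H w)\<^sup>2) + ennreal (H * (1 - exp (- \<xi> w)))
        = ennreal (1 / (thinning H w)\<^sup>2 + H * (1 - exp (- \<xi> w)))"
      using H elim by (intro ennreal_plus[symmetric]) auto
    ultimately show ?case by (simp only: ennreal_le_1)
  qed
  also have "\<dots> = 1" by (simp add: emeasure_space_1)
  finally show ?thesis .
qed

lemma geom_step_iterate_one_defect:
  assumes H: "0 < H" "H \<le> 1"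
  shows "(geom_step ^^ Suc n) (\<lambda>_. 1) H
     + ennreal (\<integral>w. 1 - exp (- \<xi> w) \<partial>\<mu>) * (geom_step ^^ n) (\<lambda>H. ennreal H) H \<le> (geom_step ^^ n) (\<lambda>_. 1) H"
proof -
  define \<kappa> where "\<kappa> = ennreal (\<integral>w. 1 - exp (- \<xi> w) \<partial>\<mu>)"
  have "(geom_step ^^ Suc n) (\<lambda>_. 1) H + \<kappa> * (geom_step ^^ n) (\<lambda>H. ennreal H) H
      = (geom_step ^^ n) (geom_step (\<lambda>_. 1)) H + (geom_step ^^ n) (\<lambda>H. \<kappa> * ennreal H) H"
    by (simp add: funpow_swap1 geom_step_iterate_cmult)
  also have "\<dots> = (geom_step ^^ n) (\<lambda>H. geom_step (\<lambda>_. 1) H + \<kappa> * ennreal H) H"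
    by (subst geom_step_iterate_add) auto
  also have "\<dots> \<le> (geom_step ^^ n) (\<lambda>_. 1) H"
    using H geom_step_one_defect by (intro geom_step_iterate_mono) (auto simp: \<kappa>_def)
  finally show ?thesis by (simp add: \<kappa>_def)
qed

text \<open>
  In the coordinate \<open>- ln H\<close> one step adds at least \<open>X\<close>, and the factor \<open>thinning\<^sup>-\<^sup>2\<close> improves as \<open>H\<close> decreases.
\<close>

lemma step_iterate_le_geom_step_iterate:
  assumes "0 < H" "H \<le> exp (- (s + b))"
  shows "(killed_step b ^^ n) (\<lambda>_. 1) s \<le> (geom_step ^^ n) (\<lambda>_. 1) H"
  using assms
proof (induction n arbitrary: s H)
  case (Suc n)
  have "killed_step b ((killed_step b ^^ n) (\<lambda>_. 1)) s \<le> geom_step ((geom_step ^^ n) (\<lambda>_. 1)) H"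
    unfolding killed_step_def[of b "(killed_step b ^^ n) (\<lambda>_. 1)"] geom_step_def[of "(geom_step ^^ n) (\<lambda>_. 1)"]
  proof (rule nn_integral_mono_AE, use \<xi>_nonneg in eventually_elim)
    case (elim w)
    have t: "1 \<le> thinning H w" using Suc.prems elim by (intro thinning_ge_1) auto
    have "thinning H w \<le> 1 + H * exp (\<xi> w)" using Suc.prems by (simp add: thinning_def)
    also have "\<dots> \<le> 1 + exp (- (s + b)) * exp (\<xi> w)" using Suc.prems by simp
    also have "\<dots> = 1 + exp (\<xi> w - (s + b))" by (simp flip: exp_add)
    finally have "survival b s w \<le> 1 / (thinning H w)\<^sup>2"
      unfolding survival_def using t by (intro divide_left_mono power_mono) auto
    moreover have "(killed_step b ^^ n) (\<lambda>_. 1) (s + X w) \<le> (geom_step ^^ n) (\<lambda>_. 1) (H * exp (- X w) / thinning H w)"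
    proof (rule Suc.IH)
      show "0 < H * exp (- X w) / thinning H w" using t Suc.prems by simp
      have "H * exp (- X w) / thinning H w \<le> H * exp (- X w) / 1"
        using t Suc.prems by (intro divide_left_mono) auto
      also have "\<dots> \<le> exp (- (s + b)) * exp (- X w)" using Suc.prems by simp
      also have "\<dots> = exp (- (s + X w + b))" by (simp flip: exp_add)
      finally show "H * exp (- X w) / thinning H w \<le> exp (- (s + X w + b))" .
    qed
    ultimately show ?case
      by (intro mult_mono ennreal_leI) (auto simp: indicator_def)
  qed
  then show ?case by simp
qed simp

text \<open>
  \<open>H / H'\<close> changes by exactly the quotient of the two thinning factors, which compensates their squares in the
  operator.  This allows the walk to be started at an arbitrarily high level.
\<close>

lemma geom_step_iterate_compare:
  assumes "0 < H" "H \<le> H'"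
  shows "ennreal ((H / H')\<^sup>2) * (geom_step ^^ n) (\<lambda>_. 1) H \<le> (geom_step ^^ n) (\<lambda>_. 1) H'"
  using assms
proof (induction n arbitrary: H H')
  case 0
  then show ?case by (simp add: ennreal_le_1 power_le_one)
next
  case (Suc n)
  have "ennreal ((H / H')\<^sup>2) * geom_step ((geom_step ^^ n) (\<lambda>_. 1)) H
      = (\<integral>\<^sup>+w. ennreal ((H / H')\<^sup>2) * (ennreal (1 / (thinning H w)\<^sup>2)
             * (geom_step ^^ n) (\<lambda>_. 1) (H * exp (- X w) / thinning H w)) \<partial>\<mu>)"
    unfolding geom_step_def[of "(geom_step ^^ n) (\<lambda>_. 1)"] by (rule nn_integral_cmult[symmetric]) measurable
  also have "\<dots> \<le> geom_step ((geom_step ^^ n) (\<lambda>_. 1)) H'"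
    unfolding geom_step_def[of "(geom_step ^^ n) (\<lambda>_. 1)"]
  proof (rule nn_integral_mono_AE, use \<xi>_nonneg in eventually_elim)
    case (elim w)
    define G where "G = H * exp (- X w) / thinning H w"
    define G' where "G' = H' * exp (- X w) / thinning H' w"
    have t: "1 \<le> thinning H w" "1 \<le> thinning H' w"
      using Suc.prems elim by (auto intro!: thinning_ge_1)
    have G: "0 < G" using Suc.prems t by (simp add: G_def)
    have "G \<le> G'"
    proof -
      have "H * thinning H' w \<le> H' * thinning H w"
        using Suc.prems by (simp add: thinning_def algebra_simps)
      then have "H / thinning H w \<le> H' / thinning H' w"
        using t by (simp add: divide_simps mult_ac)
      then have "exp (- X w) * (H / thinning H w) \<le> exp (- X w) * (H' / thinning H' w)"
        by (intro mult_left_mono) auto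
      then show ?thesis by (simp add: G_def G'_def mult_ac)
    qed
    note IH = Suc.IH[OF G this]
    have "(H / H')\<^sup>2 * (1 / (thinning H w)\<^sup>2) = 1 / (thinning H' w)\<^sup>2 * (G / G')\<^sup>2"
      using Suc.prems t by (simp add: G_def G'_def power2_eq_square field_simps)
    then have eq: "ennreal ((H / H')\<^sup>2) * ennreal (1 / (thinning H w)\<^sup>2)
        = ennreal (1 / (thinning H' w)\<^sup>2) * ennreal ((G / G')\<^sup>2)"
      by (simp flip: ennreal_mult)
    have "ennreal ((H / H')\<^sup>2) * (ennreal (1 / (thinning H w)\<^sup>2) * (geom_step ^^ n) (\<lambda>_. 1) G)
        = ennreal (1 / (thinning H' w)\<^sup>2) * (ennreal ((G / G')\<^sup>2) * (geom_step ^^ n) (\<lambda>_. 1) G)"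
      by (simp add: eq flip: mult.assoc)
    also have "\<dots> \<le> ennreal (1 / (thinning H' w)\<^sup>2) * (geom_step ^^ n) (\<lambda>_. 1) G'"
      using IH by (intro mult_left_mono) auto
    finally show ?case by (simp add: G_def G'_def)
  qed
  finally show ?case by simp
qed

lemma geom_step_green_infinite:
  assumes "0 \<le> b" "0 \<le> x" and inf: "(\<Sum>n. (killed_step b ^^ n) (\<lambda>_. 1) x) = \<infinity>"
  shows "(\<Sum>n. (geom_step ^^ n) (\<lambda>_. 1) 1) = \<infinity>"
proof -
  define H where "H = exp (- (x + b))"
  have H: "0 < H" "H \<le> 1" using assms by (auto simp: H_def)
  have "\<infinity> = ennreal (H\<^sup>2) * (\<Sum>n. (killed_step b ^^ n) (\<lambda>_. 1) x)"
    using H by (simp add: inf ennreal_mult_top)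
  also have "\<dots> = (\<Sum>n. ennreal (H\<^sup>2) * (killed_step b ^^ n) (\<lambda>_. 1) x)"
    by simp
  also have "\<dots> \<le> (\<Sum>n. (geom_step ^^ n) (\<lambda>_. 1) 1)"
  proof (intro suminf_le)
    fix n
    have "ennreal (H\<^sup>2) * (killed_step b ^^ n) (\<lambda>_. 1) x \<le> ennreal ((H / 1)\<^sup>2) * (geom_step ^^ n) (\<lambda>_. 1) H"
      using step_iterate_le_geom_step_iterate[of H x b n] H by (intro mult_mono) (auto simp: H_def)
    also have "\<dots> \<le> (geom_step ^^ n) (\<lambda>_. 1) 1"
      by (rule geom_step_iterate_compare[OF H])
    finally show "ennreal (H\<^sup>2) * (killed_step b ^^ n) (\<lambda>_. 1) x \<le> (geom_step ^^ n) (\<lambda>_. 1) 1" .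
  qed auto
  finally show ?thesis by (simp add: top_unique)
qed

end

context random_step begin

text \<open>
  \<open>\<T>\<^sup>n H\<close> is squeezed between the two one-step inequalities: it bounds the difference of the weights at 1 and
  at \<open>k + 1\<close> (Bernoulli), and is itself bounded by the decrement of \<open>u\<close>.
\<close>

lemma geometric_profile_flat:
  fixes k :: nat
  defines "u \<equiv> \<lambda>n. enn2real ((geom_step ^^ n) (\<lambda>_. 1) 1)"
  assumes \<kappa>: "0 < (\<integral>w. 1 - exp (- \<xi> w) \<partial>\<mu>)" and pos: "\<And>n. 0 < u n"
    and ratio: "(\<lambda>n. u (Suc n) / u n) \<longlonglongrightarrow> 1"
  shows "(\<lambda>n. enn2real ((geom_step ^^ n) (\<lambda>H. ennreal ((1 - H) ^ k)) 1) / u n) \<longlonglongrightarrow> 1"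
proof -
  define \<kappa> where "\<kappa> = (\<integral>w. 1 - exp (- \<xi> w) \<partial>\<mu>)"
  define v where "v n = enn2real ((geom_step ^^ n) (\<lambda>H. ennreal ((1 - H) ^ k)) 1)" for n
  define w where "w n = enn2real ((geom_step ^^ n) (\<lambda>H. ennreal H) 1)" for n
  have one_le: "(geom_step ^^ n) (\<lambda>_. 1) H \<le> 1" if "0 < H" "H \<le> 1" for n H
  proof (induction n)
    case (Suc n)
    have "(geom_step ^^ Suc n) (\<lambda>_. 1) H \<le> (geom_step ^^ n) (\<lambda>_. 1) H"
      using geom_step_iterate_one_defect[OF that, of n] by (rule order_trans[rotated]) simp
    with Suc show ?case by (rule order_trans[rotated])
  qed simp
  have le_one: "(geom_step ^^ n) \<phi> 1 \<le> (geom_step ^^ n) (\<lambda>_. 1) 1"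
    if "\<And>H. 0 < H \<Longrightarrow> H \<le> 1 \<Longrightarrow> \<phi> H \<le> 1" for \<phi> n
    using that by (intro geom_step_iterate_mono) auto
  have u: "(geom_step ^^ n) (\<lambda>_. 1) 1 = ennreal (u n)" for n
    unfolding u_def using one_le[of 1 n] by (simp add: ennreal_enn2real_if top_unique split: if_splits) (auto simp: top_unique)
  have v: "(geom_step ^^ n) (\<lambda>H. ennreal ((1 - H) ^ k)) 1 = ennreal (v n)"
    and v_le: "v n \<le> u n" for n
  proof -
    have le: "(geom_step ^^ n) (\<lambda>H. ennreal ((1 - H) ^ k)) 1 \<le> ennreal (u n)"
      unfolding u[symmetric] by (intro le_one) (auto simp: ennreal_le_1 power_le_one)
    then show *: "(geom_step ^^ n) (\<lambda>H. ennreal ((1 - H) ^ k)) 1 = ennreal (v n)"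
      unfolding v_def by (intro ennreal_enn2real[symmetric]) (auto simp: less_top[symmetric] top_unique)
    show "v n \<le> u n" using le unfolding * by (simp add: u_def)
  qed
  have w: "(geom_step ^^ n) (\<lambda>H. ennreal H) 1 = ennreal (w n)" for n
  proof -
    have "(geom_step ^^ n) (\<lambda>H. ennreal H) 1 \<le> ennreal (u n)"
      unfolding u[symmetric] by (intro le_one) (auto simp: ennreal_le_1)
    then show ?thesis
      unfolding w_def by (intro ennreal_enn2real[symmetric]) (auto simp: less_top[symmetric] top_unique)
  qed
  have nonneg: "0 \<le> u n" "0 \<le> v n" "0 \<le> w n" for n by (auto simp: u_def v_def w_def)
  have \<kappa>w: "\<kappa> * w n \<le> u n - u (Suc n)" for n
  proof -
    have "ennreal (u (Suc n) + \<kappa> * w n) = ennreal (u (Suc n)) + ennreal \<kappa> * ennreal (w n)"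
      using nonneg \<kappa> by (simp add: \<kappa>_def ennreal_mult)
    also have "\<dots> \<le> ennreal (u n)"
      using geom_step_iterate_one_defect[of 1 n] unfolding u w by (simp add: \<kappa>_def)
    finally show ?thesis using nonneg by simp
  qed
  have Bernoulli: "u n \<le> v n + real k * w n" for n
  proof -
    have "(geom_step ^^ n) (\<lambda>_. 1) 1 \<le> (geom_step ^^ n) (\<lambda>H. ennreal ((1 - H) ^ k) + ennreal (real k) * ennreal H) 1"
    proof (rule geom_step_iterate_mono)
      fix H :: real assume H: "0 < H" "H \<le> 1"
      have "1 + real k * (- H) \<le> (1 + (- H)) ^ k" using H by (intro Bernoulli_inequality) auto
      then have "1 \<le> (1 - H) ^ k + real k * H" by simp
      then have "ennreal 1 \<le> ennreal ((1 - H) ^ k + real k * H)" by (rule ennreal_leI)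
      then show "1 \<le> ennreal ((1 - H) ^ k) + ennreal (real k) * ennreal H"
        using H by (simp add: ennreal_mult)
    qed auto
    also have "\<dots> = ennreal (v n) + ennreal (real k) * ennreal (w n)"
      by (simp add: geom_step_iterate_add geom_step_iterate_cmult v w)
    also have "\<dots> = ennreal (v n + real k * w n)"
      using nonneg by (simp add: ennreal_mult)
    finally show ?thesis using nonneg unfolding u by (subst (asm) ennreal_le_iff) auto
  qed
  have "(\<lambda>n. v n / u n) \<longlonglongrightarrow> 1"
  proof (rule tendsto_sandwich)
    have "(\<lambda>n. 1 - real k / \<kappa> * (1 - u (Suc n) / u n)) \<longlonglongrightarrow> 1 - real k / \<kappa> * (1 - 1)"
      by (intro tendsto_intros ratio)
    then show "(\<lambda>n. 1 - real k / \<kappa> * (1 - u (Suc n) / u n)) \<longlonglongrightarrow> 1" by simp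
    show "\<forall>\<^sub>F n in sequentially. 1 - real k / \<kappa> * (1 - u (Suc n) / u n) \<le> v n / u n"
    proof (rule always_eventually, rule allI)
      fix n
      have "w n \<le> (u n - u (Suc n)) / \<kappa>" using \<kappa>w[of n] \<kappa> by (simp add: \<kappa>_def field_simps)
      then have "real k * w n \<le> real k * ((u n - u (Suc n)) / \<kappa>)" by (intro mult_left_mono) auto
      then have "u n - real k * ((u n - u (Suc n)) / \<kappa>) \<le> v n" using Bernoulli[of n] by linarith
      then have "(u n - real k * ((u n - u (Suc n)) / \<kappa>)) / u n \<le> v n / u n"
        using pos[of n] by (intro divide_right_mono) auto
      also have "(u n - real k * ((u n - u (Suc n)) / \<kappa>)) / u n = 1 - real k / \<kappa> * (1 - u (Suc n) / u n)"
        using pos[of n] by (simp add: diff_divide_distrib right_diff_distrib)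
      finally show "1 - real k / \<kappa> * (1 - u (Suc n) / u n) \<le> v n / u n" .
    qed
    show "\<forall>\<^sub>F n in sequentially. v n / u n \<le> 1"
      using v_le pos by (intro always_eventually allI) (simp add: divide_le_eq)
  qed simp
  then show ?thesis by (simp add: v_def)
qed

end


context random_step begin

text \<open>
  The mixed moment that bounds the cost of soft killing is obtained from
  \<open>a\<^sup>1\<^sup>-\<^sup>1\<^sup>/\<^sup>q c\<^sup>1\<^sup>/\<^sup>q \<le> a + c\<close> with \<open>a = (1 + \<xi>)\<^sup>\<alpha>\<^sup>+\<^sup>\<epsilon>\<close> and \<open>c = \<bar>X\<bar>\<^sup>q\<close>.  Its exponent \<open>(\<alpha> + \<epsilon>) (1 - 1/q)\<close> exceeds
  \<open>\<alpha> - 1\<close> when \<open>q\<close> is close to \<open>\<alpha>\<close>.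
\<close>

lemma geom_step_recurrent:
  fixes \<alpha> \<epsilon> :: real
  assumes X_int: "integrable \<mu> X" and X_mean: "(\<integral>w. X w \<partial>\<mu>) = 0"
    and \<alpha>: "1 < \<alpha>" and \<epsilon>: "0 < \<epsilon>"
    and \<xi>_int: "integrable \<mu> (\<lambda>w. \<bar>\<xi> w\<bar> powr (\<alpha> + \<epsilon>))"
    and moments: "\<And>q. 1 \<le> q \<Longrightarrow> q < \<alpha> \<Longrightarrow> integrable \<mu> (\<lambda>w. \<bar>X w\<bar> powr q)"
    and spread: "\<And>\<delta>. 0 < \<delta> \<Longrightarrow> \<exists>c>0. \<exists>y1. \<forall>y\<ge>y1. c * y powr (- (\<alpha> + \<delta>)) \<le> (\<integral>w. min 1 ((X w / y)\<^sup>2) \<partial>\<mu>)"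
  shows "(\<Sum>n. (geom_step ^^ n) (\<lambda>_. 1) 1) = \<infinity>"
proof -
  define r where "r = \<alpha> + \<epsilon>"
  have r: "1 < r" using \<alpha> \<epsilon> by (simp add: r_def)
  \<comment> \<open>Any \<open>q\<close> above this value makes the exponent \<open>p\<close> below exceed \<open>\<alpha> - 1\<close>.\<close>
  have max_lt: "max 1 (r / (1 + \<epsilon>)) < \<alpha>"
  proof -
    have "1 * \<epsilon> < \<alpha> * \<epsilon>" using \<alpha> \<epsilon> by (intro mult_strict_right_mono)
    then have "r < \<alpha> * (1 + \<epsilon>)" by (simp add: r_def algebra_simps)
    then show ?thesis using \<alpha> \<epsilon> by (simp add: pos_divide_less_eq)
  qed
  then obtain q where q: "max 1 (r / (1 + \<epsilon>)) < q" "q < \<alpha>" using dense by blast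
  then have q1: "1 < q" and "r / (1 + \<epsilon>) < q" by auto
  then have rq: "r / q < 1 + \<epsilon>" using \<epsilon> by (simp add: field_simps)
  define p where "p = r * (1 - 1 / q)"
  have "p = r - r / q" by (simp add: p_def right_diff_distrib)
  then have p: "\<alpha> - 1 < p" using rq by (simp add: r_def)
  have one_\<xi>_int: "integrable \<mu> (\<lambda>w. (1 + \<xi> w) powr r)"
  proof (rule Bochner_Integration.integrable_bound)
    show "integrable \<mu> (\<lambda>w. 2 powr r * (1 + \<bar>\<xi> w\<bar> powr r))"
      using \<xi>_int by (simp add: r_def)
    show "AE w in \<mu>. norm ((1 + \<xi> w) powr r) \<le> norm (2 powr r * (1 + \<bar>\<xi> w\<bar> powr r))"
      using \<xi>_nonneg
    proof eventually_elim
      case (elim w)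
      have "(1 + \<xi> w) powr r \<le> (2 * max 1 (\<xi> w)) powr r"
        using elim r by (intro powr_mono2) auto
      also have "\<dots> = 2 powr r * max 1 (\<xi> w) powr r" by (rule powr_mult)
      also have "\<dots> \<le> 2 powr r * (1 + \<bar>\<xi> w\<bar> powr r)"
        by (intro mult_left_mono) (auto simp: max_def)
      finally show ?case by simp
    qed
  qed measurable
  have \<xi>X_int: "integrable \<mu> (\<lambda>w. (1 + \<xi> w) powr p * \<bar>X w\<bar>)"
  proof (rule Bochner_Integration.integrable_bound)
    show "integrable \<mu> (\<lambda>w. (1 + \<xi> w) powr r + \<bar>X w\<bar> powr q)"
      using one_\<xi>_int moments[of q] q q1 by simp
    show "AE w in \<mu>. norm ((1 + \<xi> w) powr p * \<bar>X w\<bar>) \<le> norm ((1 + \<xi> w) powr r + \<bar>X w\<bar> powr q)"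
    proof (rule AE_I2)
      fix w
      define a where "a = (1 + \<xi> w) powr r"
      define c where "c = \<bar>X w\<bar> powr q"
      have a: "0 \<le> a" and c: "0 \<le> c" by (auto simp: a_def c_def)
      have pa: "(1 + \<xi> w) powr p = a powr (1 - 1 / q)" by (simp add: a_def p_def powr_powr)
      have xc: "\<bar>X w\<bar> = c powr (1 / q)" using q1 by (simp add: c_def powr_powr)
      have "a powr (1 - 1 / q) * c powr (1 / q) \<le> max a c powr (1 - 1 / q) * max a c powr (1 / q)"
        using a c q1 by (intro mult_mono powr_mono2) auto
      also have "\<dots> = max a c" using a by (simp flip: powr_add)
      also have "\<dots> \<le> a + c" using a c by simp
      finally show "norm ((1 + \<xi> w) powr p * \<bar>X w\<bar>) \<le> norm ((1 + \<xi> w) powr r + \<bar>X w\<bar> powr q)"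
        using a c unfolding pa a_def[symmetric] c_def[symmetric] by (subst xc) (simp add: abs_mult)
    qed
  qed measurable
  obtain b x where "0 \<le> b" "0 \<le> x" "(\<Sum>n. (killed_step b ^^ n) (\<lambda>_. 1) x) = \<infinity>"
    by (rule recurrence_criterion[OF X_int X_mean \<alpha> \<epsilon> one_\<xi>_int[unfolded r_def] p \<xi>X_int spread])
  then show ?thesis by (rule geom_step_green_infinite)
qed

end

section \<open>Linear fractional laws preserve geometric weights\<close>

lemma conv_power_0 [simp]: "conv_power q 0 = return_pmf 0"
  by (simp add: conv_power_def)

lemma conv_power_Suc:
  "conv_power q (Suc z) = map_pmf (\<lambda>(y, t). y + t) (pair_pmf q (conv_power q z))"
proof -
  have "Pi_pmf {..<Suc z} 0 (\<lambda>_. q) = map_pmf (\<lambda>(y, f). f(z := y)) (pair_pmf q (Pi_pmf {..<z} 0 (\<lambda>_. q)))"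
    unfolding lessThan_Suc by (rule Pi_pmf_insert) auto
  then have "conv_power q (Suc z)
      = map_pmf (\<lambda>(y, f). \<Sum>i<Suc z. (f(z := y)) i) (pair_pmf q (Pi_pmf {..<z} 0 (\<lambda>_. q)))"
    by (simp add: conv_power_def map_pmf_comp case_prod_unfold)
  also have "(\<lambda>(y, f). \<Sum>i<Suc z. (f(z := y)) i) = (\<lambda>(y, f). y + (\<Sum>i<z. f i))"
    by (auto simp: fun_eq_iff add.commute)
  also have "map_pmf (\<lambda>(y, f). y + (\<Sum>i<z. f i)) (pair_pmf q (Pi_pmf {..<z} 0 (\<lambda>_. q)))
      = map_pmf (\<lambda>(y, t). y + t) (pair_pmf q (conv_power q z))"
    unfolding conv_power_def pair_map_pmf2 map_pmf_comp by (simp add: case_prod_unfold)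
  finally show ?thesis .
qed

lemma pmf_conv_power_Suc:
  "pmf (conv_power q (Suc z)) k = (\<Sum>i\<le>k. pmf q i * pmf (conv_power q z) (k - i))"
proof -
  have "pmf (conv_power q (Suc z)) k
      = measure (measure_pmf (pair_pmf q (conv_power q z))) ((\<lambda>(y, t). y + t) -` {k})"
    unfolding conv_power_Suc pmf_map ..
  also have "(\<lambda>(y, t). y + t) -` {k} = (\<lambda>i. (i, k - i)) ` {..k}"
    by (auto simp: image_iff)
  also have "measure (measure_pmf (pair_pmf q (conv_power q z))) \<dots>
      = (\<Sum>x\<in>(\<lambda>i. (i, k - i)) ` {..k}. pmf (pair_pmf q (conv_power q z)) x)"
    by (rule measure_measure_pmf_finite) auto
  also have "\<dots> = (\<Sum>i\<le>k. pmf q i * pmf (conv_power q z) (k - i))"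
    by (subst sum.reindex) (auto simp: inj_on_def pmf_pair)
  finally show ?thesis .
qed

lemma conv_power_1: "pmf (conv_power q (Suc 0)) k = pmf q k"
proof -
  have "pmf (conv_power q (Suc 0)) k = (\<Sum>i\<le>k. if i = k then pmf q i else 0)"
    unfolding pmf_conv_power_Suc by (intro sum.cong) (auto simp: pmf_return)
  then show ?thesis by simp
qed

lemma offspring_mean_eq: "offspring_mean q = enn2real (\<Sum>k. ennreal (pmf q k * real k))"
proof -
  have "offspring_mean q = enn2real (\<integral>\<^sup>+k. ennreal (real k) \<partial>measure_pmf q)"
    unfolding offspring_mean_def by (rule integral_eq_nn_integral) auto
  also have "(\<integral>\<^sup>+k. ennreal (real k) \<partial>measure_pmf q) = (\<Sum>k. ennreal (pmf q k * real k))"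
    by (simp add: nn_integral_measure_pmf nn_integral_count_space_nat ennreal_mult)
  finally show ?thesis .
qed

lemma linear_fractional_mean:
  assumes a: "0 \<le> a" "a < 1" and p: "0 < p" "p < 1"
    and q: "\<And>k. 1 \<le> k \<Longrightarrow> pmf q k = (1 - a) * (1 - p) / p * p ^ k"
  shows "offspring_mean q = (1 - a) / (1 - p)"
proof -
  have "(\<lambda>k. real k * p ^ (k - Suc 0)) sums (1 / (1 - p)\<^sup>2)"
    using sums_Suc[of "\<lambda>k. real k * p ^ (k - Suc 0)" "1 / (1 - p)\<^sup>2"] geometric_deriv_sums[of p] p
    by simp
  then have "(\<lambda>k. (1 - a) * (1 - p) * (real k * p ^ (k - Suc 0))) sums ((1 - a) * (1 - p) * (1 / (1 - p)\<^sup>2))"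
    by (rule sums_mult)
  also have "(\<lambda>k. (1 - a) * (1 - p) * (real k * p ^ (k - Suc 0))) = (\<lambda>k. pmf q k * real k)"
  proof
    fix k show "(1 - a) * (1 - p) * (real k * p ^ (k - Suc 0)) = pmf q k * real k"
      using p q[of k] by (cases k) auto
  qed
  also have "(1 - a) * (1 - p) * (1 / (1 - p)\<^sup>2) = (1 - a) / (1 - p)"
    using p by (simp add: power2_eq_square)
  finally have sums: "(\<lambda>k. pmf q k * real k) sums ((1 - a) / (1 - p))" .
  have "(\<Sum>k. ennreal (pmf q k * real k)) = ennreal ((1 - a) / (1 - p))"
    by (rule suminf_ennreal_eq[OF _ sums]) simp
  then show ?thesis using a p by (simp add: offspring_mean_eq)
qed

lemma linear_fractional_log_mean:
  assumes a: "0 \<le> a" "a < 1" and p: "0 < p" "p < 1"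
    and q: "\<And>k. 1 \<le> k \<Longrightarrow> pmf q k = (1 - a) * (1 - p) / p * p ^ k"
  shows "exp (- log_mean q) = (1 - p) / (1 - a)"
proof -
  have "offspring_mean q = (1 - a) / (1 - p)" by (rule linear_fractional_mean[OF a p q])
  then show ?thesis using a p by (simp add: log_mean_def exp_minus)
qed

text \<open>
  The mixture \<open>c\<close> solves \<open>c = q + r (q * c)\<close> with \<open>r = 1 - H\<close> and the convolution \<open>q * c\<close>.  Since \<open>q\<close> is
  geometric on the positive integers, subtracting \<open>p\<close> times the equation at \<open>k\<close> from the equation at \<open>k + 1\<close>
  leaves a first-order recursion, so \<open>c\<close> is geometric there as well.
\<close>

lemma linear_fractional_geometric_mixture:
  fixes H :: real
  assumes lf: "linear_fractional q" and H: "0 < H" "H \<le> 1"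
  defines "D \<equiv> 1 + H * (exp (- ln (1 - pmf q 0)) - 1)"
  shows "(\<lambda>z. (1 - H) ^ z * pmf (conv_power q (Suc z)) (Suc k))
     sums (exp (- log_mean q) / D\<^sup>2 * (1 - H * exp (- log_mean q) / D) ^ k)"
proof -
  obtain a p where a: "0 \<le> a" "a < 1" and p: "0 < p" "p < 1" and q0: "pmf q 0 = a"
    and "\<forall>k\<ge>1. pmf q k = (1 - a) * (1 - p) / p * p ^ k"
    using lf unfolding linear_fractional_def by (elim exE conjE) (rule that)
  then have q: "pmf q k = (1 - a) * (1 - p) / p * p ^ k" if "1 \<le> k" for k
    using that by simp
  define r where "r = 1 - H"
  have r: "0 \<le> r" "r < 1" using H by (auto simp: r_def)
  define q1 where "q1 = (1 - a) * (1 - p)"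
  have q_Suc: "pmf q (Suc k) = q1 * p ^ k" for k
    using q[of "Suc k"] p by (simp add: q1_def)
  define c where "c k = (\<Sum>z. r ^ z * pmf (conv_power q (Suc z)) k)" for k
  have summ: "summable (\<lambda>z. r ^ z * pmf (conv_power q (f z)) k)" for k f
    using r by (intro summable_comparison_test'[OF summable_geometric[of r], of 0])
      (simp_all add: abs_mult pmf_le_1 mult_left_le)
  have rec: "c k = pmf q k + r * (\<Sum>i\<le>k. pmf q i * c (k - i))" for k
  proof -
    have "c k = pmf q k + (\<Sum>z. r ^ Suc z * pmf (conv_power q (Suc (Suc z))) k)"
      using suminf_split_head[OF summ[of Suc k]] by (simp add: c_def conv_power_1)
    also have "(\<Sum>z. r ^ Suc z * pmf (conv_power q (Suc (Suc z))) k)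
        = (\<Sum>z. \<Sum>i\<le>k. r * pmf q i * (r ^ z * pmf (conv_power q (Suc z)) (k - i)))"
      by (subst pmf_conv_power_Suc) (simp add: sum_distrib_left mult_ac)
    also have "\<dots> = (\<Sum>i\<le>k. \<Sum>z. r * pmf q i * (r ^ z * pmf (conv_power q (Suc z)) (k - i)))"
      by (intro suminf_sum summable_mult summ)
    also have "\<dots> = r * (\<Sum>i\<le>k. pmf q i * c (k - i))"
      unfolding c_def sum_distrib_left
      by (intro sum.cong refl) (subst suminf_mult[OF summ], simp add: mult_ac)
    finally show ?thesis .
  qed
  define N where "N = 1 - r * a"
  have N: "0 < N"
    using r a mult_strict_mono'[of r 1 a 1] by (simp add: N_def)
  have rec': "N * c (Suc k) = q1 * p ^ k + r * (\<Sum>i\<le>k. q1 * p ^ i * c (k - i))" for k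
    using rec[of "Suc k"] by (subst (asm) sum.atMost_Suc_shift) (simp add: N_def q0 q_Suc algebra_simps)
  have c0: "N * c 0 = a" using rec[of 0] by (simp add: N_def q0 algebra_simps)
  define \<rho> where "\<rho> = p + r * q1 / N"
  have c_Suc: "c (Suc (Suc k)) = \<rho> * c (Suc k)" for k
  proof -
    have "N * c (Suc (Suc k)) = q1 * p ^ Suc k + r * (q1 * c (Suc k) + (\<Sum>i\<le>k. q1 * p ^ Suc i * c (k - i)))"
      unfolding rec'[of "Suc k"] by (subst sum.atMost_Suc_shift) simp
    also have "\<dots> = p * (q1 * p ^ k + r * (\<Sum>i\<le>k. q1 * p ^ i * c (k - i))) + r * q1 * c (Suc k)"
      by (simp add: algebra_simps sum_distrib_left)
    also have "\<dots> = N * (\<rho> * c (Suc k))"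
      unfolding rec'[symmetric] using N by (simp add: \<rho>_def field_simps)
    finally show ?thesis using N by simp
  qed
  have geo: "c (Suc k) = c 1 * \<rho> ^ k" for k
    by (induction k) (simp_all add: c_Suc mult_ac)
  have DN: "N = (1 - a) * D"
    using a by (simp add: N_def D_def q0 r_def exp_minus field_simps)
  have D: "0 < D" using DN N a by (simp add: zero_less_mult_iff)
  have em: "exp (- log_mean q) = (1 - p) / (1 - a)"
    by (rule linear_fractional_log_mean[OF a p q])
  have c1: "c 1 = exp (- log_mean q) / D\<^sup>2"
  proof -
    have "N * c 1 = q1 * (1 + r * c 0)" using rec'[of 0] by (simp add: algebra_simps)
    then have "N * N * c 1 = q1 * (N + r * (N * c 0))" by (simp add: algebra_simps)
    also have "\<dots> = q1" by (simp add: c0) (simp add: N_def)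
    finally have "(1 - a) * ((1 - a) * D\<^sup>2 * c 1) = (1 - a) * (1 - p)"
      by (simp add: q1_def DN power2_eq_square mult_ac)
    then have "(1 - a) * D\<^sup>2 * c 1 = 1 - p" using a by simp
    then show ?thesis using a D unfolding em by (simp add: field_simps)
  qed
  have \<rho>: "\<rho> = 1 - H * exp (- log_mean q) / D"
  proof -
    have "\<rho> * N = p * N + r * q1" using N by (simp add: \<rho>_def field_simps)
    also have "\<dots> = N - H * (1 - p)" by (simp add: N_def r_def q1_def algebra_simps)
    finally have "\<rho> = 1 - H * (1 - p) / N" using N by (simp add: field_simps)
    then show ?thesis by (simp add: em DN)
  qed
  have "(\<lambda>z. r ^ z * pmf (conv_power q (Suc z)) (Suc k)) sums c (Suc k)"
    unfolding c_def by (intro summable_sums summ)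
  then show ?thesis unfolding geo c1 \<rho> r_def .
qed

section \<open>The annealed Markov chain\<close>

lemma space_offspring_space [simp]: "space offspring_space = UNIV"
  by (simp add: offspring_space_def)

lemma pmf_measurable [measurable]: "(\<lambda>q. pmf q k) \<in> borel_measurable offspring_space"
proof -
  have "(pmf :: nat pmf \<Rightarrow> _) \<in> offspring_space \<rightarrow>\<^sub>M Pi\<^sub>M UNIV (\<lambda>_. borel)"
    unfolding offspring_space_def by (rule measurable_vimage_algebra1) (auto simp: space_PiM)
  then show ?thesis by (rule measurable_compose[OF _ measurable_component_singleton]) simp
qed

lemma pmf_conv_power_measurable [measurable]:
  "(\<lambda>q. pmf (conv_power q z) k) \<in> borel_measurable offspring_space"
proof (induction z arbitrary: k)
  case (Suc z)
  note Suc [measurable]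
  show ?case unfolding pmf_conv_power_Suc by measurable
qed simp

lemma log_mean_measurable [measurable]: "log_mean \<in> borel_measurable offspring_space"
  unfolding log_mean_def offspring_mean_eq by measurable

definition annealed_kernel :: "nat pmf measure \<Rightarrow> nat \<Rightarrow> nat \<Rightarrow> ennreal" where
  "annealed_kernel \<nu> z k = (\<integral>\<^sup>+q. ennreal (pmf (conv_power q z) k) \<partial>\<nu>)"

context branching_process_random_env begin

lemmas [measurable] = env_measurable pop_measurable

lemma sets_env_law [measurable_cong, simp]: "sets \<nu> = sets offspring_space"
  using env_law[of 0, symmetric] by simp

lemma space_env_law [simp]: "space \<nu> = UNIV"
  using sets_eq_imp_space_eq[OF sets_env_law] by simp

lemma prob_space_env_law: "prob_space \<nu>"
  unfolding env_law[of 0, symmetric] by (rule prob_space_distr) simp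

definition history :: "nat \<Rightarrow> 'w \<Rightarrow> (nat \<Rightarrow> nat pmf) \<times> (nat \<Rightarrow> nat)" where
  "history n \<omega> = (\<lambda>i. Q i \<omega>, \<lambda>j\<in>{..n}. Z j \<omega>)"

abbreviation history_space :: "nat \<Rightarrow> ((nat \<Rightarrow> nat pmf) \<times> (nat \<Rightarrow> nat)) measure" where
  "history_space n \<equiv> Pi\<^sub>M UNIV (\<lambda>_. offspring_space) \<Otimes>\<^sub>M Pi\<^sub>M {..n} (\<lambda>_. count_space UNIV)"

lemma env_history_eq: "env_history M Q Z n = vimage_algebra (space M) (history n) (history_space n)"
  by (simp add: env_history_def history_def[abs_def])

lemma history_measurable: "history n \<in> M \<rightarrow>\<^sub>M history_space n"
  unfolding history_def
  by (intro measurable_Pair measurable_PiM_single' measurable_restrict) auto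

lemma history_measurable': "history n \<in> env_history M Q Z n \<rightarrow>\<^sub>M history_space n"
  unfolding env_history_eq
  by (rule measurable_vimage_algebra1) (use history_measurable in \<open>auto simp: measurable_def\<close>)

lemma subalgebra_env_history: "subalgebra M (env_history M Q Z n)"
  unfolding subalgebra_def
proof
  show "space (env_history M Q Z n) = space M" by (simp add: env_history_eq)
  have "sets (env_history M Q Z n) = {history n -` A \<inter> space M |A. A \<in> sets (history_space n)}"
    unfolding env_history_eq
    by (rule sets_vimage_algebra2) (use history_measurable in \<open>auto simp: measurable_def\<close>)
  then show "sets (env_history M Q Z n) \<subseteq> sets M"
    using measurable_sets[OF history_measurable] by auto
qed

lemma Q_measurable_history: "Q i \<in> env_history M Q Z n \<rightarrow>\<^sub>M offspring_space"
proof -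
  have "(\<lambda>x. fst x i) \<in> history_space n \<rightarrow>\<^sub>M offspring_space" by measurable
  from measurable_compose[OF history_measurable' this] show ?thesis
    by (simp add: history_def)
qed

lemma transition_pmf_measurable [measurable]:
  "(\<lambda>\<omega>. pmf (conv_power (Q n \<omega>) (Z n \<omega>)) k) \<in> borel_measurable M"
proof -
  have "(\<lambda>\<omega>. (\<lambda>z. pmf (conv_power (Q n \<omega>) z) k) (Z n \<omega>)) \<in> borel_measurable M"
    by (rule measurable_compose_countable) measurable
  then show ?thesis by simp
qed

lemma transition_integral:
  assumes F: "F \<in> borel_measurable (env_history M Q Z n)" and F_nonneg: "\<And>\<omega>. 0 \<le> F \<omega>"
    and F_le: "\<And>\<omega>. F \<omega> \<le> (1::real)"
  shows "(\<integral>\<^sup>+\<omega>. ennreal (F \<omega>) * indicator {\<omega>. Z (Suc n) \<omega> = k} \<omega> \<partial>M)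
     = (\<integral>\<^sup>+\<omega>. ennreal (F \<omega>) * ennreal (pmf (conv_power (Q n \<omega>) (Z n \<omega>)) k) \<partial>M)"
proof -
  interpret H: finite_measure_subalgebra M "env_history M Q Z n"
    by unfold_locales (rule subalgebra_env_history)
  have F_M [measurable]: "F \<in> borel_measurable M"
    by (rule measurable_from_subalg[OF subalgebra_env_history F])
  define g where "g = (indicator {\<omega> \<in> space M. Z (Suc n) \<omega> = k} :: 'w \<Rightarrow> real)"
  have [measurable]: "g \<in> borel_measurable M" unfolding g_def by measurable
  have int: "integrable M (\<lambda>\<omega>. F \<omega> * g \<omega>)"
    by (rule integrable_const_bound[of _ 1])
       (use F_nonneg F_le in \<open>auto simp: g_def indicator_def\<close>)
  have int': "integrable M (\<lambda>\<omega>. F \<omega> * pmf (conv_power (Q n \<omega>) (Z n \<omega>)) k)"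
    by (rule integrable_const_bound[of _ 1])
       (use F_nonneg F_le in \<open>auto simp: abs_mult pmf_le_1 intro!: mult_le_one\<close>)
  have "(\<integral>\<^sup>+\<omega>. ennreal (F \<omega>) * indicator {\<omega>. Z (Suc n) \<omega> = k} \<omega> \<partial>M) = (\<integral>\<^sup>+\<omega>. ennreal (F \<omega> * g \<omega>) \<partial>M)"
    by (intro nn_integral_cong) (auto simp: g_def indicator_def)
  also have "\<dots> = ennreal (\<integral>\<omega>. F \<omega> * g \<omega> \<partial>M)"
    by (intro nn_integral_eq_integral int) (auto simp: g_def F_nonneg)
  also have "(\<integral>\<omega>. F \<omega> * g \<omega> \<partial>M) = (\<integral>\<omega>. F \<omega> * real_cond_exp M (env_history M Q Z n) g \<omega> \<partial>M)"
    by (rule H.real_cond_exp_intg(2)[OF int F, symmetric]) simp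
  also have "\<dots> = (\<integral>\<omega>. F \<omega> * pmf (conv_power (Q n \<omega>) (Z n \<omega>)) k \<partial>M)"
    using transition[of n k] by (intro integral_cong_AE) (auto simp: g_def)
  also have "ennreal \<dots> = (\<integral>\<^sup>+\<omega>. ennreal (F \<omega> * pmf (conv_power (Q n \<omega>) (Z n \<omega>)) k) \<partial>M)"
    by (intro nn_integral_eq_integral[symmetric] int') (auto simp: F_nonneg)
  also have "\<dots> = (\<integral>\<^sup>+\<omega>. ennreal (F \<omega>) * ennreal (pmf (conv_power (Q n \<omega>) (Z n \<omega>)) k) \<partial>M)"
    by (intro nn_integral_cong) (simp add: ennreal_mult F_nonneg)
  finally show ?thesis .
qed

definition pop_law :: "nat \<Rightarrow> nat \<Rightarrow> ennreal" where
  "pop_law n k = emeasure M {\<omega> \<in> space M. Z n \<omega> = k}"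

lemma pop_law_eq_nn_integral: "pop_law n z = (\<integral>\<^sup>+\<omega>. indicator {\<omega>. Z n \<omega> = z} \<omega> \<partial>M)"
proof -
  have "pop_law n z = (\<integral>\<^sup>+\<omega>. indicator {\<omega> \<in> space M. Z n \<omega> = z} \<omega> \<partial>M)"
    unfolding pop_law_def by (rule nn_integral_indicator[symmetric]) measurable
  also have "\<dots> = (\<integral>\<^sup>+\<omega>. indicator {\<omega>. Z n \<omega> = z} \<omega> \<partial>M)"
    by (intro nn_integral_cong) (auto simp: indicator_def)
  finally show ?thesis .
qed

lemma env_factor:
  assumes "finite I" and [measurable]: "\<And>i. g i \<in> borel_measurable offspring_space"
  shows "(\<integral>\<^sup>+\<omega>. (\<Prod>i\<in>I. ennreal (g i (Q i \<omega>))) \<partial>M) = (\<Prod>i\<in>I. \<integral>\<^sup>+q. ennreal (g i q) \<partial>\<nu>)"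
proof -
  have "indep_vars (\<lambda>_. borel) (\<lambda>i \<omega>. ennreal (g i (Q i \<omega>))) UNIV"
    by (rule indep_vars_compose2[OF env_indep]) measurable
  then have "indep_vars (\<lambda>_. borel) (\<lambda>i \<omega>. ennreal (g i (Q i \<omega>))) I"
    by (rule indep_vars_subset) simp
  then have "(\<integral>\<^sup>+\<omega>. (\<Prod>i\<in>I. ennreal (g i (Q i \<omega>))) \<partial>M) = (\<Prod>i\<in>I. \<integral>\<^sup>+\<omega>. ennreal (g i (Q i \<omega>)) \<partial>M)"
    using assms by (intro indep_vars_nn_integral) auto
  also have "\<dots> = (\<Prod>i\<in>I. \<integral>\<^sup>+q. ennreal (g i q) \<partial>\<nu>)"
  proof (rule prod.cong[OF refl])
    fix i
    show "(\<integral>\<^sup>+\<omega>. ennreal (g i (Q i \<omega>)) \<partial>M) = (\<integral>\<^sup>+q. ennreal (g i q) \<partial>\<nu>)"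
      unfolding env_law[of i, symmetric] by (rule nn_integral_distr[symmetric]) measurable
  qed
  finally show ?thesis .
qed

text \<open>
  The population at time \<open>n\<close> is independent of the environment from time \<open>n\<close> on.  Finite products of functions
  of single coordinates are enough, and they make the induction close: the transition probability of the
  next step is one more factor.
\<close>

lemma population_indep_future:
  assumes start: "AE \<omega> in M. Z 0 \<omega> = 1"
  assumes "finite I" "I \<subseteq> {n..}" and "\<And>i. g i \<in> borel_measurable offspring_space"
    and "\<And>i q. 0 \<le> g i q" "\<And>i q. g i q \<le> (1::real)"
  shows "(\<integral>\<^sup>+\<omega>. (\<Prod>i\<in>I. ennreal (g i (Q i \<omega>))) * indicator {\<omega>. Z n \<omega> = z} \<omega> \<partial>M)
    = pop_law n z * (\<Prod>i\<in>I. \<integral>\<^sup>+q. ennreal (g i q) \<partial>\<nu>)"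
  using assms(2-)
proof (induction n arbitrary: I g z)
  case 0
  note 0(3) [measurable]
  have ind: "AE \<omega> in M. indicator {\<omega>. Z 0 \<omega> = z} \<omega> = (of_bool (z = 1) :: ennreal)"
    using start by eventually_elim auto
  have "pop_law 0 z = (\<integral>\<^sup>+\<omega>. indicator {\<omega>. Z 0 \<omega> = z} \<omega> \<partial>M)"
    by (rule pop_law_eq_nn_integral)
  also have "\<dots> = (\<integral>\<^sup>+\<omega>. of_bool (z = 1) \<partial>M)"
    using ind by (intro nn_integral_cong_AE)
  finally have law: "pop_law 0 z = of_bool (z = 1)" by (simp add: emeasure_space_1)
  have "(\<integral>\<^sup>+\<omega>. (\<Prod>i\<in>I. ennreal (g i (Q i \<omega>))) * indicator {\<omega>. Z 0 \<omega> = z} \<omega> \<partial>M)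
      = (\<integral>\<^sup>+\<omega>. (\<Prod>i\<in>I. ennreal (g i (Q i \<omega>))) * of_bool (z = 1) \<partial>M)"
    using ind by (intro nn_integral_cong_AE) auto
  also have "\<dots> = (\<integral>\<^sup>+\<omega>. (\<Prod>i\<in>I. ennreal (g i (Q i \<omega>))) \<partial>M) * of_bool (z = 1)"
    by (rule nn_integral_multc) measurable
  finally show ?case using 0 by (simp add: env_factor law mult.commute)
next
  case (Suc n)
  have step: "(\<integral>\<^sup>+\<omega>. (\<Prod>i\<in>J. ennreal (h i (Q i \<omega>))) * indicator {\<omega>. Z (Suc n) \<omega> = z} \<omega> \<partial>M)
      = (\<Sum>y. pop_law n y * annealed_kernel \<nu> y z) * (\<Prod>i\<in>J. \<integral>\<^sup>+q. ennreal (h i q) \<partial>\<nu>)"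
    if J: "finite J" "J \<subseteq> {Suc n..}" and h [measurable]: "\<And>i. h i \<in> borel_measurable offspring_space"
      and h01: "\<And>i q. 0 \<le> h i q" "\<And>i q. h i q \<le> 1" for J h
  proof -
    have prod_eq: "(\<Prod>i\<in>J. ennreal (h i (Q i \<omega>))) = ennreal (\<Prod>i\<in>J. h i (Q i \<omega>))" for \<omega>
      by (rule prod_ennreal) (rule h01)
    have "(\<integral>\<^sup>+\<omega>. (\<Prod>i\<in>J. ennreal (h i (Q i \<omega>))) * indicator {\<omega>. Z (Suc n) \<omega> = z} \<omega> \<partial>M)
       = (\<integral>\<^sup>+\<omega>. (\<Prod>i\<in>J. ennreal (h i (Q i \<omega>))) * ennreal (pmf (conv_power (Q n \<omega>) (Z n \<omega>)) z) \<partial>M)"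
      unfolding prod_eq
    proof (rule transition_integral)
      show "(\<lambda>\<omega>. \<Prod>i\<in>J. h i (Q i \<omega>)) \<in> borel_measurable (env_history M Q Z n)"
        by (intro borel_measurable_prod measurable_compose[OF Q_measurable_history h])
    qed (use h01 in \<open>auto intro!: prod_nonneg prod_le_1\<close>)
    also have "\<dots> = (\<integral>\<^sup>+\<omega>. (\<Sum>y. (\<Prod>i\<in>insert n J. ennreal ((h(n := \<lambda>q. pmf (conv_power q y) z)) i (Q i \<omega>)))
          * indicator {\<omega>. Z n \<omega> = y} \<omega>) \<partial>M)"
    proof (rule nn_integral_cong)
      fix \<omega>
      define G where "G y = (\<Prod>i\<in>J. ennreal (h i (Q i \<omega>))) * ennreal (pmf (conv_power (Q n \<omega>) y) z)" for y
      have "(\<Prod>i\<in>insert n J. ennreal ((h(n := \<lambda>q. pmf (conv_power q y) z)) i (Q i \<omega>))) = G y" for y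
      proof -
        have "n \<notin> J" using J by auto
        then have "(\<Prod>i\<in>J. ennreal ((h(n := \<lambda>q. pmf (conv_power q y) z)) i (Q i \<omega>))) = (\<Prod>i\<in>J. ennreal (h i (Q i \<omega>)))"
          by (intro prod.cong) auto
        then show ?thesis using J \<open>n \<notin> J\<close> by (simp add: G_def mult.commute)
      qed
      then have "(\<Sum>y. (\<Prod>i\<in>insert n J. ennreal ((h(n := \<lambda>q. pmf (conv_power q y) z)) i (Q i \<omega>)))
          * indicator {\<omega>. Z n \<omega> = y} \<omega>) = (\<Sum>y. if y = Z n \<omega> then G y else 0)"
        by (intro suminf_cong) (auto simp: indicator_def)
      also have "\<dots> = G (Z n \<omega>)" by (rule sums_unique[OF sums_single, symmetric])
      finally show "(\<Prod>i\<in>J. ennreal (h i (Q i \<omega>))) * ennreal (pmf (conv_power (Q n \<omega>) (Z n \<omega>)) z)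
        = (\<Sum>y. (\<Prod>i\<in>insert n J. ennreal ((h(n := \<lambda>q. pmf (conv_power q y) z)) i (Q i \<omega>)))
          * indicator {\<omega>. Z n \<omega> = y} \<omega>)" by (simp add: G_def)
    qed
    also have "\<dots> = (\<Sum>y. \<integral>\<^sup>+\<omega>. (\<Prod>i\<in>insert n J. ennreal ((h(n := \<lambda>q. pmf (conv_power q y) z)) i (Q i \<omega>)))
          * indicator {\<omega>. Z n \<omega> = y} \<omega> \<partial>M)"
    proof (rule nn_integral_suminf)
      fix y
      have [measurable]: "(h(n := \<lambda>q. pmf (conv_power q y) z)) i \<in> borel_measurable offspring_space" for i
        by simp
      show "(\<lambda>\<omega>. (\<Prod>i\<in>insert n J. ennreal ((h(n := \<lambda>q. pmf (conv_power q y) z)) i (Q i \<omega>)))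
          * indicator {\<omega>. Z n \<omega> = y} \<omega>) \<in> borel_measurable M"
        by measurable
    qed
    also have "\<dots> = (\<Sum>y. pop_law n y * (\<Prod>i\<in>insert n J. \<integral>\<^sup>+q. ennreal ((h(n := \<lambda>q. pmf (conv_power q y) z)) i q) \<partial>\<nu>))"
      using J h01 by (intro suminf_cong Suc.IH) (auto simp: pmf_le_1)
    also have "\<dots> = (\<Sum>y. pop_law n y * annealed_kernel \<nu> y z * (\<Prod>i\<in>J. \<integral>\<^sup>+q. ennreal (h i q) \<partial>\<nu>))"
    proof (rule suminf_cong)
      fix y
      have "n \<notin> J" using J by auto
      then have "(\<Prod>i\<in>J. \<integral>\<^sup>+q. ennreal ((h(n := \<lambda>q. pmf (conv_power q y) z)) i q) \<partial>\<nu>)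
          = (\<Prod>i\<in>J. \<integral>\<^sup>+q. ennreal (h i q) \<partial>\<nu>)"
        by (intro prod.cong) auto
      then show "pop_law n y * (\<Prod>i\<in>insert n J. \<integral>\<^sup>+q. ennreal ((h(n := \<lambda>q. pmf (conv_power q y) z)) i q) \<partial>\<nu>)
         = pop_law n y * annealed_kernel \<nu> y z * (\<Prod>i\<in>J. \<integral>\<^sup>+q. ennreal (h i q) \<partial>\<nu>)"
        using J \<open>n \<notin> J\<close> by (simp add: annealed_kernel_def mult.assoc)
    qed
    also have "\<dots> = (\<Sum>y. pop_law n y * annealed_kernel \<nu> y z) * (\<Prod>i\<in>J. \<integral>\<^sup>+q. ennreal (h i q) \<partial>\<nu>)"
      by simp
    finally show ?thesis .
  qed
  have "pop_law (Suc n) z = (\<integral>\<^sup>+\<omega>. indicator {\<omega>. Z (Suc n) \<omega> = z} \<omega> \<partial>M)"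
    by (rule pop_law_eq_nn_integral)
  also have "\<dots> = (\<Sum>y. pop_law n y * annealed_kernel \<nu> y z)"
    using step[of "{}" "\<lambda>_ _. 0"] by simp
  finally show ?case using step[of I g] Suc.prems by simp
qed

lemma annealed_markov:
  assumes start: "AE \<omega> in M. Z 0 \<omega> = 1"
  shows "pop_law (Suc n) z = (\<Sum>y. pop_law n y * annealed_kernel \<nu> y z)"
proof -
  have "pop_law (Suc n) z = (\<integral>\<^sup>+\<omega>. ennreal 1 * indicator {\<omega>. Z (Suc n) \<omega> = z} \<omega> \<partial>M)"
    by (simp add: pop_law_eq_nn_integral)
  also have "\<dots> = (\<integral>\<^sup>+\<omega>. ennreal 1 * ennreal (pmf (conv_power (Q n \<omega>) (Z n \<omega>)) z) \<partial>M)"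
    by (rule transition_integral) auto
  also have "\<dots> = (\<integral>\<^sup>+\<omega>. (\<Sum>y. ennreal (pmf (conv_power (Q n \<omega>) y) z) * indicator {\<omega>. Z n \<omega> = y} \<omega>) \<partial>M)"
  proof (rule nn_integral_cong)
    fix \<omega>
    have "(\<Sum>y. ennreal (pmf (conv_power (Q n \<omega>) y) z) * indicator {\<omega>. Z n \<omega> = y} \<omega>)
        = (\<Sum>y. if y = Z n \<omega> then ennreal (pmf (conv_power (Q n \<omega>) y) z) else 0)"
      by (intro suminf_cong) (auto simp: indicator_def)
    also have "\<dots> = ennreal (pmf (conv_power (Q n \<omega>) (Z n \<omega>)) z)"
      by (rule sums_unique[OF sums_single, symmetric])
    finally show "ennreal 1 * ennreal (pmf (conv_power (Q n \<omega>) (Z n \<omega>)) z)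
        = (\<Sum>y. ennreal (pmf (conv_power (Q n \<omega>) y) z) * indicator {\<omega>. Z n \<omega> = y} \<omega>)" by simp
  qed
  also have "\<dots> = (\<Sum>y. \<integral>\<^sup>+\<omega>. ennreal (pmf (conv_power (Q n \<omega>) y) z) * indicator {\<omega>. Z n \<omega> = y} \<omega> \<partial>M)"
    by (rule nn_integral_suminf) measurable
  also have "\<dots> = (\<Sum>y. pop_law n y * annealed_kernel \<nu> y z)"
  proof (rule suminf_cong)
    fix y
    show "(\<integral>\<^sup>+\<omega>. ennreal (pmf (conv_power (Q n \<omega>) y) z) * indicator {\<omega>. Z n \<omega> = y} \<omega> \<partial>M)
        = pop_law n y * annealed_kernel \<nu> y z"
      using population_indep_future[OF start, of "{n}" n "\<lambda>_ q. pmf (conv_power q y) z" y]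
      by (simp add: annealed_kernel_def pmf_le_1)
  qed
  finally show ?thesis .
qed

lemma pop_law_0:
  assumes start: "AE \<omega> in M. Z 0 \<omega> = 1"
  shows "pop_law 0 z = of_bool (z = 1)"
proof -
  have "pop_law 0 z = emeasure M (if z = 1 then space M else {})"
    unfolding pop_law_def by (rule emeasure_eq_AE) (use start in auto)
  then show ?thesis by (simp add: emeasure_space_1)
qed

end

definition log_survival :: "nat pmf \<Rightarrow> real" where
  "log_survival q = - ln (1 - pmf q 0)"

lemma log_survival_measurable [measurable]: "log_survival \<in> borel_measurable offspring_space"
  unfolding log_survival_def by measurable

lemma linear_fractional_bounds:
  assumes "linear_fractional q"
  shows "0 \<le> log_survival q" "- log_survival q \<le> log_mean q" "0 < pmf q 1"
proof -
  obtain a p where a: "0 \<le> a" "a < 1" and p: "0 < p" "p < 1" and q0: "pmf q 0 = a"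
    and "\<forall>k\<ge>1. pmf q k = (1 - a) * (1 - p) / p * p ^ k"
    using assms unfolding linear_fractional_def by (elim exE conjE) (rule that)
  then have q: "pmf q k = (1 - a) * (1 - p) / p * p ^ k" if "1 \<le> k" for k
    using that by simp
  show "0 \<le> log_survival q" using a by (simp add: log_survival_def q0)
  show "0 < pmf q 1" using q[of 1] a p by simp
  have "exp (- log_mean q) = (1 - p) / (1 - a)" by (rule linear_fractional_log_mean[OF a p q])
  also have "\<dots> \<le> 1 / (1 - a)" using a p by (intro divide_right_mono) auto
  also have "\<dots> = exp (log_survival q)" using a by (simp add: log_survival_def q0 exp_minus field_simps)
  finally show "- log_survival q \<le> log_mean q" by simp
qed

context branching_process_random_env begin

lemma annealed_kernel_0_Suc: "annealed_kernel \<nu> 0 (Suc k) = 0"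
  by (simp add: annealed_kernel_def pmf_return)

text \<open>
  Laws of the annealed chain started at 1 and forbidden to be at 1 at intermediate times; the index \<open>n\<close> stands
  for time \<open>n + 1\<close>.
\<close>

primrec first_return :: "nat \<Rightarrow> nat \<Rightarrow> ennreal" where
  "first_return 0 z = annealed_kernel \<nu> 1 z"
| "first_return (Suc n) z = (\<Sum>y. (if y = 1 then 0 else first_return n y) * annealed_kernel \<nu> y z)"

lemma last_visit_decomposition:
  assumes start: "AE \<omega> in M. Z 0 \<omega> = 1"
  shows "pop_law (Suc n) z = (\<Sum>j\<le>n. pop_law j 1 * first_return (n - j) z)"
proof (induction n arbitrary: z)
  case 0
  have "pop_law (Suc 0) z = (\<Sum>y. if y = 1 then annealed_kernel \<nu> y z else 0)"
    unfolding annealed_markov[OF start] pop_law_0[OF start] by (intro suminf_cong) auto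
  also have "\<dots> = annealed_kernel \<nu> 1 z" by (rule sums_unique[OF sums_single, symmetric])
  finally show ?case by (simp add: pop_law_0[OF start])
next
  case (Suc n)
  have "pop_law (Suc (Suc n)) z
      = (\<Sum>y. (if y = 1 then pop_law (Suc n) y * annealed_kernel \<nu> y z else 0)
           + (if y = 1 then 0 else pop_law (Suc n) y) * annealed_kernel \<nu> y z)"
    unfolding annealed_markov[OF start, of "Suc n"] by (intro suminf_cong) auto
  also have "\<dots> = (\<Sum>y. if y = 1 then pop_law (Suc n) y * annealed_kernel \<nu> y z else 0)
      + (\<Sum>y. (if y = 1 then 0 else pop_law (Suc n) y) * annealed_kernel \<nu> y z)"
    by (rule suminf_add[symmetric]) auto
  also have "(\<Sum>y. if y = 1 then pop_law (Suc n) y * annealed_kernel \<nu> y z else 0)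
      = pop_law (Suc n) 1 * first_return 0 z"
    unfolding first_return.simps by (rule sums_unique[OF sums_single, symmetric])
  also have "(\<Sum>y. (if y = 1 then 0 else pop_law (Suc n) y) * annealed_kernel \<nu> y z)
      = (\<Sum>y. \<Sum>j\<le>n. pop_law j 1 * ((if y = 1 then 0 else first_return (n - j) y) * annealed_kernel \<nu> y z))"
    unfolding Suc.IH by (intro suminf_cong) (auto simp: sum_distrib_right mult.assoc)
  also have "\<dots> = (\<Sum>j\<le>n. \<Sum>y. pop_law j 1 * ((if y = 1 then 0 else first_return (n - j) y) * annealed_kernel \<nu> y z))"
    by (rule suminf_sum) auto
  also have "\<dots> = (\<Sum>j\<le>n. pop_law j 1 * first_return (Suc n - j) z)"
    by (intro sum.cong refl) (simp add: Suc_diff_le)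
  finally show ?case by (simp add: add.commute)
qed

lemma pop_law_le_1: "pop_law n k \<le> 1"
  unfolding pop_law_def by (rule emeasure_le_1)

text \<open>
  The transfer from the operator to the process: the law of the population is an iterate of \<open>geom_step\<close>, and
  its value at 1 is a renewal sequence.
\<close>

theorem uniform_limit_of_green_infinite:
  assumes start: "AE \<omega> in M. Z 0 \<omega> = 1"
    and lf: "AE q in \<nu>. linear_fractional q"
    and \<gamma>_int: "integrable \<nu> (\<lambda>q. exp (- log_mean q))"
    and rs: "random_step (tilted_law \<nu>) log_mean log_survival"
    and \<kappa>: "0 < (\<integral>q. 1 - exp (- log_survival q) \<partial>tilted_law \<nu>)"
    and green: "(\<Sum>n. (random_step.geom_step (tilted_law \<nu>) log_mean log_survival ^^ n) (\<lambda>_. 1) 1) = \<infinity>"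
    and k: "1 \<le> k" "k \<le> c"
  shows "(\<lambda>n. cond_prob M (\<lambda>\<omega>. Z n \<omega> = k) (\<lambda>\<omega>. 1 \<le> Z n \<omega> \<and> Z n \<omega> \<le> c)) \<longlonglongrightarrow> 1 / real c"
proof -
  interpret R: random_step "tilted_law \<nu>" log_mean log_survival by (rule rs)
  interpret N: prob_space \<nu> by (rule prob_space_env_law)
  define \<gamma> where "\<gamma> = (LINT q|\<nu>. exp (- log_mean q))"
  have \<gamma>: "0 < \<gamma>"
  proof -
    have "0 \<le> \<gamma>" unfolding \<gamma>_def by (intro integral_nonneg_AE) auto
    moreover have "\<gamma> \<noteq> 0"
    proof
      assume "\<gamma> = 0"
      then have "AE q in \<nu>. exp (- log_mean q) = 0"
        unfolding \<gamma>_def using \<gamma>_int by (subst (asm) integral_nonneg_eq_0_iff_AE) auto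
      then show False using N.AE_const[of False] by simp
    qed
    ultimately show ?thesis by simp
  qed
  have kernel: "(\<Sum>z. ennreal ((1 - H) ^ z) * annealed_kernel \<nu> (Suc z) (Suc k))
      = ennreal \<gamma> * R.geom_step (\<lambda>H. ennreal ((1 - H) ^ k)) H" if H: "0 < H" "H \<le> 1" for H k
  proof -
    have "ennreal \<gamma> * R.geom_step (\<lambda>H. ennreal ((1 - H) ^ k)) H
        = ennreal \<gamma> * (\<integral>\<^sup>+q. ennreal (exp (- log_mean q) / \<gamma>) * (ennreal (1 / (R.thinning H q)\<^sup>2) *
              ennreal ((1 - H * exp (- log_mean q) / R.thinning H q) ^ k)) \<partial>\<nu>)"
    proof -
      have [measurable]: "R.thinning H \<in> borel_measurable offspring_space" "R.thinning H \<in> borel_measurable \<nu>"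
        unfolding R.thinning_def by measurable
      show ?thesis
        unfolding R.geom_step_def unfolding tilted_law_def \<gamma>_def[symmetric] by (subst nn_integral_density) auto
    qed
    also have "\<dots> = (\<integral>\<^sup>+q. ennreal \<gamma> * (ennreal (exp (- log_mean q) / \<gamma>) * (ennreal (1 / (R.thinning H q)\<^sup>2) *
              ennreal ((1 - H * exp (- log_mean q) / R.thinning H q) ^ k))) \<partial>\<nu>)"
    proof -
      have [measurable]: "R.thinning H \<in> borel_measurable \<nu>"
        unfolding R.thinning_def by measurable
      show ?thesis by (rule nn_integral_cmult[symmetric]) measurable
    qed
    also have "\<dots> = (\<integral>\<^sup>+q. (\<Sum>z. ennreal ((1 - H) ^ z) * ennreal (pmf (conv_power q (Suc z)) (Suc k))) \<partial>\<nu>)"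
    proof (rule nn_integral_cong_AE, use lf in eventually_elim)
      case (elim q)
      define D where "D = R.thinning H q"
      define G where "G = H * exp (- log_mean q) / D"
      note b = linear_fractional_bounds[OF elim]
      have G: "G \<le> 1" using R.parameter_in_unit_interval[OF H b(1,2)] by (simp add: G_def D_def)
      have sums: "(\<lambda>z. (1 - H) ^ z * pmf (conv_power q (Suc z)) (Suc k)) sums (exp (- log_mean q) / D\<^sup>2 * (1 - G) ^ k)"
        using linear_fractional_geometric_mixture[OF elim H, of k]
        by (simp add: G_def D_def R.thinning_def log_survival_def)
      have "(\<Sum>z. ennreal ((1 - H) ^ z) * ennreal (pmf (conv_power q (Suc z)) (Suc k)))
          = (\<Sum>z. ennreal ((1 - H) ^ z * pmf (conv_power q (Suc z)) (Suc k)))"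
        using H by (simp add: ennreal_mult)
      also have "\<dots> = ennreal (exp (- log_mean q) / D\<^sup>2 * (1 - G) ^ k)"
        using H by (intro suminf_ennreal_eq sums) auto
      also have "\<dots> = ennreal (\<gamma> * (exp (- log_mean q) / \<gamma> * (1 / D\<^sup>2 * (1 - G) ^ k)))"
        using \<gamma> by simp
      also have "\<dots> = ennreal \<gamma> * (ennreal (exp (- log_mean q) / \<gamma>) * (ennreal (1 / D\<^sup>2) * ennreal ((1 - G) ^ k)))"
      proof -
        have "ennreal (\<gamma> * (x * (y * z))) = ennreal \<gamma> * (ennreal x * (ennreal y * ennreal z))"
          if "0 \<le> x" "0 \<le> y" "0 \<le> z" for x y z
          using \<gamma> that by (simp add: ennreal_mult)
        from this[of "exp (- log_mean q) / \<gamma>" "1 / D\<^sup>2" "(1 - G) ^ k"]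
        show ?thesis using \<gamma> G by (simp only: divide_nonneg_pos exp_ge_zero zero_le_power2 zero_le_power diff_ge_0_iff_ge zero_le_divide_1_iff)
      qed
      finally show ?case by (simp add: G_def D_def)
    qed
    also have "\<dots> = (\<Sum>z. \<integral>\<^sup>+q. ennreal ((1 - H) ^ z) * ennreal (pmf (conv_power q (Suc z)) (Suc k)) \<partial>\<nu>)"
      by (rule nn_integral_suminf) measurable
    also have "\<dots> = (\<Sum>z. ennreal ((1 - H) ^ z) * annealed_kernel \<nu> (Suc z) (Suc k))"
      unfolding annealed_kernel_def by (intro suminf_cong nn_integral_cmult) measurable
    finally show ?thesis ..
  qed
  have law: "pop_law n (Suc k) = ennreal (\<gamma> ^ n) * (R.geom_step ^^ n) (\<lambda>H. ennreal ((1 - H) ^ k)) 1" for n k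
  proof (induction n arbitrary: k)
    case 0
    then show ?case by (simp add: pop_law_0[OF start] power_0_left)
  next
    case (Suc n)
    have "pop_law (Suc n) (Suc k) = (\<Sum>y. pop_law n (Suc y) * annealed_kernel \<nu> (Suc y) (Suc k))
        + pop_law n 0 * annealed_kernel \<nu> 0 (Suc k)"
      unfolding annealed_markov[OF start, of n]
      by (rule sums_unique[OF sums_Suc[OF summable_sums], symmetric]) simp
    also have "\<dots> = (\<Sum>y. ennreal (\<gamma> ^ n) * (R.geom_step ^^ n) (\<lambda>H. annealed_kernel \<nu> (Suc y) (Suc k) * ennreal ((1 - H) ^ y)) 1)"
    proof -
      have "pop_law n (Suc y) * annealed_kernel \<nu> (Suc y) (Suc k)
          = ennreal (\<gamma> ^ n) * (R.geom_step ^^ n) (\<lambda>H. annealed_kernel \<nu> (Suc y) (Suc k) * ennreal ((1 - H) ^ y)) 1" for y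
      proof -
        have "(R.geom_step ^^ n) (\<lambda>H. annealed_kernel \<nu> (Suc y) (Suc k) * ennreal ((1 - H) ^ y))
            = (\<lambda>H. annealed_kernel \<nu> (Suc y) (Suc k) * (R.geom_step ^^ n) (\<lambda>H. ennreal ((1 - H) ^ y)) H)"
          by (rule R.geom_step_iterate_cmult) measurable
        then show ?thesis by (simp add: Suc mult_ac)
      qed
      then show ?thesis by (simp add: annealed_kernel_0_Suc)
    qed
    also have "\<dots> = ennreal (\<gamma> ^ n) * (R.geom_step ^^ n) (\<lambda>H. \<Sum>y. annealed_kernel \<nu> (Suc y) (Suc k) * ennreal ((1 - H) ^ y)) 1"
      by (simp add: R.geom_step_iterate_suminf)
    also have "(R.geom_step ^^ n) (\<lambda>H. \<Sum>y. annealed_kernel \<nu> (Suc y) (Suc k) * ennreal ((1 - H) ^ y)) 1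
        = (R.geom_step ^^ n) (\<lambda>H. ennreal \<gamma> * R.geom_step (\<lambda>H. ennreal ((1 - H) ^ k)) H) 1"
      using kernel by (intro R.geom_step_iterate_cong) (simp_all add: mult.commute)
    also have "\<dots> = ennreal \<gamma> * (R.geom_step ^^ Suc n) (\<lambda>H. ennreal ((1 - H) ^ k)) 1"
      by (simp add: R.geom_step_iterate_cmult funpow_swap1)
    finally show ?case using \<gamma> by (simp add: ennreal_mult mult_ac)
  qed
  define u where "u k n = enn2real ((R.geom_step ^^ n) (\<lambda>H. ennreal ((1 - H) ^ k)) 1)" for k n
  have prob_eq: "prob {\<omega> \<in> space M. Z n \<omega> = Suc k} = \<gamma> ^ n * u k n" for n k
    using law[of n k] \<gamma> by (simp add: pop_law_def u_def measure_def enn2real_mult)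
  have u_pop: "u k n = enn2real (pop_law n (Suc k)) / \<gamma> ^ n" for k n
    using \<gamma> by (simp add: law u_def enn2real_mult)
  define f where "f n = enn2real (first_return (n - 1) 1) / \<gamma> ^ n" for n
  have fr_le: "first_return n 1 \<le> 1" for n
  proof -
    have "pop_law 0 1 * first_return (n - 0) 1 \<le> pop_law (Suc n) 1"
      unfolding last_visit_decomposition[OF start] by (rule member_le_sum) auto
    then show ?thesis using pop_law_le_1[of "Suc n" 1] by (simp add: pop_law_0[OF start])
  qed
  have fin: "pop_law n j < top" "first_return n 1 < top" for n j
    using pop_law_le_1[of n j] fr_le[of n] by (auto simp: order_le_less_trans)
  have renewal: "u 0 (Suc n) = (\<Sum>j\<le>n. u 0 j * f (Suc n - j))" for n
  proof -
    have "enn2real (pop_law (Suc n) 1) = (\<Sum>j\<le>n. enn2real (pop_law j 1) * enn2real (first_return (n - j) 1))"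
      unfolding last_visit_decomposition[OF start] using fin
      by (subst enn2real_sum) (auto simp: enn2real_mult ennreal_mult_less_top)
    then have "u 0 (Suc n) = (\<Sum>j\<le>n. enn2real (pop_law j 1) * enn2real (first_return (n - j) 1) / \<gamma> ^ Suc n)"
      by (simp add: u_pop sum_divide_distrib)
    also have "\<dots> = (\<Sum>j\<le>n. u 0 j * f (Suc n - j))"
    proof (rule sum.cong[OF refl])
      fix j assume "j \<in> {..n}"
      then have "\<gamma> ^ Suc n = \<gamma> ^ j * \<gamma> ^ (Suc n - j)" by (simp flip: power_add)
      then show "enn2real (pop_law j 1) * enn2real (first_return (n - j) 1) / \<gamma> ^ Suc n = u 0 j * f (Suc n - j)"
        by (simp add: u_pop f_def)
    qed
    finally show ?thesis .
  qed
  have u0: "u 0 0 = 1" by (simp add: u_def)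
  have f_nonneg: "0 \<le> f n" for n using \<gamma> by (simp add: f_def)
  have f1: "0 < f 1"
  proof -
    have "annealed_kernel \<nu> 1 1 \<noteq> 0"
    proof
      assume "annealed_kernel \<nu> 1 1 = 0"
      then have "AE q in \<nu>. pmf q 1 = 0"
        unfolding annealed_kernel_def One_nat_def conv_power_1
        by (subst (asm) nn_integral_0_iff_AE) (auto simp: ennreal_eq_0_iff pmf_nonneg order_antisym_conv)
      with lf have "AE q in \<nu>. False"
        by eventually_elim (use linear_fractional_bounds(3) in force)
      then show False using N.AE_const[of False] by simp
    qed
    then have "0 < enn2real (first_return 0 1)"
      using fin(2)[of 0] by (simp add: enn2real_positive_iff zero_less_iff_neq_zero)
    then show ?thesis using \<gamma> by (simp add: f_def)
  qed
  have u_one: "u 0 n = enn2real ((R.geom_step ^^ n) (\<lambda>_. 1) 1)" for n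
    by (simp add: u_def)
  have geom_fin: "(R.geom_step ^^ n) (\<lambda>_. 1) 1 = ennreal (u 0 n)" for n
  proof -
    have "(R.geom_step ^^ n) (\<lambda>_. 1) 1 < top"
      using fin(1)[of n 1] law[of n 0] zero_less_power[OF \<gamma>, of n]
      by (auto simp: ennreal_mult_less_top ennreal_eq_0_iff)
    then show ?thesis unfolding u_one by simp
  qed
  have dec: "decseq (u 0)"
  proof (rule decseq_SucI)
    fix n
    have "ennreal (u 0 (Suc n)) \<le> ennreal (u 0 n)"
      unfolding geom_fin[symmetric] by (rule order_trans[OF _ R.geom_step_iterate_one_defect[of 1 n]]) auto
    then show "u 0 (Suc n) \<le> u 0 n" by (simp add: u_def)
  qed
  have "\<not> summable (u 0)"
  proof
    assume "summable (u 0)"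
    then have "(\<Sum>n. ennreal (u 0 n)) = ennreal (\<Sum>n. u 0 n)"
      by (intro suminf_ennreal2 \<open>summable (u 0)\<close>) (simp add: u_def)
    then show False using green unfolding geom_fin by simp
  qed
  from renewal_ratio_tendsto_1[OF u0 f_nonneg f1 renewal dec this]
  have ratio: "(\<lambda>n. u 0 (Suc n) / u 0 n) \<longlonglongrightarrow> 1" .
  have pos: "0 < u 0 n" for n
  proof (induction n)
    case (Suc n)
    have "0 < u 0 n * f (Suc n - n)" using Suc f1 by simp
    also have "\<dots> \<le> u 0 (Suc n)"
      unfolding renewal using f_nonneg by (intro member_le_sum) (auto simp: u_def)
    finally show ?case .
  qed (simp add: u0)
  have flat: "(\<lambda>n. u k n / u 0 n) \<longlonglongrightarrow> 1" for k
    unfolding u_one using R.geometric_profile_flat[of k] \<kappa> pos ratio unfolding u_one by (simp add: u_def)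
  have "(\<lambda>n. (u (k - 1) n / u 0 n) / (\<Sum>j<c. u j n / u 0 n)) \<longlonglongrightarrow> 1 / (\<Sum>j<c. 1)"
    using k by (intro tendsto_divide flat tendsto_sum) auto
  moreover have "(u (k - 1) n / u 0 n) / (\<Sum>j<c. u j n / u 0 n)
      = cond_prob M (\<lambda>\<omega>. Z n \<omega> = k) (\<lambda>\<omega>. 1 \<le> Z n \<omega> \<and> Z n \<omega> \<le> c)" for n
  proof -
    have "{\<omega> \<in> space M. Z n \<omega> = k \<and> 1 \<le> Z n \<omega> \<and> Z n \<omega> \<le> c} = {\<omega> \<in> space M. Z n \<omega> = Suc (k - 1)}"
      using k by auto
    moreover have "prob {\<omega> \<in> space M. 1 \<le> Z n \<omega> \<and> Z n \<omega> \<le> c} = (\<Sum>j<c. \<gamma> ^ n * u j n)"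
    proof -
      have "{\<omega> \<in> space M. 1 \<le> Z n \<omega> \<and> Z n \<omega> \<le> c} = (\<Union>j<c. {\<omega> \<in> space M. Z n \<omega> = Suc j})"
      proof (intro equalityI subsetI)
        fix \<omega> assume "\<omega> \<in> {\<omega> \<in> space M. 1 \<le> Z n \<omega> \<and> Z n \<omega> \<le> c}"
        then show "\<omega> \<in> (\<Union>j<c. {\<omega> \<in> space M. Z n \<omega> = Suc j})"
          by (intro UN_I[of "Z n \<omega> - 1"]) auto
      qed auto
      also have "prob \<dots> = (\<Sum>j<c. prob {\<omega> \<in> space M. Z n \<omega> = Suc j})"
        by (rule finite_measure_finite_Union) (auto simp: disjoint_family_on_def)
      finally show ?thesis by (simp add: prob_eq)
    qed
    ultimately have "cond_prob M (\<lambda>\<omega>. Z n \<omega> = k) (\<lambda>\<omega>. 1 \<le> Z n \<omega> \<and> Z n \<omega> \<le> c)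
        = (\<gamma> ^ n * u (k - 1) n) / (\<gamma> ^ n * (\<Sum>j<c. u j n))"
      unfolding cond_prob_def by (simp only: prob_eq sum_distrib_left)
    also have "\<dots> = u (k - 1) n / (\<Sum>j<c. u j n)" using \<gamma> by simp
    also have "\<dots> = (u (k - 1) n / u 0 n) / (\<Sum>j<c. u j n / u 0 n)"
      using pos[of n] by (simp flip: sum_divide_distrib)
    finally show ?thesis ..
  qed
  ultimately show ?thesis by simp
qed

end

section \<open>Characteristic functions\<close>

lemma sin_ge_half:
  fixes y :: real
  assumes y: "0 \<le> y" "y \<le> 1"
  shows "y / 2 \<le> sin y"
proof -
  have "1 < pi / 3" using pi_gt3 by simp
  have "sin 0 - 0 / 2 \<le> sin y - y / 2"
  proof (rule DERIV_nonneg_imp_nondecreasing[of 0 y "\<lambda>y. sin y - y / 2"])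
    fix t assume t: "0 \<le> t" "t \<le> y"
    have "cos (pi / 3) \<le> cos t" using t y \<open>1 < pi / 3\<close> by (intro cos_monotone_0_pi_le) auto
    then have "0 \<le> cos t - 1 / 2" by (simp add: cos_60)
    moreover have "((\<lambda>y. sin y - y / 2) has_real_derivative (cos t - 1 / 2)) (at t)"
      by (auto intro!: derivative_eq_intros)
    ultimately show "\<exists>d. ((\<lambda>y. sin y - y / 2) has_real_derivative d) (at t) \<and> 0 \<le> d" by blast
  qed (use y in auto)
  then show ?thesis by simp
qed

text \<open>
  The range extends a little beyond \<open>\<pi>\<close> because a phase of modulus up to \<open>\<pi>\<close> will be added to a small argument.
\<close>

lemma one_minus_cos_ge:
  fixes x z :: real
  assumes "0 \<le> x" "x \<le> 1" "x \<le> \<bar>z\<bar>" "\<bar>z\<bar> \<le> pi + 1"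
  shows "x\<^sup>2 / 4 \<le> 1 - cos z"
proof -
  have small: "y\<^sup>2 / 4 \<le> 1 - cos y" if y: "0 \<le> y" "y \<le> 1" for y :: real
  proof -
    have "1 - cos 0 - 0\<^sup>2 / 4 \<le> 1 - cos y - y\<^sup>2 / 4"
    proof (rule DERIV_nonneg_imp_nondecreasing[of 0 y "\<lambda>y. 1 - cos y - y\<^sup>2 / 4"])
      fix t assume t: "0 \<le> t" "t \<le> y"
      have "((\<lambda>y. 1 - cos y - y\<^sup>2 / 4) has_real_derivative (sin t - t / 2)) (at t)"
        by (auto intro!: derivative_eq_intros)
      then show "\<exists>d. ((\<lambda>y. 1 - cos y - y\<^sup>2 / 4) has_real_derivative d) (at t) \<and> 0 \<le> d"
        using sin_ge_half[of t] t y by auto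
    qed (use y in auto)
    then show ?thesis by simp
  qed
  define w where "w = \<bar>z\<bar>"
  have w: "x \<le> w" "w \<le> pi + 1" using assms by (auto simp: w_def)
  have "x\<^sup>2 / 4 \<le> 1 - cos w"
  proof -
    consider "w \<le> 1" | "1 < w" "w \<le> pi" | "pi < w" by linarith
    then show ?thesis
    proof cases
      case 1
      have "x\<^sup>2 \<le> w\<^sup>2" using assms w by (intro power_mono) auto
      then show ?thesis using small[of w] 1 w assms by linarith
    next
      case 2
      have "cos w \<le> cos 1" using 2 by (intro cos_monotone_0_pi_le) auto
      then have "1\<^sup>2 / 4 \<le> 1 - cos w" using small[of 1] by linarith
      moreover have "x\<^sup>2 \<le> 1" using assms by (simp add: power_le_one)
      ultimately show ?thesis by simp
    next
      case 3
      have "0 \<le> cos (w - pi)" using 3 w pi_gt3 by (intro cos_ge_zero) auto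
      then have "cos w \<le> 0" by (simp add: cos_diff)
      moreover have "x\<^sup>2 \<le> 1" using assms by (simp add: power_le_one)
      ultimately show ?thesis by simp
    qed
  qed
  then show ?thesis by (simp add: w_def)
qed

lemma one_minus_cos_le: "1 - cos (x::real) \<le> 2 * min 1 (x\<^sup>2)"
proof -
  have "1 - cos x = 2 * (sin (x / 2))\<^sup>2"
    using cos_double_sin[of "x / 2"] by simp
  moreover have "(sin (x / 2))\<^sup>2 \<le> (x / 2)\<^sup>2"
    using power_mono[OF abs_sin_x_le_abs_x[of "x / 2"], of 2] by (simp add: power_divide)
  moreover have "(sin (x / 2))\<^sup>2 \<le> 1" by (simp add: abs_square_le_1)
  moreover have "(x / 2)\<^sup>2 \<le> x\<^sup>2" by (simp add: power_divide)
  ultimately show ?thesis by (auto simp: min_def)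
qed

context real_distribution begin

lemma char_normalized_sum:
  "char (distr (Pi\<^sub>M {..<n} (\<lambda>_. M)) borel (\<lambda>x. (\<Sum>i<n. x i) / a)) t = char M (t / a) ^ n"
proof -
  interpret P: product_prob_space "\<lambda>_::nat. M" "{..<n}" ..
  have "char (distr (Pi\<^sub>M {..<n} (\<lambda>_. M)) borel (\<lambda>x. (\<Sum>i<n. x i) / a)) t
      = (CLINT x|Pi\<^sub>M {..<n} (\<lambda>_. M). iexp (t * ((\<Sum>i<n. x i) / a)))"
    unfolding char_def by (subst integral_distr) auto
  also have "\<dots> = (CLINT x|Pi\<^sub>M {..<n} (\<lambda>_. M). (\<Prod>i<n. iexp (t / a * x i)))"
    by (intro Bochner_Integration.integral_cong refl)
       (simp add: exp_sum sum_distrib_left sum_divide_distrib flip: exp_sum)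
  also have "\<dots> = (\<Prod>i<n. CLINT x|M. iexp (t / a * x))"
  proof (rule P.product_integral_prod)
    show "complex_integrable M (\<lambda>x. iexp (t / a * x))" for i
      by (rule integrable_iexp) auto
  qed simp
  also have "\<dots> = char M (t / a) ^ n" by (simp add: char_def)
  finally show ?thesis .
qed

lemma real_distribution_normalized_sum:
  "real_distribution (distr (Pi\<^sub>M {..<n} (\<lambda>_. M)) borel (\<lambda>x. (\<Sum>i<n. x i) / a))"
proof -
  interpret P: prob_space "Pi\<^sub>M {..<n} (\<lambda>_. M)"
    by (intro prob_space_PiM prob_space_axioms)
  show ?thesis by (rule P.real_distribution_distr) measurable
qed

lemma Re_char: "1 - Re (char M t) = (\<integral>x. 1 - cos (t * x) \<partial>M)"
proof -
  have int: "integrable M (\<lambda>x. cos (t * x))"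
    by (rule integrable_const_bound[of _ 1]) auto
  have "Re (char M t) = (\<integral>x. Re (iexp (t * x)) \<partial>M)"
    unfolding char_def by (intro integral_Re[symmetric] integrable_iexp) auto
  also have "\<dots> = (\<integral>x. cos (t * x) \<partial>M)" by (simp add: Re_exp)
  finally show ?thesis using int by (simp del: space_eq_univ add: prob_space)
qed

lemma Im_char: "Im (char M t) = (\<integral>x. sin (t * x) \<partial>M)"
proof -
  have "Im (char M t) = (\<integral>x. Im (iexp (t * x)) \<partial>M)"
    unfolding char_def by (intro integral_Im[symmetric] integrable_iexp) auto
  then show ?thesis by (simp add: Im_exp)
qed

text \<open>
  Rotating by the argument \<open>\<tau>\<close> of the characteristic function makes it real.
\<close>

lemma cmod_char_eq_integral_cos:
  "\<exists>\<tau>. - pi < \<tau> \<and> \<tau> \<le> pi \<and> 1 - cmod (char M t) = (\<integral>x. 1 - cos (t * x - \<tau>) \<partial>M)"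
proof (intro exI conjI)
  define \<tau> where "\<tau> = Arg (char M t)"
  show "- pi < \<tau>" "\<tau> \<le> pi" using mpi_less_Arg Arg_le_pi by (auto simp: \<tau>_def)
  have int: "integrable M (\<lambda>x. cos (t * x - \<tau>))"
    by (rule integrable_const_bound[of _ 1]) auto
  have int': "integrable M (\<lambda>x. iexp (t * x - \<tau>))" by (intro integrable_iexp) auto
  have "complex_of_real (cmod (char M t)) = exp (- (\<i> * \<tau>)) * char M t"
  proof (cases "char M t = 0")
    case False
    then have "char M t = cmod (char M t) * exp (\<i> * \<tau>)" unfolding \<tau>_def by (rule Arg_eq)
    then show ?thesis by (metis (no_types, lifting) exp_minus_inverse mult.assoc mult.commute mult_1)
  qed simp
  also have "\<dots> = (CLINT x|M. exp (- (\<i> * \<tau>)) * iexp (t * x))"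
    unfolding char_def by simp
  also have "\<dots> = (CLINT x|M. iexp (t * x - \<tau>))"
    by (intro Bochner_Integration.integral_cong refl) (simp add: algebra_simps flip: exp_add)
  finally have "Re (complex_of_real (cmod (char M t))) = (\<integral>x. Re (iexp (t * x - \<tau>)) \<partial>M)"
    using int' by (simp only: integral_Re)
  then have "cmod (char M t) = (\<integral>x. cos (t * x - \<tau>) \<partial>M)" by (simp add: Re_exp)
  then show "1 - cmod (char M t) = (\<integral>x. 1 - cos (t * x - \<tau>) \<partial>M)"
    using int by (simp del: space_eq_univ add: prob_space)
qed

text \<open>
  At frequency \<open>1/n\<close> the law sits on a lattice of mesh \<open>2 \<pi> n\<close>; two points at finite distance cannot lie in
  all these lattices.
\<close>

lemma point_mass_if_cmod_char_1:
  assumes "\<And>u. cmod (char M u) = 1"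
  shows "\<exists>x. M = return borel x"
proof -
  have "\<exists>\<tau>. AE x in M. cos (1 / real (Suc n) * x - \<tau>) = 1" for n
  proof -
    obtain \<tau> where "1 - cmod (char M (1 / real (Suc n))) = (\<integral>x. 1 - cos (1 / real (Suc n) * x - \<tau>) \<partial>M)"
      using cmod_char_eq_integral_cos by blast
    then have "(\<integral>x. 1 - cos (1 / real (Suc n) * x - \<tau>) \<partial>M) = 0" using assms by simp
    moreover have "integrable M (\<lambda>x. 1 - cos (1 / real (Suc n) * x - \<tau>))"
      by (rule integrable_const_bound[of _ 2]) (auto simp: abs_le_iff intro: order_trans[of _ 1])
    ultimately have "AE x in M. 1 - cos (1 / real (Suc n) * x - \<tau>) = 0"
      by (subst (asm) integral_nonneg_eq_0_iff_AE) auto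
    then show ?thesis by (intro exI[of _ \<tau>]) auto
  qed
  then obtain \<tau> where "\<And>n. AE x in M. cos (1 / real (Suc n) * x - \<tau> n) = 1" by metis
  then have AE: "AE x in M. \<forall>n. cos (1 / real (Suc n) * x - \<tau> n) = 1" by (simp add: AE_all_countable)
  have "\<exists>x0. \<forall>n. cos (1 / real (Suc n) * x0 - \<tau> n) = 1"
  proof (rule ccontr)
    assume "\<not> ?thesis"
    then have no: "\<not> (\<forall>n. cos (1 / real (Suc n) * x - \<tau> n) = 1)" for x by blast
    have "AE x in M. False" using AE by eventually_elim (use no in blast)
    then show False using AE_const[of False] by simp
  qed
  then obtain x0 where x0: "\<And>n. cos (1 / real (Suc n) * x0 - \<tau> n) = 1" by blast
  have "AE x in M. x = x0"
    using AE
  proof eventually_elim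
    case (elim x)
    obtain n :: nat where n: "\<bar>x - x0\<bar> \<le> real n" using real_arch_simple by blast
    define z where "z = (x - x0) / real (Suc n)"
    have "sin (1 / real (Suc n) * x - \<tau> n) = 0" "sin (1 / real (Suc n) * x0 - \<tau> n) = 0"
      using elim x0[of n] by (auto intro: cos_one_sin_zero)
    then have "cos ((1 / real (Suc n) * x - \<tau> n) - (1 / real (Suc n) * x0 - \<tau> n)) = 1"
      using elim x0[of n] unfolding cos_diff[of "1 / real (Suc n) * x - \<tau> n"] by simp
    moreover have "(1 / real (Suc n) * x - \<tau> n) - (1 / real (Suc n) * x0 - \<tau> n) = z"
      by (simp add: z_def diff_divide_distrib)
    ultimately have "cos z = 1" by simp
    moreover have "\<bar>z\<bar> \<le> 1" using n by (simp add: z_def abs_divide)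
    ultimately have "\<bar>z\<bar>\<^sup>2 / 4 \<le> 0" using one_minus_cos_ge[of "\<bar>z\<bar>" z] pi_gt3 by simp
    then show ?case by (simp add: z_def)
  qed
  then have "M = return M x0" by (rule AE_eq_constD)
  also have "\<dots> = return borel x0" by (rule return_cong) simp
  finally show ?thesis by blast
qed

end

text \<open>
  Convergence at moving frequencies, from an almost surely convergent realisation of the weak limit.
\<close>

lemma weak_conv_char_tendsto:
  assumes "\<And>n. real_distribution (\<mu> n)" "real_distribution M" "weak_conv_m \<mu> M" "u \<longlonglongrightarrow> v"
  shows "(\<lambda>n. char (\<mu> n) (u n)) \<longlonglongrightarrow> char M v"
proof -
  obtain \<Omega> :: "real measure" and Y_seq Y where \<Omega>: "prob_space \<Omega>"
    and Yn [measurable]: "\<And>n. Y_seq n \<in> borel_measurable \<Omega>" and Yn_distr: "\<And>n. distr \<Omega> borel (Y_seq n) = \<mu> n"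
    and Y: "Y \<in> measurable \<Omega> lborel" and Y_distr: "distr \<Omega> borel Y = M"
    and lim: "\<And>x. x \<in> space \<Omega> \<Longrightarrow> (\<lambda>n. Y_seq n x) \<longlonglongrightarrow> Y x"
    using Skorohod[OF assms(1-3)] by blast
  interpret \<Omega>: prob_space \<Omega> by (rule \<Omega>)
  have [measurable]: "Y \<in> borel_measurable \<Omega>" using Y by simp
  have "(\<lambda>n. CLINT x|\<Omega>. iexp (u n * Y_seq n x)) \<longlonglongrightarrow> (CLINT x|\<Omega>. iexp (v * Y x))"
  proof (rule integral_dominated_convergence[where w = "\<lambda>_. 1"])
    show "AE x in \<Omega>. (\<lambda>n. iexp (u n * Y_seq n x)) \<longlonglongrightarrow> iexp (v * Y x)"
      by (intro AE_I2 tendsto_intros assms lim)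
  qed (auto simp: norm_exp_eq_Re)
  moreover have "char (\<mu> n) t = (CLINT x|\<Omega>. iexp (t * Y_seq n x))" for n t
    unfolding Yn_distr[symmetric] char_def by (subst integral_distr) auto
  moreover have "char M v = (CLINT x|\<Omega>. iexp (v * Y x))"
    unfolding Y_distr[symmetric] char_def by (subst integral_distr) auto
  ultimately show ?thesis by simp
qed

lemma strictly_stable_char:
  assumes "strictly_stable \<alpha> s"
  shows "char s t ^ 2 = char s (2 powr (1 / \<alpha>) * t)"
proof -
  interpret s: real_distribution s using assms by (simp add: strictly_stable_def)
  interpret ss: pair_prob_space s s ..
  have "convolution (distr s borel (\<lambda>x. 1 powr (1 / \<alpha>) * x)) (distr s borel (\<lambda>x. 1 powr (1 / \<alpha>) * x))
          = distr s borel (\<lambda>x. (1 + 1) powr (1 / \<alpha>) * x)"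
    using assms unfolding strictly_stable_def by (metis zero_less_one)
  moreover have "distr s borel (\<lambda>x. 1 powr (1 / \<alpha>) * x) = s"
    by (simp add: distr_id2)
  ultimately have conv: "convolution s s = distr s borel (\<lambda>x. 2 powr (1 / \<alpha>) * x)" by simp
  have "char (convolution s s) t = (CLINT z|s \<Otimes>\<^sub>M s. iexp (t * (fst z + snd z)))"
    unfolding convolution_def char_def by (subst integral_distr) (auto simp: case_prod_unfold)
  also have "\<dots> = (CLINT x|s. CLINT y|s. iexp (t * (x + y)))"
    by (subst ss.integral_fst'[symmetric]) (auto intro!: ss.integrable_iexp simp: case_prod_unfold)
  also have "\<dots> = (CLINT x|s. CLINT y|s. iexp (t * x) * iexp (t * y))"
    by (simp add: algebra_simps exp_add)
  also have "\<dots> = char s t ^ 2"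
    unfolding char_def by (simp add: power2_eq_square)
  finally have "char s t ^ 2 = char (distr s borel (\<lambda>x. 2 powr (1 / \<alpha>) * x)) t" by (simp add: conv)
  also have "\<dots> = char s (2 powr (1 / \<alpha>) * t)"
    unfolding char_def by (subst integral_distr) (auto simp: mult_ac)
  finally show ?thesis .
qed

lemma growth_of_ratio_limit:
  fixes A :: "nat \<Rightarrow> real"
  assumes pos: "\<And>j. 0 < A j" and lim: "(\<lambda>j. A (Suc j) / A j) \<longlonglongrightarrow> R"
  shows "0 < r \<Longrightarrow> r < R \<Longrightarrow> \<exists>c>0. \<exists>J. \<forall>j\<ge>J. c * r ^ j \<le> A j"
    and "R < r \<Longrightarrow> 0 < r \<Longrightarrow> \<exists>c>0. \<exists>J. \<forall>j\<ge>J. A j \<le> c * r ^ j"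
proof -
  show "\<exists>c>0. \<exists>J. \<forall>j\<ge>J. c * r ^ j \<le> A j" if r: "0 < r" "r < R"
  proof -
    obtain J where J: "\<And>j. J \<le> j \<Longrightarrow> r < A (Suc j) / A j"
      using order_tendstoD(1)[OF lim r(2)] by (auto simp: eventually_sequentially)
    have "A J / r ^ J * r ^ j \<le> A j" if "J \<le> j" for j
      using that
    proof (induction j rule: dec_induct)
      case (step n)
      have "A J / r ^ J * r ^ Suc n = r * (A J / r ^ J * r ^ n)" by simp
      also have "\<dots> \<le> r * A n" using step r by (intro mult_left_mono) auto
      also have "\<dots> \<le> A (Suc n)" using J[of n] step pos[of n] by (simp add: field_simps)
      finally show ?case .
    qed (use r in simp)
    then show ?thesis using pos[of J] r by (intro exI[of _ "A J / r ^ J"]) auto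
  qed
  show "\<exists>c>0. \<exists>J. \<forall>j\<ge>J. A j \<le> c * r ^ j" if r: "R < r" "0 < r"
  proof -
    obtain J where J: "\<And>j. J \<le> j \<Longrightarrow> A (Suc j) / A j < r"
      using order_tendstoD(2)[OF lim r(1)] by (auto simp: eventually_sequentially)
    have "A j \<le> A J / r ^ J * r ^ j" if "J \<le> j" for j
      using that
    proof (induction j rule: dec_induct)
      case (step n)
      have "A (Suc n) \<le> r * A n" using J[of n] step pos[of n] by (simp add: field_simps)
      also have "\<dots> \<le> r * (A J / r ^ J * r ^ n)" using step r by (intro mult_left_mono) auto
      finally show ?case by (simp add: mult_ac)
    qed (use r in simp)
    then show ?thesis using pos[of J] r by (intro exI[of _ "A J / r ^ J"]) auto
  qed
qed

section \<open>Trigonometric sums\<close>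

text \<open>
  On the dyadic scales below \<open>2\<^sup>n\<close>, \<open>cosine_sum\<close> adds up the tail masses of a law and \<open>sine_gap\<close> its truncated
  mean.  For tails of index 1 every scale contributes the same amount to the former, while convergence without
  centring makes the latter negligible.
\<close>

definition cosine_sum :: "nat \<Rightarrow> real \<Rightarrow> real" where
  "cosine_sum n y = (\<Sum>m<n. 2 ^ m * (1 - cos (y / 2 ^ m)))"

definition sine_gap :: "nat \<Rightarrow> real \<Rightarrow> real" where
  "sine_gap n y = 2 ^ n * sin (y / 2 ^ n) - sin y"

definition sine_defect :: "real \<Rightarrow> real" where
  "sine_defect z = 2 * sin z - sin (2 * z)"

lemma sine_defect_eq: "sine_defect z = 2 * sin z * (1 - cos z)"
  unfolding sine_defect_def sin_double by (simp add: algebra_simps)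

lemma abs_sine_defect_le: "\<bar>sine_defect z\<bar> \<le> 2 * (1 - cos z)"
proof -
  have "\<bar>sine_defect z\<bar> = 2 * \<bar>sin z\<bar> * (1 - cos z)"
    by (simp add: sine_defect_eq abs_mult)
  also have "\<dots> \<le> 2 * 1 * (1 - cos z)" by (intro mult_right_mono mult_left_mono) auto
  finally show ?thesis by simp
qed

lemma sine_gap_0: "sine_gap 0 y = 0"
  by (simp add: sine_gap_def)

lemma sine_gap_Suc: "sine_gap (Suc n) y = sine_gap n y + 2 ^ n * sine_defect (y / 2 ^ Suc n)"
  by (simp add: sine_gap_def sine_defect_def right_diff_distrib)

lemma min_square_le_powr:
  fixes z :: real
  assumes "0 < e" "e \<le> 1"
  shows "min 1 (z\<^sup>2) \<le> \<bar>z\<bar> powr (1 + e)"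
proof (cases "\<bar>z\<bar> \<le> 1")
  case True
  have "z\<^sup>2 = \<bar>z\<bar> powr 2" by (cases "z = 0") (simp_all add: powr_numeral)
  also have "\<dots> \<le> \<bar>z\<bar> powr (1 + e)" using True assms by (intro powr_mono') auto
  finally show ?thesis by simp
next
  case False
  then have "1 \<le> \<bar>z\<bar> powr (1 + e)" using assms by (intro ge_one_powr_ge_zero) auto
  then show ?thesis by simp
qed

lemma one_minus_cos_le_powr:
  fixes y z :: real
  assumes "0 < e" "e \<le> 1" "\<bar>z\<bar> \<le> \<bar>y\<bar>"
  shows "1 - cos z \<le> 2 * \<bar>y\<bar> powr (1 + e)"
proof -
  have "1 - cos z \<le> 2 * min 1 (z\<^sup>2)" by (rule one_minus_cos_le)
  also have "\<dots> \<le> 2 * \<bar>z\<bar> powr (1 + e)" using min_square_le_powr[OF assms(1,2), of z] by simp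
  also have "\<dots> \<le> 2 * \<bar>y\<bar> powr (1 + e)" using assms by (intro mult_left_mono powr_mono2) auto
  finally show ?thesis .
qed

lemma abs_div_power2_le: "\<bar>y / 2 ^ n\<bar> \<le> \<bar>y :: real\<bar>"
  by (simp add: abs_divide divide_le_eq mult_le_cancel_left1)

lemma cosine_sum_le_powr:
  assumes "0 < e" "e \<le> 1"
  shows "cosine_sum n y \<le> 2 * 2 ^ n * \<bar>y\<bar> powr (1 + e)"
proof (induction n)
  case (Suc n)
  have "cosine_sum (Suc n) y = cosine_sum n y + 2 ^ n * (1 - cos (y / 2 ^ n))"
    by (simp add: cosine_sum_def)
  also have "\<dots> \<le> 2 * 2 ^ n * \<bar>y\<bar> powr (1 + e) + 2 ^ n * (2 * \<bar>y\<bar> powr (1 + e))"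
    by (intro add_mono Suc mult_left_mono one_minus_cos_le_powr assms abs_div_power2_le) auto
  finally show ?case by (simp add: algebra_simps)
qed (simp add: cosine_sum_def)

lemma abs_sine_gap_le_powr:
  assumes "0 < e" "e \<le> 1"
  shows "\<bar>sine_gap n y\<bar> \<le> 4 * 2 ^ n * \<bar>y\<bar> powr (1 + e)"
proof (induction n)
  case (Suc n)
  have "\<bar>sine_gap (Suc n) y\<bar> \<le> \<bar>sine_gap n y\<bar> + 2 ^ n * \<bar>sine_defect (y / 2 ^ Suc n)\<bar>"
    unfolding sine_gap_Suc by (rule order_trans[OF abs_triangle_ineq]) (simp add: abs_mult)
  also have "\<dots> \<le> 4 * 2 ^ n * \<bar>y\<bar> powr (1 + e) + 2 ^ n * (2 * (2 * \<bar>y\<bar> powr (1 + e)))"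
    by (intro add_mono Suc mult_left_mono order_trans[OF abs_sine_defect_le] one_minus_cos_le_powr assms abs_div_power2_le) auto
  finally show ?case by (simp add: algebra_simps)
qed (simp add: sine_gap_0)

lemma one_minus_cos_le_half_square: "1 - cos (z::real) \<le> z\<^sup>2 / 2"
proof -
  have "1 - cos z = 2 * (sin (z / 2))\<^sup>2" using cos_double_sin[of "z / 2"] by simp
  also have "\<dots> \<le> 2 * (z / 2)\<^sup>2"
    using power_mono[OF abs_sin_x_le_abs_x[of "z / 2"], of 2] by (simp add: power_divide)
  finally show ?thesis by (simp add: power_divide)
qed

lemma cosine_sum_le_square: "cosine_sum n y \<le> y\<^sup>2"
proof -
  have "cosine_sum n y \<le> y\<^sup>2 * (1 - (1 / 2) ^ n)"
  proof (induction n)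
    case (Suc n)
    have "cosine_sum (Suc n) y = cosine_sum n y + 2 ^ n * (1 - cos (y / 2 ^ n))"
      by (simp add: cosine_sum_def)
    also have "\<dots> \<le> y\<^sup>2 * (1 - (1 / 2) ^ n) + 2 ^ n * ((y / 2 ^ n)\<^sup>2 / 2)"
      by (intro add_mono Suc mult_left_mono one_minus_cos_le_half_square) auto
    also have "2 ^ n * ((y / 2 ^ n)\<^sup>2 / 2) = y\<^sup>2 * ((1 / 2) ^ n / 2)"
      by (simp add: power_divide power2_eq_square field_simps)
    finally show ?case by (simp add: algebra_simps)
  qed (simp add: cosine_sum_def)
  also have "\<dots> \<le> y\<^sup>2 * 1" by (intro mult_left_mono) auto
  finally show ?thesis by simp
qed

lemma cosine_sum_le_2_power: "cosine_sum n y \<le> 2 * 2 ^ n"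
proof (induction n)
  case (Suc n)
  have "1 - cos (y / 2 ^ n) \<le> 2" using cos_ge_minus_one[of "y / 2 ^ n"] by linarith
  then have "2 ^ n * (1 - cos (y / 2 ^ n)) \<le> 2 ^ n * 2" by (intro mult_left_mono) auto
  moreover have "cosine_sum (Suc n) y = cosine_sum n y + 2 ^ n * (1 - cos (y / 2 ^ n))"
    by (simp add: cosine_sum_def)
  ultimately show ?case using Suc unfolding power_Suc by linarith
qed (simp add: cosine_sum_def)

lemma cosine_sum_le_linear:
  assumes y: "1 < y"
  shows "cosine_sum n y \<le> 5 * y"
proof -
  have "\<exists>M. y \<le> 2 ^ M" using real_arch_pow[of 2 y] by (auto intro: less_imp_le)
  define M where "M = (LEAST M. y \<le> 2 ^ M)"
  have M: "y \<le> 2 ^ M" unfolding M_def using \<open>\<exists>M. y \<le> 2 ^ M\<close> by (rule LeastI_ex)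
  have "M \<noteq> 0" using M y by (cases M) auto
  then obtain M' where M': "M = Suc M'" by (cases M) auto
  have "\<not> y \<le> 2 ^ M'" using not_less_Least[of M' "\<lambda>M. y \<le> 2 ^ M"] M' by (simp add: M_def)
  then have M2: "2 ^ M \<le> 2 * y" using M' by simp
  have "cosine_sum n y \<le> cosine_sum (M + n) y"
    unfolding cosine_sum_def by (intro sum_mono2) auto
  also have "\<dots> = cosine_sum M y + (\<Sum>i<n. 2 ^ (M + i) * (1 - cos (y / 2 ^ (M + i))))"
  proof -
    have "(\<Sum>m<M + k. f m) = (\<Sum>m<M. f m) + (\<Sum>i<k. f (M + i))" for f :: "nat \<Rightarrow> real" and k
      by (induction k) (simp_all add: add.assoc)
    then show ?thesis unfolding cosine_sum_def .
  qed
  also have "(\<Sum>i<n. 2 ^ (M + i) * (1 - cos (y / 2 ^ (M + i)))) = 2 ^ M * cosine_sum n (y / 2 ^ M)"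
    by (simp add: cosine_sum_def sum_distrib_left power_add mult.assoc)
  also have "\<dots> \<le> 2 ^ M * (y / 2 ^ M)\<^sup>2" by (intro mult_left_mono cosine_sum_le_square) auto
  also have "\<dots> = y * (y / 2 ^ M)" by (simp add: power2_eq_square)
  also have "\<dots> \<le> y * 1" using M y by (intro mult_left_mono) auto
  finally have "cosine_sum n y \<le> cosine_sum M y + y" by simp
  also have "\<dots> \<le> 2 * 2 ^ M + y" using cosine_sum_le_2_power[of M y] by simp
  finally show ?thesis using M2 by simp
qed

lemma sine_gap_nonneg:
  assumes "0 \<le> y" "y \<le> 4"
  shows "0 \<le> sine_gap n y"
proof (induction n)
  case (Suc n)
  have "y / 2 ^ Suc n \<le> 4 / 2 ^ Suc n" using assms by (intro divide_right_mono) auto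
  also have "\<dots> \<le> 4 / 2 ^ 1" by (intro divide_left_mono power_increasing) auto
  finally have "y / 2 ^ Suc n \<le> pi" using pi_gt3 by simp
  then have "0 \<le> sine_defect (y / 2 ^ Suc n)"
    unfolding sine_defect_eq using assms by (intro mult_nonneg_nonneg sin_ge_zero) auto
  with Suc show ?case by (simp add: sine_gap_Suc)
qed (simp add: sine_gap_0)

text \<open>
  For large positive arguments up to \<open>2\<^sup>n\<close> both sides are linear.  Near 0, beyond \<open>2\<^sup>n\<close> and on the negative
  axis the other three terms take over; their expectations will not grow with \<open>n\<close>.
\<close>

lemma cosine_sum_le:
  assumes e: "0 < e" "e \<le> 1"
  shows "cosine_sum n y \<le> 64 * (1 - cos y) + 20 * sine_gap n y + 42 * 2 ^ n * indicator {z. 2 ^ n < \<bar>z\<bar>} y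
     + 82 * 2 ^ n * max 0 (- y) powr (1 + e)"
proof -
  have nonneg: "0 \<le> 64 * (1 - cos y)" "0 \<le> 42 * 2 ^ n * (indicator {z. 2 ^ n < \<bar>z\<bar>} y :: real)"
    "0 \<le> 82 * 2 ^ n * max 0 (- y) powr (1 + e)" by auto
  consider "y < 0" | "0 \<le> y" "y \<le> 4" | "4 < y" "y \<le> 2 ^ n" | "2 ^ n < y" "4 < y" by linarith
  then show ?thesis
  proof cases
    case 1
    have "cosine_sum n y - 20 * sine_gap n y \<le> 2 * 2 ^ n * \<bar>y\<bar> powr (1 + e) + 20 * (4 * 2 ^ n * \<bar>y\<bar> powr (1 + e))"
      using cosine_sum_le_powr[OF e, of n y] abs_sine_gap_le_powr[OF e, of n y] by linarith
    also have "\<dots> = 82 * 2 ^ n * max 0 (- y) powr (1 + e)" using 1 by simp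
    finally show ?thesis using nonneg by linarith
  next
    case 2
    have "y\<^sup>2 \<le> 64 * (1 - cos y)"
    proof (cases "y \<le> 1")
      case True
      have "y\<^sup>2 / 4 \<le> 1 - cos y" using one_minus_cos_ge[of y y] 2 True pi_gt3 by simp
      then have "64 * (y\<^sup>2 / 4) \<le> 64 * (1 - cos y)" by (intro mult_left_mono) auto
      moreover have "y\<^sup>2 \<le> 64 * (y\<^sup>2 / 4)" by simp
      ultimately show ?thesis by (rule order_trans[rotated])
    next
      case False
      have "1\<^sup>2 / 4 \<le> 1 - cos y" using one_minus_cos_ge[of 1 y] 2 False pi_gt3 by simp
      moreover have "y\<^sup>2 \<le> 4\<^sup>2" using 2 by (intro power_mono) auto
      ultimately show ?thesis by simp
    qed
    then show ?thesis using cosine_sum_le_square[of n y] sine_gap_nonneg[OF 2, of n] nonneg by linarith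
  next
    case 3
    have "y / 2 ^ n / 2 \<le> sin (y / 2 ^ n)" using 3 by (intro sin_ge_half) auto
    then have "2 ^ n * (y / 2 ^ n / 2) \<le> 2 ^ n * sin (y / 2 ^ n)" by (intro mult_left_mono) auto
    moreover have "2 ^ n * (y / 2 ^ n / 2) = y / 2" by simp
    ultimately have "y / 2 - 1 \<le> sine_gap n y" using sin_le_one[of y] unfolding sine_gap_def by linarith
    then have "5 * y \<le> 20 * sine_gap n y" using 3 by simp
    then show ?thesis using cosine_sum_le_linear[of y n] 3 nonneg by linarith
  next
    case 4
    have "2 ^ n * (- 1) \<le> 2 ^ n * sin (y / 2 ^ n)" by (intro mult_left_mono) auto
    then have "- (2 ^ n) - 1 \<le> sine_gap n y" using sin_le_one[of y] unfolding sine_gap_def by linarith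
    moreover have "(1::real) \<le> 2 ^ n" by simp
    moreover have "42 * 2 ^ n * indicator {z. 2 ^ n < \<bar>z\<bar>} y = (42 * 2 ^ n :: real)" using 4 by simp
    ultimately show ?thesis using cosine_sum_le_2_power[of n y] nonneg by linarith
  qed
qed

section \<open>Attraction to a stable law\<close>

text \<open>
  The sequence \<open>A j\<close> norms the sum of \<open>2\<^sup>j\<close> steps.  Dyadic times suffice, because doubling the number of summands
  relates the stable law to itself.
\<close>

locale attracted_law = real_distribution N for N :: "real measure" +
  fixes \<alpha> :: real and s :: "real measure" and A :: "nat \<Rightarrow> real"
  assumes \<alpha>_pos: "0 < \<alpha>"
    and stable: "strictly_stable \<alpha> s"
    and A_pos: "\<And>j. 0 < A j"
    and attraction: "weak_conv_m (\<lambda>j. distr (Pi\<^sub>M {..<2 ^ j :: nat} (\<lambda>_. N)) borel (\<lambda>x. (\<Sum>i<2 ^ j. x i) / A j)) s"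
    and mean_int: "integrable N (\<lambda>x. x)"
    and mean_zero: "(\<integral>x. x \<partial>N) = 0"
    and nondegenerate: "\<not> (AE x in N. x = 0)"
begin

interpretation s: real_distribution s
  using stable by (simp add: strictly_stable_def)

definition \<rho> :: real where "\<rho> = 2 powr (- (1 / \<alpha>))"

lemma \<rho>: "0 < \<rho>" "\<rho> < 1"
  using \<alpha>_pos powr_less_mono[of "- (1 / \<alpha>)" 0 2] by (auto simp: \<rho>_def)

lemma inverse_\<rho>: "inverse \<rho> = 2 powr (1 / \<alpha>)"
  by (simp add: \<rho>_def powr_minus)

lemma char_doubling: "char s u = char s (\<rho> * u) ^ 2"
proof -
  have eq: "2 powr (1 / \<alpha>) * (\<rho> * u) = u" unfolding inverse_\<rho>[symmetric] using \<rho>(1) by simp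
  show ?thesis using strictly_stable_char[OF stable, of "\<rho> * u"] unfolding eq by simp
qed

lemma char_limit:
  assumes "u \<longlonglongrightarrow> v" "strict_mono r"
  shows "(\<lambda>j. char N (u j / A (r j)) ^ (2 ^ r j)) \<longlonglongrightarrow> char s v"
proof -
  define \<mu> where "\<mu> j = distr (Pi\<^sub>M {..<2 ^ j :: nat} (\<lambda>_. N)) borel (\<lambda>x. (\<Sum>i<2 ^ j. x i) / A j)" for j
  have "weak_conv_m (\<lambda>j. \<mu> (r j)) s"
    using attraction LIMSEQ_subseq_LIMSEQ[OF _ assms(2)]
    unfolding weak_conv_m_def weak_conv_def \<mu>_def[symmetric] by (auto simp: o_def)
  then have "(\<lambda>j. char (\<mu> (r j)) (u j)) \<longlonglongrightarrow> char s v"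
    by (intro weak_conv_char_tendsto assms(1) s.real_distribution_axioms)
       (auto simp: \<mu>_def intro: real_distribution_normalized_sum)
  then show ?thesis by (simp add: \<mu>_def char_normalized_sum)
qed

lemma char_limit': "(\<lambda>j. char N (u / A j) ^ (2 ^ j)) \<longlonglongrightarrow> char s u"
  using char_limit[of "\<lambda>_. u" u "\<lambda>j. j"] by (simp add: strict_mono_def)

lemma char_nontrivial: "\<exists>v. cmod (char s v) < 1"
proof (rule ccontr)
  assume "\<not> ?thesis"
  then have "cmod (char s v) = 1" for v
    using s.cmod_char_le_1[of v] by (meson antisym_conv not_le)
  then obtain x where "s = return borel x" using s.point_mass_if_cmod_char_1 by blast
  then show False using stable by (auto simp: strictly_stable_def)
qed

text \<open>
  Iterating the scaling drives the frequency to 0, where the characteristic function is 1.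
\<close>

lemma scale_invariance_trivial:
  assumes x: "0 \<le> x" "x < 1" and inv: "\<And>v. cmod (char s v) = cmod (char s (x * v))"
  shows False
proof -
  have iter: "cmod (char s v) = cmod (char s (x ^ n * v))" for n v
  proof (induction n)
    case (Suc n)
    then show ?case using inv[of "x ^ n * v"] by (simp add: mult.assoc)
  qed simp
  have "cmod (char s v) = 1" for v
  proof -
    have "(\<lambda>n. x ^ n * v) \<longlonglongrightarrow> 0 * v"
      using x by (intro tendsto_mult LIMSEQ_realpow_zero tendsto_const) auto
    then have "(\<lambda>n. cmod (char s (x ^ n * v))) \<longlonglongrightarrow> cmod (char s (0 * v))"
      by (intro tendsto_norm isCont_tendsto_compose[OF s.isCont_char])
    then have "(\<lambda>n::nat. cmod (char s v)) \<longlonglongrightarrow> 1" by (simp add: iter[symmetric] s.char_zero)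
    then show ?thesis by (simp add: LIMSEQ_const_iff)
  qed
  then show False using char_nontrivial by simp
qed

text \<open>
  Convergence of types: along a subsequence on which the ratio has a limit \<open>l\<close> in \<open>[0, \<infinity>]\<close>, splitting a sum into
  two halves shows that the modulus of the limit's characteristic function has the same value at \<open>l u\<close> and
  at \<open>\<rho> u\<close> (or is constant, if \<open>l = \<infinity>\<close>).
\<close>

lemma norming_ratio: "(\<lambda>j. A j / A (Suc j)) \<longlonglongrightarrow> \<rho>"
proof (rule ccontr)
  define b where "b j = A j / A (Suc j)" for j
  have b: "0 < b j" for j using A_pos by (simp add: b_def)
  assume "\<not> ?thesis"
  then have "\<not> b \<longlonglongrightarrow> \<rho>" by (simp add: b_def[abs_def])
  then obtain e where e: "0 < e" and far: "\<forall>n. \<exists>j\<ge>n. e \<le> dist (b j) \<rho>"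
    unfolding lim_sequentially by (meson not_le)
  then have "infinite {j. e \<le> dist (b j) \<rho>}"
    unfolding infinite_nat_iff_unbounded_le by blast
  then obtain r :: "nat \<Rightarrow> nat" where r: "strict_mono r" and r_far: "\<And>n. e \<le> dist (b (r n)) \<rho>"
    using infinite_enumerate by blast
  \<comment> \<open>Compactifies \<open>[0, \<infinity>]\<close>, so that the ratio has a convergent subsequence with a limit that may be infinite.\<close>
  define c where "c j = b (r j) / (1 + b (r j))" for j
  have c: "0 < c j" "c j < 1" for j using b[of "r j"] by (auto simp: c_def divide_less_eq)
  have "seq_compact {0..1::real}" using compact_Icc by (simp add: compact_eq_seq_compact_metric)
  then obtain L q where L: "L \<in> {0..1}" and q: "strict_mono q" and cL: "(c \<circ> q) \<longlonglongrightarrow> L"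
    by (rule seq_compactE[where f = c]) (use c in \<open>auto simp: less_imp_le\<close>)
  define t where "t j = r (q j)" for j
  have t: "strict_mono t" using r q by (auto simp: t_def strict_mono_def)
  have t': "strict_mono (\<lambda>j. Suc (t j))" using t by (auto simp: strict_mono_def)
  have pow: "char N (u / A (t j)) ^ (2 ^ Suc (t j)) = (char N (u / A (t j)) ^ (2 ^ t j)) ^ 2" for u j
    by (simp add: power_mult[symmetric] mult.commute)
  show False
  proof (cases "L < 1")
    case True
    define l where "l = L / (1 - L)"
    have l0: "0 \<le> l" using True L by (simp add: l_def)
    have "(\<lambda>j. c (q j) / (1 - c (q j))) \<longlonglongrightarrow> L / (1 - L)"
      using cL True by (intro tendsto_divide tendsto_diff tendsto_const) (auto simp: o_def)
    moreover have "c (q j) / (1 - c (q j)) = b (t j)" for j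
      using b[of "r (q j)"] by (simp add: c_def t_def field_simps)
    ultimately have bl: "(\<lambda>j. b (t j)) \<longlonglongrightarrow> l" by (simp add: l_def)
    have "e \<le> dist l \<rho>"
      by (rule LIMSEQ_le_const[OF tendsto_dist[OF bl tendsto_const]]) (use r_far in \<open>auto simp: t_def\<close>)
    then have "l \<noteq> \<rho>" using e by auto
    have sq: "char s u = char s (l * u) ^ 2" for u
    proof -
      have "(\<lambda>j. char N (u / A (Suc (t j))) ^ (2 ^ Suc (t j))) \<longlonglongrightarrow> char s u"
        using char_limit[of "\<lambda>_. u" u, OF tendsto_const t'] by simp
      moreover have "char N (u / A (Suc (t j))) ^ (2 ^ Suc (t j)) = (char N (b (t j) * u / A (t j)) ^ (2 ^ t j)) ^ 2" for j
      proof -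
        have "u / A (Suc (t j)) = b (t j) * u / A (t j)"
          using A_pos[of "t j"] by (simp add: b_def)
        then show ?thesis by (simp add: power_mult[symmetric] mult.commute)
      qed
      moreover have "(\<lambda>j. (char N (b (t j) * u / A (t j)) ^ (2 ^ t j)) ^ 2) \<longlonglongrightarrow> char s (l * u) ^ 2"
        by (intro tendsto_power char_limit[of "\<lambda>j. b (t j) * u"] tendsto_mult bl tendsto_const t)
      ultimately show ?thesis
        by (intro LIMSEQ_unique[of _ "char s u" "char s (l * u) ^ 2"]) (simp_all only:)
    qed
    have eq: "cmod (char s (l * u)) = cmod (char s (\<rho> * u))" for u
    proof -
      have "cmod (char s (l * u)) ^ 2 = cmod (char s (\<rho> * u)) ^ 2"
        using sq[of u] char_doubling[of u] by (metis norm_power)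
      then show ?thesis by simp
    qed
    show False
    proof (cases "l < \<rho>")
      case True
      show False
      proof (rule scale_invariance_trivial[of "l / \<rho>"])
        show "cmod (char s v) = cmod (char s (l / \<rho> * v))" for v
          using eq[of "v / \<rho>"] \<rho> by simp
      qed (use True \<rho> l0 in auto)
    next
      case False
      then have "\<rho> < l" using \<open>l \<noteq> \<rho>\<close> by simp
      show False
      proof (rule scale_invariance_trivial[of "\<rho> / l"])
        show "cmod (char s v) = cmod (char s (\<rho> / l * v))" for v
          using eq[of "v / l"] \<rho> \<open>\<rho> < l\<close> by simp
      qed (use \<open>\<rho> < l\<close> \<rho> in auto)
    qed
  next
    case False
    then have L1: "L = 1" using L by simp
    have "(\<lambda>j. (1 - c (q j)) / c (q j)) \<longlonglongrightarrow> (1 - 1) / 1"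
      using cL unfolding L1 by (intro tendsto_divide tendsto_diff tendsto_const) (auto simp: o_def)
    moreover have "(1 - c (q j)) / c (q j) = 1 / b (t j)" for j
      using b[of "r (q j)"] by (simp add: c_def t_def field_simps)
    ultimately have bl: "(\<lambda>j. 1 / b (t j)) \<longlonglongrightarrow> 0" by simp
    have "cmod (char s u) = 1" for u
    proof -
      have "(\<lambda>j. (char N (u / A (t j)) ^ (2 ^ t j)) ^ 2) \<longlonglongrightarrow> char s u ^ 2"
        by (intro tendsto_power char_limit tendsto_const t)
      moreover have "(\<lambda>j. char N ((1 / b (t j) * u) / A (Suc (t j))) ^ (2 ^ Suc (t j))) \<longlonglongrightarrow> char s (0 * u)"
        by (intro char_limit[of _ _ "\<lambda>j. Suc (t j)"] tendsto_mult bl tendsto_const t')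
      moreover have "char N ((1 / b (t j) * u) / A (Suc (t j))) ^ (2 ^ Suc (t j)) = (char N (u / A (t j)) ^ (2 ^ t j)) ^ 2" for j
      proof -
        have "(1 / b (t j) * u) / A (Suc (t j)) = u / A (t j)"
          using A_pos[of "Suc (t j)"] by (simp add: b_def)
        then show ?thesis by (simp only: pow)
      qed
      ultimately have "char s u ^ 2 = char s (0 * u)"
        by (intro LIMSEQ_unique[of _ "char s u ^ 2" "char s (0 * u)"]) (simp_all only:)
      then have "cmod (char s u) ^ 2 = 1" by (simp add: s.char_zero flip: norm_power)
      then show ?thesis by (simp add: power2_eq_1_iff) (metis norm_ge_zero not_one_le_zero neg_0_le_iff_le)
    qed
    then show False using char_nontrivial by simp
  qed
qed

lemma norming_growth: "(\<lambda>j. A (Suc j) / A j) \<longlonglongrightarrow> 2 powr (1 / \<alpha>)"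
  using tendsto_inverse[OF norming_ratio] \<rho>(1) unfolding inverse_\<rho> by (simp only: inverse_divide)

lemma norming_lower:
  assumes "0 < r" "r < 2 powr (1 / \<alpha>)"
  shows "\<exists>c>0. \<exists>J. \<forall>j\<ge>J. c * r ^ j \<le> A j"
  using growth_of_ratio_limit(1)[OF A_pos norming_growth] assms by blast

lemma norming_upper:
  assumes "2 powr (1 / \<alpha>) < r"
  shows "\<exists>c>0. \<exists>J. \<forall>j\<ge>J. A j \<le> c * r ^ j"
proof -
  have "0 < r" by (rule less_trans[OF _ assms]) simp
  then show ?thesis using growth_of_ratio_limit(2)[OF A_pos norming_growth assms] by blast
qed

lemma norming_at_top: "filterlim A at_top sequentially"
proof -
  have "1 < 2 powr (1 / \<alpha>)" using \<alpha>_pos by simp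
  then obtain r where r: "1 < r" "r < 2 powr (1 / \<alpha>)" using dense by blast
  then obtain c J where c: "0 < c" "\<And>j. J \<le> j \<Longrightarrow> c * r ^ j \<le> A j"
    using norming_lower[of r] by auto
  have "filterlim (\<lambda>j. c * r ^ j) at_top sequentially"
    using c r by (intro filterlim_tendsto_pos_mult_at_top[OF tendsto_const]
        filterlim_at_infinity_imp_filterlim_at_top filterlim_realpow_sequentially_gt1) auto
  then show ?thesis
    by (rule filterlim_at_top_mono) (use c in \<open>auto simp: eventually_sequentially\<close>)
qed

text \<open>
  The \<open>2\<^sup>j\<close>-th power of the characteristic function at \<open>v / A j\<close> stays away from 1.
\<close>

lemma spread_along_norming:
  obtains v \<kappa> J where "v \<noteq> 0" "0 < \<kappa>" "\<And>j. J \<le> j \<Longrightarrow> \<kappa> \<le> 2 ^ j * (1 - cmod (char N (v / A j)))"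
proof -
  obtain v where v: "cmod (char s v) < 1" using char_nontrivial by blast
  have v0: "v \<noteq> 0" using v s.char_zero by auto
  define \<kappa> where "\<kappa> = (1 - cmod (char s v)) / 2"
  have \<kappa>: "0 < \<kappa>" using v by (simp add: \<kappa>_def)
  have "(\<lambda>j. cmod (char N (v / A j)) ^ (2 ^ j)) \<longlonglongrightarrow> cmod (char s v)"
    using tendsto_norm[OF char_limit'[of v]] by (simp add: norm_power)
  moreover have "cmod (char s v) < 1 - \<kappa>" using v by (simp add: \<kappa>_def field_simps)
  ultimately have "\<forall>\<^sub>F j in sequentially. cmod (char N (v / A j)) ^ (2 ^ j) < 1 - \<kappa>"
    by (rule order_tendstoD(2))
  then obtain J where J: "\<And>j. J \<le> j \<Longrightarrow> cmod (char N (v / A j)) ^ (2 ^ j) < 1 - \<kappa>"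
    by (auto simp: eventually_sequentially)
  have "\<kappa> \<le> 2 ^ j * (1 - cmod (char N (v / A j)))" if "J \<le> j" for j
  proof -
    define x where "x = cmod (char N (v / A j))"
    have "1 + real (2 ^ j) * (x - 1) \<le> (1 + (x - 1)) ^ (2 ^ j)"
      by (rule Bernoulli_inequality) (simp add: x_def)
    then show ?thesis using J[OF that] by (simp add: x_def algebra_simps)
  qed
  then show ?thesis using that v0 \<kappa> by blast
qed

lemma one_minus_cmod_char_le: "1 - cmod (char N u) \<le> (\<integral>x. 1 - cos (u * x) \<partial>N)"
  using complex_Re_le_cmod[of "char N u"] by (simp flip: Re_char)

lemma cmod_one_minus_char_le: "cmod (char N u - 1) \<le> \<bar>u\<bar> * (\<integral>x. \<bar>x\<bar> \<partial>N)"
proof -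
  have int: "integrable N (\<lambda>x. iexp (u * x))" by (intro integrable_iexp) auto
  have "char N u - 1 = (CLINT x|N. iexp (u * x) - 1)"
    unfolding char_def using int by (simp del: space_eq_univ add: prob_space)
  also have "cmod \<dots> \<le> (\<integral>x. cmod (iexp (u * x) - 1) \<partial>N)"
    by (rule integral_norm_bound)
  also have "\<dots> \<le> (\<integral>x. \<bar>u\<bar> * \<bar>x\<bar> \<partial>N)"
  proof (rule integral_mono)
    show "cmod (iexp (u * x) - 1) \<le> \<bar>u\<bar> * \<bar>x\<bar>" for x
      using iexp_approx1[of "u * x" 0] by (simp add: abs_mult)
  qed (use mean_int int in auto)
  finally show ?thesis by simp
qed

text \<open>
  Otherwise \<open>A j\<close> outgrows \<open>2\<^sup>j\<close>, against the Lipschitz bound given by the finite mean.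
\<close>

lemma index_ge_1: "1 \<le> \<alpha>"
proof (rule ccontr)
  assume "\<not> 1 \<le> \<alpha>"
  then have "2 powr 1 < (2::real) powr (1 / \<alpha>)" using \<alpha>_pos by (intro powr_less_mono) auto
  then obtain r :: real where r: "2 < r" "r < 2 powr (1 / \<alpha>)" using dense by auto
  obtain c J where c: "0 < c" "\<And>j. J \<le> j \<Longrightarrow> c * r ^ j \<le> A j"
    using norming_lower[of r] r by auto
  obtain v \<kappa> J' where v: "v \<noteq> 0" "0 < \<kappa>" "\<And>j. J' \<le> j \<Longrightarrow> \<kappa> \<le> 2 ^ j * (1 - cmod (char N (v / A j)))"
    by (rule spread_along_norming) (rule that)
  define m where "m = (\<integral>x. \<bar>x\<bar> \<partial>N)"
  have m: "0 \<le> m" unfolding m_def by (intro integral_nonneg_AE) auto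
  have "(\<lambda>j. \<bar>v\<bar> * m / c * (2 / r) ^ j) \<longlonglongrightarrow> \<bar>v\<bar> * m / c * 0"
    using r by (intro tendsto_mult tendsto_const LIMSEQ_realpow_zero) auto
  then have "\<forall>\<^sub>F j in sequentially. \<bar>v\<bar> * m / c * (2 / r) ^ j < \<kappa>"
    using v(2) by (intro order_tendstoD(2)) auto
  then obtain J'' where J'': "\<And>j. J'' \<le> j \<Longrightarrow> \<bar>v\<bar> * m / c * (2 / r) ^ j < \<kappa>"
    by (auto simp: eventually_sequentially)
  define j where "j = max (max J J') J''"
  have "\<kappa> \<le> 2 ^ j * (1 - cmod (char N (v / A j)))" using v(3) by (simp add: j_def)
  also have "1 - cmod (char N (v / A j)) \<le> cmod (char N (v / A j) - 1)"
    using norm_triangle_ineq2[of 1 "char N (v / A j)"] by (simp add: norm_minus_commute)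
  also have "\<dots> \<le> \<bar>v / A j\<bar> * m" unfolding m_def by (rule cmod_one_minus_char_le)
  also have "\<dots> = \<bar>v\<bar> * m / A j" using A_pos[of j] by (simp add: abs_divide)
  also have "\<dots> \<le> \<bar>v\<bar> * m / (c * r ^ j)"
    using c r m A_pos[of j] by (intro divide_left_mono) (auto simp: j_def intro!: mult_pos_pos)
  finally have "\<kappa> \<le> \<bar>v\<bar> * m / c * (2 / r) ^ j" by (simp add: power_divide field_simps)
  with J''[of j] show False by (simp add: j_def)
qed

text \<open>
  At the levels \<open>A j\<close> the bound is of order \<open>2\<^sup>-\<^sup>j\<close>, and \<open>A j\<close> grows at least like a power of \<open>2\<^sup>j\<close> with exponent
  just below \<open>1/\<alpha>\<close>.
\<close>

lemma spread:
  assumes \<delta>: "0 < \<delta>"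
  shows "\<exists>c>0. \<exists>y1. \<forall>y\<ge>y1. c * y powr (- (\<alpha> + \<delta>)) \<le> (\<integral>x. min 1 ((x / y)\<^sup>2) \<partial>N)"
proof -
  define D where "D y = (\<integral>x. min 1 ((x / y)\<^sup>2) \<partial>N)" for y
  have D_int: "integrable N (\<lambda>x. min 1 ((x / y)\<^sup>2))" for y
    by (rule integrable_const_bound[of _ 1]) auto
  have D_mono: "D z \<le> D y" if "0 < y" "y \<le> z" for y z
    unfolding D_def
  proof (intro integral_mono D_int)
    fix x
    have "\<bar>x / z\<bar> \<le> \<bar>x / y\<bar>" using that by (simp add: abs_divide divide_left_mono)
    from power_mono[OF this abs_ge_zero, of 2] have "(x / z)\<^sup>2 \<le> (x / y)\<^sup>2" by (simp only: power2_abs)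
    then show "min 1 ((x / z)\<^sup>2) \<le> min 1 ((x / y)\<^sup>2)" by auto
  qed
  obtain v \<kappa> J where v: "v \<noteq> 0" "0 < \<kappa>" "\<And>j. J \<le> j \<Longrightarrow> \<kappa> \<le> 2 ^ j * (1 - cmod (char N (v / A j)))"
    by (rule spread_along_norming) (rule that)
  have DA: "\<kappa> / 2 * (1 / 2) ^ j \<le> D (A j / \<bar>v\<bar>)" if "J \<le> j" for j
  proof -
    have "1 - cmod (char N (v / A j)) \<le> (\<integral>x. 1 - cos (v / A j * x) \<partial>N)"
      by (rule one_minus_cmod_char_le)
    also have "\<dots> \<le> (\<integral>x. 2 * min 1 ((x / (A j / \<bar>v\<bar>))\<^sup>2) \<partial>N)"
    proof (rule integral_mono)
      show "integrable N (\<lambda>x. 1 - cos (v / A j * x))"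
        by (rule integrable_const_bound[of _ 2]) (auto simp: abs_le_iff intro: order_trans[of _ 1])
      show "1 - cos (v / A j * x) \<le> 2 * min 1 ((x / (A j / \<bar>v\<bar>))\<^sup>2)" for x
        using one_minus_cos_le[of "v / A j * x"] by (simp add: power_divide power_mult_distrib mult_ac)
      show "integrable N (\<lambda>x. 2 * min 1 ((x / (A j / \<bar>v\<bar>))\<^sup>2))"
        by (intro integrable_mult_right D_int)
    qed
    also have "\<dots> = 2 * D (A j / \<bar>v\<bar>)" by (simp add: D_def)
    finally have "2 ^ j * (1 - cmod (char N (v / A j))) \<le> 2 ^ j * (2 * D (A j / \<bar>v\<bar>))"
      by (intro mult_left_mono) auto
    with v(3)[OF that] have "\<kappa> \<le> 2 ^ j * (2 * D (A j / \<bar>v\<bar>))" by linarith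
    then show ?thesis by (simp add: power_divide field_simps)
  qed
  define r :: real where "r = 2 powr (1 / (\<alpha> + \<delta>))"
  have r: "1 < r" using \<alpha>_pos \<delta> by (simp add: r_def)
  have "r < 2 powr (1 / \<alpha>)" using \<alpha>_pos \<delta> by (simp add: r_def frac_less2)
  then obtain c J' where c: "0 < c" "\<And>j. J' \<le> j \<Longrightarrow> c * r ^ j \<le> A j"
    using norming_lower[of r] r by auto
  define K where "K = max J J'"
  define C where "C = \<bar>v\<bar> / c"
  have C: "0 < C" using v c by (simp add: C_def)
  define y1 where "y1 = max 1 (r ^ K / C)"
  define c' where "c' = \<kappa> / 4 * C powr (- (\<alpha> + \<delta>))"
  have "c' * y powr (- (\<alpha> + \<delta>)) \<le> D y" if y: "y1 \<le> y" for y
  proof -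
    have y': "1 \<le> y" "r ^ K \<le> C * y" using y C by (auto simp: y1_def field_simps)
    define l where "l = log r (C * y)"
    have Cy: "0 < C * y" using C y' by simp
    have rl: "r powr l = C * y" using r Cy by (simp add: l_def)
    have Kl: "real K \<le> l"
    proof -
      have "r powr (real K) \<le> C * y" using r y' by (simp add: powr_realpow)
      then show ?thesis using r by (simp add: l_def le_log_iff Cy)
    qed
    define j where "j = nat \<lceil>l\<rceil>"
    have j: "l \<le> real j" "real j \<le> l + 1" using Kl by (auto simp: j_def)
    have jK: "K \<le> j" using Kl j by linarith
    have "C * y \<le> r ^ j"
      unfolding rl[symmetric] powr_realpow[symmetric, OF less_trans[OF zero_less_one r]]
      using r j by (intro powr_mono) auto
    then have "\<bar>v\<bar> * y \<le> c * r ^ j" using c by (simp add: C_def field_simps)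
    also have "\<dots> \<le> A j" using c jK by (simp add: K_def)
    finally have yA: "y \<le> A j / \<bar>v\<bar>" using v by (simp add: field_simps)
    have "c' * y powr (- (\<alpha> + \<delta>)) = \<kappa> / 4 * (C * y) powr (- (\<alpha> + \<delta>))"
      using C y' by (simp add: c'_def powr_mult)
    also have "(C * y) powr (- (\<alpha> + \<delta>)) = 2 powr (- l)"
    proof -
      have "(C * y) powr (- (\<alpha> + \<delta>)) = r powr (- ((\<alpha> + \<delta>) * l))"
        by (simp add: rl[symmetric] powr_powr algebra_simps)
      also have "\<dots> = 2 powr (1 / (\<alpha> + \<delta>) * (- ((\<alpha> + \<delta>) * l)))"
        by (simp only: r_def powr_powr)
      also have "1 / (\<alpha> + \<delta>) * (- ((\<alpha> + \<delta>) * l)) = - l" using \<alpha>_pos \<delta> by simp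
      finally show ?thesis .
    qed
    also have "\<kappa> / 4 * 2 powr (- l) \<le> \<kappa> / 4 * 2 powr (1 - real j)"
      using v(2) j by (intro mult_left_mono powr_mono) auto
    also have "\<dots> = \<kappa> / 2 * (1 / 2) ^ j"
      by (simp add: powr_diff powr_realpow power_divide)
    also have "\<dots> \<le> D (A j / \<bar>v\<bar>)" using jK by (intro DA) (simp add: K_def)
    also have "\<dots> \<le> D y" using y' yA by (intro D_mono) auto
    finally show ?thesis .
  qed
  moreover have "0 < c'" using v(2) C by (simp add: c'_def)
  ultimately show ?thesis unfolding D_def by blast
qed

end

text \<open>
  Replaces powers of a characteristic function by exponentials, whose modulus reveals the real part of
  \<open>z - 1\<close> without any choice of a logarithm.
\<close>

lemma cmod_power_minus_exp_le:
  fixes z :: complex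
  assumes z: "cmod z \<le> 1" and near: "cmod (z - 1) \<le> 1"
  shows "cmod (z ^ n - exp (of_nat n * (z - 1))) \<le> 3 * (real n * (cmod (z - 1))\<^sup>2)"
proof -
  define w where "w = exp (z - 1)"
  have "cmod w = exp (Re z - 1)" by (simp add: w_def)
  also have "\<dots> \<le> 1" using complex_Re_le_cmod[of z] z by simp
  finally have w: "cmod w \<le> 1" .
  have "cmod (w - (1 + (z - 1))) \<le> exp \<bar>Re (z - 1)\<bar> * (cmod (z - 1))\<^sup>2"
    using Taylor_exp[of "z - 1" 1] by (simp add: w_def power2_eq_square)
  also have "\<dots> \<le> 3 * (cmod (z - 1))\<^sup>2"
  proof (rule mult_right_mono)
    have "exp \<bar>Re (z - 1)\<bar> \<le> exp 1" using abs_Re_le_cmod[of "z - 1"] near by simp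
    then show "exp \<bar>Re (z - 1)\<bar> \<le> 3" using exp_le by linarith
  qed simp
  finally have "cmod (z - w) \<le> 3 * (cmod (z - 1))\<^sup>2" by (simp add: norm_minus_commute)
  then have "real n * cmod (z - w) \<le> real n * (3 * (cmod (z - 1))\<^sup>2)" by (intro mult_left_mono) auto
  moreover have "cmod (z ^ n - w ^ n) \<le> real n * cmod (z - w)" by (rule norm_power_diff[OF z w])
  moreover have "exp (of_nat n * (z - 1)) = w ^ n" unfolding w_def by (rule exp_of_nat_mult)
  ultimately show ?thesis by (simp only: mult.left_commute[of 3])
qed

lemma (in real_distribution) cmod_char_minus: "cmod (char M (- t)) = cmod (char M t)"
proof -
  have "char M (- t) = cnj (char M t)"
    using Re_char[of "- t"] Re_char[of t] Im_char[of "- t"] Im_char[of t]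
    by (intro complex_eqI) auto
  then show ?thesis by simp
qed

text \<open>
  Both signs of a centred nondegenerate variable carry mass in a compact set away from 0.
\<close>

lemma (in real_distribution) positive_part_not_null:
  assumes int: "integrable M X" and mean: "(\<integral>x. X x \<partial>M) = 0" and "\<not> (AE x in M. X x = (0::real))"
  shows "\<exists>n. 0 < prob {x \<in> space M. 1 / real (Suc n) \<le> X x \<and> X x \<le> real (Suc n)}"
proof (rule ccontr)
  have [measurable]: "X \<in> borel_measurable M" using int by (rule borel_measurable_integrable)
  assume neg: "\<not> ?thesis"
  have "AE x in M. \<not> (1 / real (Suc n) \<le> X x \<and> X x \<le> real (Suc n))" for n
  proof -
    have "prob {x \<in> space M. 1 / real (Suc n) \<le> X x \<and> X x \<le> real (Suc n)} = 0"
      using neg measure_nonneg[of M "{x \<in> space M. 1 / real (Suc n) \<le> X x \<and> X x \<le> real (Suc n)}"]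
      by (meson antisym_conv not_le)
    then have "AE x in M. x \<notin> {x \<in> space M. 1 / real (Suc n) \<le> X x \<and> X x \<le> real (Suc n)}"
      by (subst (asm) prob_eq_0) auto
    then show ?thesis by eventually_elim auto
  qed
  then have "AE x in M. \<forall>n. \<not> (1 / real (Suc n) \<le> X x \<and> X x \<le> real (Suc n))"
    by (subst AE_all_countable) blast
  then have "AE x in M. 0 \<le> - X x"
  proof eventually_elim
    case (elim x)
    show ?case
    proof (rule ccontr)
      assume "\<not> 0 \<le> - X x"
      then have pos: "0 < X x" by simp
      obtain n :: nat where "max (X x) (1 / X x) \<le> real n" using real_arch_simple by blast
      then have "X x \<le> real (Suc n)" "1 / X x \<le> real (Suc n)" by auto
      then show False using elim pos by (auto simp: field_simps dest!: spec[of _ n])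
    qed
  qed
  moreover have "(\<integral>x. - X x \<partial>M) = 0" using int mean by simp
  ultimately have "AE x in M. - X x = 0"
    using int by (subst (asm) integral_nonneg_eq_0_iff_AE) auto
  then show False using assms(3) by simp
qed

context attracted_law begin

interpretation s: real_distribution s
  using stable by (simp add: strictly_stable_def)

text \<open>
  Whatever the phase \<open>\<tau>\<close> of the characteristic function, the sign of \<open>x\<close> opposite to it moves \<open>\<theta> x - \<tau>\<close> away from 0.
\<close>

lemma char_quadratic_lower:
  obtains c \<theta>0 where "0 < c" "0 < \<theta>0" "\<And>\<theta>. 0 < \<theta> \<Longrightarrow> \<theta> \<le> \<theta>0 \<Longrightarrow> c * \<theta>\<^sup>2 \<le> 1 - cmod (char N \<theta>)"
proof -
  obtain n1 where n1: "0 < prob {x \<in> space N. 1 / real (Suc n1) \<le> x \<and> x \<le> real (Suc n1)}"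
    using positive_part_not_null[OF mean_int mean_zero nondegenerate] by blast
  obtain n2 where n2: "0 < prob {x \<in> space N. 1 / real (Suc n2) \<le> - x \<and> - x \<le> real (Suc n2)}"
    using positive_part_not_null[of "\<lambda>x. - x"] mean_int mean_zero nondegenerate by auto
  define m where "m = max n1 n2"
  define a where "a = 1 / real (Suc m)"
  have a: "0 < a" "a \<le> 1" "a \<le> 1 / real (Suc n1)" "a \<le> 1 / real (Suc n2)"
    by (auto simp: a_def m_def intro!: divide_left_mono)
  define B1 where "B1 = {x \<in> space N. 1 / real (Suc n1) \<le> x \<and> x \<le> real (Suc n1)}"
  define B2 where "B2 = {x \<in> space N. 1 / real (Suc n2) \<le> - x \<and> - x \<le> real (Suc n2)}"
  have [measurable]: "B1 \<in> sets N" "B2 \<in> sets N" by (auto simp: B1_def B2_def)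
  define p where "p = min (prob B1) (prob B2)"
  have p: "0 < p" "p \<le> prob B1" "p \<le> prob B2" using n1 n2 by (auto simp: p_def B1_def B2_def)
  have "p * a\<^sup>2 / 4 * \<theta>\<^sup>2 \<le> 1 - cmod (char N \<theta>)" if \<theta>: "0 < \<theta>" "\<theta> \<le> a" for \<theta>
  proof -
    obtain \<tau> where \<tau>: "- pi < \<tau>" "\<tau> \<le> pi" and eq: "1 - cmod (char N \<theta>) = (\<integral>x. 1 - cos (\<theta> * x - \<tau>) \<partial>N)"
      using cmod_char_eq_integral_cos[of \<theta>] by blast
    define B where "B = (if 0 \<le> \<tau> then B2 else B1)"
    have [measurable]: "B \<in> sets N"
      using \<open>B1 \<in> sets N\<close> \<open>B2 \<in> sets N\<close> by (simp add: B_def)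
    have pB: "p \<le> prob B" using p by (simp add: B_def)
    have \<theta>m: "\<theta> * real (Suc m) \<le> 1" using \<theta> by (simp add: a_def field_simps)
    have \<theta>a: "0 \<le> \<theta> * a" "\<theta> * a \<le> 1" using \<theta> a by (auto intro: mult_le_one)
    have low: "(\<theta> * a)\<^sup>2 / 4 \<le> 1 - cos (\<theta> * x - \<tau>)" if "x \<in> B" for x
    proof (rule one_minus_cos_ge[OF \<theta>a])
      have bounds: "a \<le> \<bar>x\<bar>" "\<bar>x\<bar> \<le> real (Suc m)" and sgn: "\<bar>\<theta> * x - \<tau>\<bar> = \<theta> * \<bar>x\<bar> + \<bar>\<tau>\<bar>"
      proof -
        have "a \<le> \<bar>x\<bar> \<and> \<bar>x\<bar> \<le> real (Suc m) \<and> (if 0 \<le> \<tau> then x < 0 else 0 < x)"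
        proof (cases "0 \<le> \<tau>")
          case True
          then have x: "1 / real (Suc n2) \<le> - x" "- x \<le> real (Suc n2)" using \<open>x \<in> B\<close> by (auto simp: B_def B2_def)
          then have "a \<le> - x" "- x \<le> real (Suc m)" using a by (auto simp: m_def)
          with True a show ?thesis by auto
        next
          case False
          then have x: "1 / real (Suc n1) \<le> x" "x \<le> real (Suc n1)" using \<open>x \<in> B\<close> by (auto simp: B_def B1_def)
          then have "a \<le> x" "x \<le> real (Suc m)" using a by (auto simp: m_def)
          with False a show ?thesis by auto
        qed
        note * = this
        then show "a \<le> \<bar>x\<bar>" "\<bar>x\<bar> \<le> real (Suc m)" by auto
        show "\<bar>\<theta> * x - \<tau>\<bar> = \<theta> * \<bar>x\<bar> + \<bar>\<tau>\<bar>"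
        proof (cases "0 \<le> \<tau>")
          case True
          then have "x < 0" using * by simp
          then have "\<theta> * x < 0" using \<theta> by (simp add: mult_pos_neg)
          with True \<open>x < 0\<close> show ?thesis by simp
        next
          case False
          then have "0 < x" using * by simp
          then have "0 < \<theta> * x" using \<theta> by simp
          with False \<open>0 < x\<close> show ?thesis by simp
        qed
      qed
      have "\<theta> * a \<le> \<theta> * \<bar>x\<bar>" using bounds \<theta> by simp
      then show "\<theta> * a \<le> \<bar>\<theta> * x - \<tau>\<bar>" unfolding sgn by simp
      have "\<theta> * \<bar>x\<bar> \<le> \<theta> * real (Suc m)" using bounds \<theta> by (intro mult_left_mono) auto
      then show "\<bar>\<theta> * x - \<tau>\<bar> \<le> pi + 1" unfolding sgn using \<theta>m \<tau> by simp
    qed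
    have "p * ((\<theta> * a)\<^sup>2 / 4) \<le> prob B * ((\<theta> * a)\<^sup>2 / 4)"
      using pB by (intro mult_right_mono) auto
    also have "\<dots> = (\<integral>x. indicator B x * ((\<theta> * a)\<^sup>2 / 4) \<partial>N)"
      by (simp only: integral_mult_left_zero Bochner_Integration.integral_indicator space_eq_univ Int_UNIV_right)
    also have "\<dots> \<le> (\<integral>x. 1 - cos (\<theta> * x - \<tau>) \<partial>N)"
    proof (rule integral_mono)
      show "integrable N (\<lambda>x. indicator B x * ((\<theta> * a)\<^sup>2 / 4))"
      proof (rule integrable_const_bound[of _ "(\<theta> * a)\<^sup>2 / 4"])
        show "AE x in N. norm (indicator B x * ((\<theta> * a)\<^sup>2 / 4)) \<le> (\<theta> * a)\<^sup>2 / 4"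
          by (auto simp: indicator_def)
      qed measurable
      show "integrable N (\<lambda>x. 1 - cos (\<theta> * x - \<tau>))"
        by (rule integrable_const_bound[of _ 2]) (auto simp: abs_le_iff intro: order_trans[of _ 1])
      show "indicator B x * ((\<theta> * a)\<^sup>2 / 4) \<le> 1 - cos (\<theta> * x - \<tau>)" for x
        using low[of x] by (auto simp: indicator_def)
    qed
    finally show ?thesis using eq by (simp add: power_mult_distrib mult_ac)
  qed
  then show ?thesis using that[of "p * a\<^sup>2 / 4" a] p a by simp
qed

text \<open>
  No normalisation is below the square root of the number of summands.  For index 2 this is not implied by the
  growth rate of \<open>A\<close>.
\<close>

lemma norming_quadratic: "\<exists>B>0. \<exists>J. \<forall>j\<ge>J. 2 ^ j \<le> B * (A j)\<^sup>2"
proof -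
  obtain c \<theta>0 where c: "0 < c" "0 < \<theta>0" "\<And>\<theta>. 0 < \<theta> \<Longrightarrow> \<theta> \<le> \<theta>0 \<Longrightarrow> c * \<theta>\<^sup>2 \<le> 1 - cmod (char N \<theta>)"
    by (rule char_quadratic_lower) (rule that)
  have "((\<lambda>u. cmod (char s u)) \<longlongrightarrow> cmod (char s 0)) (at 0)"
    using s.isCont_char[of 0] by (intro tendsto_norm) (simp add: isCont_def)
  then have "\<forall>\<^sub>F u in at 0. 1 / 2 < cmod (char s u)"
    by (rule order_tendstoD(1)) (simp add: s.char_zero)
  then obtain d where d: "0 < d" "\<And>u. u \<noteq> 0 \<Longrightarrow> dist u 0 < d \<Longrightarrow> 1 / 2 < cmod (char s u)"
    unfolding eventually_at by auto
  define v where "v = d / 2"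
  have v: "0 < v" "1 / 2 < cmod (char s v)" using d by (auto simp: v_def)
  have "(\<lambda>j. cmod (char N (v / A j)) ^ (2 ^ j)) \<longlonglongrightarrow> cmod (char s v)"
    using tendsto_norm[OF char_limit'[of v]] by (simp add: norm_power)
  then have "\<forall>\<^sub>F j in sequentially. 1 / 2 < cmod (char N (v / A j)) ^ (2 ^ j)"
    using v by (intro order_tendstoD(1)) auto
  moreover have "\<forall>\<^sub>F j in sequentially. v / \<theta>0 \<le> A j"
    using norming_at_top by (simp add: filterlim_at_top)
  ultimately have "\<forall>\<^sub>F j in sequentially. 2 ^ j \<le> 1 / (c * v\<^sup>2) * (A j)\<^sup>2"
  proof eventually_elim
    case (elim j)
    define x where "x = cmod (char N (v / A j))"
    have "v / A j \<le> \<theta>0" using elim(2) c A_pos[of j] by (simp add: field_simps)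
    then have cx: "c * (v / A j)\<^sup>2 \<le> 1 - x" using c v A_pos[of j] by (simp add: x_def)
    have "x \<le> exp (x - 1)" using exp_ge_add_one_self[of "x - 1"] by simp
    then have "x ^ (2 ^ j) \<le> exp (x - 1) ^ (2 ^ j)" by (intro power_mono) (auto simp: x_def)
    also have "\<dots> = exp (2 ^ j * (x - 1))" by (simp add: exp_of_nat_mult[symmetric])
    finally have "1 / 2 < exp (2 ^ j * (x - 1))" using elim(1) by (simp add: x_def)
    moreover have "exp (- 1) \<le> (1 / 2 :: real)"
      using exp_ge_add_one_self[of "1::real"] by (simp add: exp_minus field_simps)
    ultimately have "exp (- 1) < exp (2 ^ j * (x - 1))" by linarith
    then have "2 ^ j * (1 - x) < 1" by (simp add: algebra_simps)
    moreover have "2 ^ j * (c * (v / A j)\<^sup>2) \<le> 2 ^ j * (1 - x)" using cx by (intro mult_left_mono) auto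
    ultimately have "2 ^ j * (c * (v / A j)\<^sup>2) \<le> 1" by linarith
    then show ?case using c v A_pos[of j] by (simp add: power_divide field_simps)
  qed
  then show ?thesis using c v unfolding eventually_sequentially by (intro exI[of _ "1 / (c * v\<^sup>2)"]) auto
qed

lemma cosine_integrable: "integrable N (\<lambda>x. 1 - cos (u * x))"
  by (rule integrable_const_bound[of _ 2]) (auto simp: abs_le_iff intro: order_trans[of _ 1])

definition cos_defect :: "nat \<Rightarrow> real \<Rightarrow> real" where
  "cos_defect j u = 2 ^ j * (\<integral>x. 1 - cos (u / A j * x) \<partial>N)"

lemma cmod_exp_cos_defect: "cmod (exp (of_nat (2 ^ j) * (char N (u / A j) - 1))) = exp (- cos_defect j u)"
proof -
  have "Re (char N (u / A j)) - 1 = - (\<integral>x. 1 - cos (u / A j * x) \<partial>N)"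
    using Re_char[of "u / A j"] by linarith
  then have "2 ^ j * (Re (char N (u / A j)) - 1) = - cos_defect j u" by (simp add: cos_defect_def)
  moreover have "Re (of_nat (2 ^ j) * (char N (u / A j) - 1)) = 2 ^ j * (Re (char N (u / A j)) - 1)"
    by (simp del: of_nat_power of_nat_numeral)
  ultimately show ?thesis by (simp only: norm_exp_eq_Re)
qed

text \<open>
  At a small frequency of the form \<open>\<rho>\<^sup>i v\<close> the limit has modulus in \<open>(3/4, 1)\<close>, and the error of the exponential
  approximation is at most 1/4.
\<close>

lemma good_frequency:
  obtains u J where "0 < u" "cmod (char s u) < 1" "3 / 4 < cmod (char s u)" "\<And>j. J \<le> j \<Longrightarrow> cos_defect j u \<le> 1"
proof -
  obtain B J where B: "0 < B" "\<And>j. J \<le> j \<Longrightarrow> 2 ^ j \<le> B * (A j)\<^sup>2" using norming_quadratic by blast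
  define m where "m = (\<integral>x. \<bar>x\<bar> \<partial>N)"
  have m: "0 \<le> m" unfolding m_def by (intro integral_nonneg_AE) auto
  obtain v0 where "cmod (char s v0) < 1" using char_nontrivial by blast
  then have v: "cmod (char s \<bar>v0\<bar>) < 1" using s.cmod_char_minus[of v0] by (simp add: abs_if)
  then have v_pos: "0 < \<bar>v0\<bar>" using s.char_zero by (cases "v0 = 0") auto
  define U where "U i = \<rho> ^ i * \<bar>v0\<bar>" for i
  have U_pos: "0 < U i" for i using v_pos \<rho> by (simp add: U_def)
  have U_lt: "cmod (char s (U i)) < 1" for i
  proof (induction i)
    case (Suc i)
    have "cmod (char s (U i)) = cmod (char s (U (Suc i))) ^ 2"
      using char_doubling[of "U i"] by (simp add: U_def mult.assoc norm_power)
    then have "cmod (char s (U (Suc i))) ^ 2 < 1" using Suc by simp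
    then show ?case by (simp add: power_less_one_iff)
  qed (use v in \<open>simp add: U_def\<close>)
  have U0: "U \<longlonglongrightarrow> 0"
  proof -
    have "(\<lambda>i. \<rho> ^ i * \<bar>v0\<bar>) \<longlonglongrightarrow> 0 * \<bar>v0\<bar>"
      using \<rho> by (intro tendsto_mult LIMSEQ_realpow_zero tendsto_const) auto
    then show ?thesis by (simp add: U_def[abs_def])
  qed
  have "(\<lambda>i. cmod (char s (U i))) \<longlonglongrightarrow> cmod (char s 0)"
    by (intro tendsto_norm isCont_tendsto_compose[OF s.isCont_char] U0)
  then have "\<forall>\<^sub>F i in sequentially. 3 / 4 < cmod (char s (U i))"
    by (rule order_tendstoD(1)) (simp add: s.char_zero)
  moreover have "\<forall>\<^sub>F i in sequentially. 3 * (B * (U i * m)\<^sup>2) < 1 / 4"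
  proof (rule order_tendstoD(2))
    show "(\<lambda>i. 3 * (B * (U i * m)\<^sup>2)) \<longlonglongrightarrow> 3 * (B * (0 * m)\<^sup>2)" by (intro tendsto_intros U0)
  qed simp
  ultimately have "\<forall>\<^sub>F i in sequentially. 3 / 4 < cmod (char s (U i)) \<and> 3 * (B * (U i * m)\<^sup>2) < 1 / 4"
    by eventually_elim simp
  then obtain i where i: "3 / 4 < cmod (char s (U i))" "3 * (B * (U i * m)\<^sup>2) < 1 / 4"
    unfolding eventually_sequentially by blast
  define u where "u = U i"
  have u: "0 < u" "cmod (char s u) < 1" "3 / 4 < cmod (char s u)" "3 * (B * (u * m)\<^sup>2) < 1 / 4"
    using U_pos U_lt i by (auto simp: u_def)
  have "(\<lambda>j. cmod (char N (u / A j) ^ (2 ^ j))) \<longlonglongrightarrow> cmod (char s u)"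
    using tendsto_norm[OF char_limit'[of u]] .
  then have "\<forall>\<^sub>F j in sequentially. 3 / 4 < cmod (char N (u / A j) ^ (2 ^ j))"
    using u by (intro order_tendstoD(1)) auto
  moreover have "\<forall>\<^sub>F j in sequentially. u * m \<le> A j"
    using norming_at_top by (simp add: filterlim_at_top)
  moreover have "\<forall>\<^sub>F j in sequentially. 2 ^ j \<le> B * (A j)\<^sup>2"
    using B(2) by (auto simp: eventually_sequentially)
  ultimately have "\<forall>\<^sub>F j in sequentially. cos_defect j u \<le> 1"
  proof eventually_elim
    case (elim j)
    define z where "z = char N (u / A j)"
    have z1: "cmod (z - 1) \<le> u * m / A j"
      using cmod_one_minus_char_le[of "u / A j"] u A_pos[of j] by (simp add: z_def m_def abs_divide)
    also have "\<dots> \<le> 1" using elim(2) A_pos[of j] by simp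
    finally have near: "cmod (z - 1) \<le> 1" .
    have "cmod (z ^ (2 ^ j) - exp (of_nat (2 ^ j) * (z - 1))) \<le> 3 * (real (2 ^ j) * (cmod (z - 1))\<^sup>2)"
      by (rule cmod_power_minus_exp_le) (use near cmod_char_le_1 in \<open>auto simp: z_def\<close>)
    also have "\<dots> \<le> 3 * ((B * (A j)\<^sup>2) * (u * m / A j)\<^sup>2)"
      using elim(3) z1 B(1) by (intro mult_left_mono mult_mono power_mono) auto
    also have "\<dots> = 3 * (B * (u * m)\<^sup>2)" using A_pos[of j] by (simp add: power_divide)
    also have "\<dots> < 1 / 4" by (rule u)
    finally have "cmod (z ^ (2 ^ j) - exp (of_nat (2 ^ j) * (z - 1))) < 1 / 4" .
    moreover have "3 / 4 < cmod (z ^ (2 ^ j))" using elim(1) by (simp add: z_def)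
    ultimately have "1 / 2 < cmod (exp (of_nat (2 ^ j) * (z - 1)))"
      using norm_triangle_ineq2[of "z ^ (2 ^ j)" "exp (of_nat (2 ^ j) * (z - 1))"] by linarith
    then have "1 / 2 < exp (- cos_defect j u)" unfolding z_def cmod_exp_cos_defect .
    moreover have "exp (- 1) \<le> (1 / 2 :: real)"
      using exp_ge_add_one_self[of "1::real"] by (simp add: exp_minus field_simps)
    ultimately have "exp (- 1) < exp (- cos_defect j u)" by linarith
    then show ?case by simp
  qed
  then show ?thesis using that u by (auto simp: eventually_sequentially)
qed

end

context attracted_law begin

interpretation s: real_distribution s
  using stable by (simp add: strictly_stable_def)

lemma annulus_prob:
  assumes u: "0 < u" and C: "cos_defect k u \<le> 1"
  shows "prob {x. A k / (2 * u) \<le> \<bar>x\<bar> \<and> \<bar>x\<bar> \<le> 2 * A k / u} \<le> 16 * (1 / 2) ^ k"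
proof -
  define B where "B = {x. A k / (2 * u) \<le> \<bar>x\<bar> \<and> \<bar>x\<bar> \<le> 2 * A k / u}"
  have [measurable]: "B \<in> sets borel" unfolding B_def by measurable
  have low: "1 / 16 \<le> 1 - cos (u / A k * x)" if "x \<in> B" for x
  proof -
    have "1 / 2 \<le> \<bar>u / A k * x\<bar>" "\<bar>u / A k * x\<bar> \<le> 2"
      using that u A_pos[of k] by (auto simp: B_def abs_mult field_simps)
    then have "(1 / 2)\<^sup>2 / 4 \<le> 1 - cos (u / A k * x)"
      using pi_gt3 by (intro one_minus_cos_ge) auto
    then show ?thesis by (simp add: power_divide)
  qed
  have "1 / 16 * prob B = (\<integral>x. 1 / 16 * indicator B x \<partial>N)" by simp
  also have "\<dots> \<le> (\<integral>x. 1 - cos (u / A k * x) \<partial>N)"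
  proof (rule integral_mono[OF _ cosine_integrable])
    show "integrable N (\<lambda>x. 1 / 16 * indicator B x :: real)"
      by (rule integrable_const_bound[of _ 1]) (auto simp: indicator_def)
    show "1 / 16 * indicator B x \<le> 1 - cos (u / A k * x)" for x
      using low[of x] by (auto simp: indicator_def)
  qed
  also have "\<dots> = cos_defect k u * (1 / 2) ^ k" by (simp add: cos_defect_def power_divide)
  also have "\<dots> \<le> 1 * (1 / 2) ^ k" using C by (intro mult_right_mono) auto
  finally show ?thesis by (simp add: B_def)
qed

lemma norming_step: "\<exists>J. \<forall>j\<ge>J. A (Suc j) \<le> 4 * A j"
proof -
  have "2 powr (1 / \<alpha>) \<le> 2 powr 1" using index_ge_1 by (intro powr_mono) auto
  then have "\<forall>\<^sub>F j in sequentially. A (Suc j) / A j < 4"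
    by (intro order_tendstoD(2)[OF norming_growth]) auto
  then obtain J where "\<And>j. J \<le> j \<Longrightarrow> A (Suc j) / A j < 4" by (auto simp: eventually_sequentially)
  then show ?thesis using A_pos by (intro exI[of _ J]) (auto simp: field_simps less_imp_le)
qed

lemma annuli_cover:
  assumes u: "0 < u" and step: "\<And>j. J \<le> j \<Longrightarrow> A (Suc j) \<le> 4 * A j" and i: "J \<le> i"
    and x: "A i / (2 * u) \<le> \<bar>x\<bar>"
  shows "\<exists>k. A (i + k) / (2 * u) \<le> \<bar>x\<bar> \<and> \<bar>x\<bar> \<le> 2 * A (i + k) / u"
proof -
  have ex: "\<exists>k. \<bar>x\<bar> \<le> 2 * A (i + k) / u"
  proof -
    have "\<forall>\<^sub>F j in sequentially. u * \<bar>x\<bar> \<le> A j"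
      using norming_at_top by (simp add: filterlim_at_top)
    then obtain J' where J': "\<And>j. J' \<le> j \<Longrightarrow> u * \<bar>x\<bar> \<le> A j" by (auto simp: eventually_sequentially)
    have "u * \<bar>x\<bar> \<le> 2 * A (i + J')" using J'[of "i + J'"] A_pos[of "i + J'"] by simp
    then show ?thesis using u by (intro exI[of _ J']) (simp add: field_simps)
  qed
  define k where "k = (LEAST k. \<bar>x\<bar> \<le> 2 * A (i + k) / u)"
  have k: "\<bar>x\<bar> \<le> 2 * A (i + k) / u" unfolding k_def using ex by (rule LeastI_ex)
  have "A (i + k) / (2 * u) \<le> \<bar>x\<bar>"
  proof (cases k)
    case (Suc l)
    have "\<not> \<bar>x\<bar> \<le> 2 * A (i + l) / u"
      using not_less_Least[of l "\<lambda>k. \<bar>x\<bar> \<le> 2 * A (i + k) / u"] Suc by (simp add: k_def)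
    moreover have "A (i + k) \<le> 4 * A (i + l)" using step[of "i + l"] i Suc by simp
    then have "A (i + k) / (2 * u) \<le> 4 * A (i + l) / (2 * u)" using u by (intro divide_right_mono) auto
    ultimately show ?thesis by simp
  qed (use x in simp)
  with k show ?thesis by blast
qed

text \<open>
  Consecutive annuli around the levels \<open>A k\<close> overlap because \<open>A (k + 1) \<le> 4 A k\<close>, and each carries at most
  \<open>16 / 2\<^sup>k\<close>.
\<close>

lemma tail_prob:
  assumes u: "0 < u" and C: "\<And>j. J \<le> j \<Longrightarrow> cos_defect j u \<le> 1"
    and step: "\<And>j. J \<le> j \<Longrightarrow> A (Suc j) \<le> 4 * A j" and i: "J \<le> i"
  shows "prob {x. A i / (2 * u) \<le> \<bar>x\<bar>} \<le> 32 * (1 / 2) ^ i"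
proof -
  define B where "B k = {x. A k / (2 * u) \<le> \<bar>x\<bar> \<and> \<bar>x\<bar> \<le> 2 * A k / u}" for k
  have [measurable]: "B k \<in> sets borel" for k unfolding B_def by measurable
  have geo: "(\<lambda>k. 16 * (1 / 2) ^ i * (1 / 2) ^ k) sums (16 * (1 / 2) ^ i * (1 / (1 - 1 / 2 :: real)))"
    by (intro sums_mult geometric_sums) simp
  have le: "prob (B (i + k)) \<le> 16 * (1 / 2) ^ i * (1 / 2) ^ k" for k
    using annulus_prob[OF u C, of "i + k"] i by (simp add: B_def power_add)
  have summ: "summable (\<lambda>k. prob (B (i + k)))"
    by (rule summable_comparison_test'[OF sums_summable[OF geo], of 0]) (use le in simp)
  have "prob {x. A i / (2 * u) \<le> \<bar>x\<bar>} \<le> prob (\<Union>k. B (i + k))"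
  proof (rule finite_measure_mono)
    show "{x. A i / (2 * u) \<le> \<bar>x\<bar>} \<subseteq> (\<Union>k. B (i + k))"
      using annuli_cover[OF u step i] by (fastforce simp: B_def)
  qed simp
  also have "\<dots> \<le> (\<Sum>k. prob (B (i + k)))"
    by (rule finite_measure_subadditive_countably[OF _ summ]) auto
  also have "\<dots> \<le> (\<Sum>k. 16 * (1 / 2) ^ i * (1 / 2) ^ k)"
    by (rule suminf_le[OF le summ sums_summable[OF geo]])
  also have "\<dots> = 32 * (1 / 2) ^ i" using sums_unique[OF geo] by simp
  finally show ?thesis .
qed

lemma moments:
  assumes q: "1 \<le> q" "q < \<alpha>"
  shows "integrable N (\<lambda>x. \<bar>x\<bar> powr q)"
proof -
  obtain u J1 where u: "0 < u" "\<And>j. J1 \<le> j \<Longrightarrow> cos_defect j u \<le> 1"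
    using good_frequency by metis
  obtain J2 where J2: "\<And>j. J2 \<le> j \<Longrightarrow> A (Suc j) \<le> 4 * A j" using norming_step by blast
  have "2 powr (1 / \<alpha>) < (2::real) powr (1 / q)" using q by (intro powr_less_mono) (auto simp: frac_less2)
  then obtain r :: real where r: "2 powr (1 / \<alpha>) < r" "r < 2 powr (1 / q)" using dense by blast
  have r_pos: "0 < r" by (rule less_trans[OF _ r(1)]) simp
  have rq: "r powr q < 2"
  proof -
    have "r powr q < (2 powr (1 / q)) powr q" using r r_pos q by (intro powr_less_mono2) auto
    also have "\<dots> = 2" using q by (simp add: powr_powr)
    finally show ?thesis .
  qed
  obtain c J3 where c: "0 < c" "\<And>j. J3 \<le> j \<Longrightarrow> A j \<le> c * r ^ j" using norming_upper[OF r(1)] by blast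
  define J where "J = max (max J1 J2) J3"
  have J: "\<And>j. J \<le> j \<Longrightarrow> cos_defect j u \<le> 1" "\<And>j. J \<le> j \<Longrightarrow> A (Suc j) \<le> 4 * A j" "\<And>j. J \<le> j \<Longrightarrow> A j \<le> c * r ^ j"
    using u(2) J2 c(2) by (auto simp: J_def)
  define B where "B k = {x. A k / (2 * u) \<le> \<bar>x\<bar> \<and> \<bar>x\<bar> \<le> 2 * A k / u}" for k
  have [measurable]: "B k \<in> sets borel" for k unfolding B_def by measurable
  define K where "K = (A J / (2 * u)) powr q"
  define x0 where "x0 = r powr q / 2"
  have x0: "0 \<le> x0" "x0 < 1" using rq by (auto simp: x0_def)
  define D where "D = (2 * c / u) powr q * 16"
  have D: "0 \<le> D" by (simp add: D_def)
  have "(\<integral>\<^sup>+x. ennreal (\<bar>x\<bar> powr q) \<partial>N) \<le> (\<integral>\<^sup>+x. ennreal K + (\<Sum>k. ennreal ((2 * A (J + k) / u) powr q) * indicator (B (J + k)) x) \<partial>N)"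
  proof (rule nn_integral_mono)
    fix x
    show "ennreal (\<bar>x\<bar> powr q) \<le> ennreal K + (\<Sum>k. ennreal ((2 * A (J + k) / u) powr q) * indicator (B (J + k)) x)"
    proof (cases "A J / (2 * u) \<le> \<bar>x\<bar>")
      case True
      then obtain k where k: "A (J + k) / (2 * u) \<le> \<bar>x\<bar>" "\<bar>x\<bar> \<le> 2 * A (J + k) / u"
        using annuli_cover[OF u(1) J(2) order_refl True] by blast
      define G where "G k = ennreal ((2 * A (J + k) / u) powr q) * indicator (B (J + k)) x" for k
      have "ennreal (\<bar>x\<bar> powr q) \<le> G k"
        using k q by (auto simp: G_def B_def intro!: ennreal_leI powr_mono2)
      also have "\<dots> \<le> (\<Sum>k. G k)"
        using sum_le_suminf[of G "{k}"] by simp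
      finally have "ennreal (\<bar>x\<bar> powr q) \<le> ennreal K + (\<Sum>k. G k)" by (simp add: add_increasing)
      then show ?thesis by (simp only: G_def)
    next
      case False
      then have "\<bar>x\<bar> powr q \<le> K" using q unfolding K_def by (intro powr_mono2) auto
      then show ?thesis by (simp add: add_increasing2 ennreal_leI)
    qed
  qed
  also have "\<dots> = ennreal K + (\<Sum>k. ennreal ((2 * A (J + k) / u) powr q) * emeasure N (B (J + k)))"
    by (simp add: nn_integral_add nn_integral_suminf nn_integral_cmult_indicator emeasure_space_1[unfolded space_eq_univ])
  also have "\<dots> \<le> ennreal K + (\<Sum>k. ennreal (D * x0 ^ (J + k)))"
  proof (intro add_left_mono suminf_le)
    fix k
    define m where "m = J + k"
    have m: "J \<le> m" by (simp add: m_def)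
    have "(2 * A m / u) powr q \<le> (2 * (c * r ^ m) / u) powr q"
      using J(3)[OF m] A_pos[of m] u q by (intro powr_mono2 divide_right_mono) auto
    also have "\<dots> = (2 * c / u) powr q * (r powr q) ^ m"
      using c u r_pos by (simp add: powr_mult powr_divide powr_realpow[symmetric] powr_powr mult.commute)
    finally have "(2 * A m / u) powr q * prob (B m) \<le> (2 * c / u) powr q * (r powr q) ^ m * (16 * (1 / 2) ^ m)"
      using annulus_prob[OF u(1) J(1)[OF m]] by (intro mult_mono) (auto simp: B_def)
    also have "\<dots> = D * x0 ^ m" by (simp add: D_def x0_def power_divide)
    finally have "ennreal ((2 * A m / u) powr q * prob (B m)) \<le> ennreal (D * x0 ^ m)" by (rule ennreal_leI)
    then show "ennreal ((2 * A (J + k) / u) powr q) * emeasure N (B (J + k)) \<le> ennreal (D * x0 ^ (J + k))"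
      by (simp add: m_def emeasure_eq_measure ennreal_mult)
  qed auto
  also have "(\<Sum>k. ennreal (D * x0 ^ (J + k))) = ennreal (\<Sum>k. D * x0 ^ (J + k))"
    using x0 D by (intro suminf_ennreal2) (auto simp: power_add intro!: summable_mult summable_geometric)
  also have "ennreal K + \<dots> < \<infinity>" by simp
  finally show ?thesis
    by (intro integrableI_bounded) auto
qed

lemma exp_char_limit:
  assumes "(\<lambda>j. 2 ^ j / (A j)\<^sup>2) \<longlonglongrightarrow> 0"
  shows "(\<lambda>j. exp (of_nat (2 ^ j) * (char N (w / A j) - 1))) \<longlonglongrightarrow> char s w"
proof -
  define m where "m = (\<integral>x. \<bar>x\<bar> \<partial>N)"
  have m: "0 \<le> m" unfolding m_def by (intro integral_nonneg_AE) auto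
  define z where "z j = char N (w / A j)" for j
  have "\<forall>\<^sub>F j in sequentially. \<bar>w\<bar> * m \<le> A j"
    using norming_at_top by (simp add: filterlim_at_top)
  then have ev: "\<forall>\<^sub>F j in sequentially. norm (z j ^ (2 ^ j) - exp (of_nat (2 ^ j) * (z j - 1))) \<le> 3 * ((\<bar>w\<bar> * m)\<^sup>2 * (2 ^ j / (A j)\<^sup>2))"
  proof eventually_elim
    case (elim j)
    have z1: "cmod (z j - 1) \<le> \<bar>w\<bar> * m / A j"
      using cmod_one_minus_char_le[of "w / A j"] A_pos[of j] by (simp add: z_def m_def abs_divide)
    also have "\<dots> \<le> 1" using elim A_pos[of j] by simp
    finally have near: "cmod (z j - 1) \<le> 1" .
    have "cmod (z j ^ (2 ^ j) - exp (of_nat (2 ^ j) * (z j - 1))) \<le> 3 * (real (2 ^ j) * (cmod (z j - 1))\<^sup>2)"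
      by (rule cmod_power_minus_exp_le) (use near cmod_char_le_1 in \<open>auto simp: z_def\<close>)
    also have "\<dots> \<le> 3 * (2 ^ j * (\<bar>w\<bar> * m / A j)\<^sup>2)"
      using power_mono[OF z1 norm_ge_zero, of 2] by simp
    also have "\<dots> = 3 * ((\<bar>w\<bar> * m)\<^sup>2 * (2 ^ j / (A j)\<^sup>2))" by (simp add: power_divide)
    finally show ?case .
  qed
  have "(\<lambda>j. 3 * ((\<bar>w\<bar> * m)\<^sup>2 * (2 ^ j / (A j)\<^sup>2))) \<longlonglongrightarrow> 3 * ((\<bar>w\<bar> * m)\<^sup>2 * 0)"
    by (intro tendsto_intros assms)
  then have "(\<lambda>j. 3 * ((\<bar>w\<bar> * m)\<^sup>2 * (2 ^ j / (A j)\<^sup>2))) \<longlonglongrightarrow> 0" by simp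
  from Lim_null_comparison[OF ev this]
  have "(\<lambda>j. z j ^ (2 ^ j) - exp (of_nat (2 ^ j) * (z j - 1))) \<longlonglongrightarrow> 0" .
  from tendsto_diff[OF char_limit'[of w, folded z_def] this] show ?thesis by (simp add: z_def)
qed

text \<open>
  Suppose \<open>\<alpha> = 1\<close>, and let \<open>R > 0\<close> be minus the logarithm of the modulus of the limit at the frequency \<open>u\<close>.  Since
  the modulus at \<open>u / 2\<^sup>m\<close> has logarithm \<open>-R / 2\<^sup>m\<close>, the expectation of \<open>cosine_sum n\<close> times \<open>2\<^sup>j\<close> tends to \<open>n R\<close>.
  The doubling relation makes the corresponding limit for \<open>sine_gap n\<close> vanish.  The inequality between the
  two leaves a bound independent of \<open>n\<close>, because negative values contribute nothing in the limit.
\<close>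

lemma index_gt_1:
  assumes \<epsilon>: "0 < \<epsilon>" and neg_int: "integrable N (\<lambda>x. max 0 (- x) powr (\<alpha> + \<epsilon>))"
  shows "1 < \<alpha>"
proof (rule ccontr)
  assume "\<not> 1 < \<alpha>"
  then have \<alpha>1: "\<alpha> = 1" using index_ge_1 by simp
  have \<rho>2: "\<rho> = 1 / 2"
  proof -
    have "\<rho> = 2 powr (- (1 / \<alpha>))" by (rule \<rho>_def)
    also have "\<dots> = 1 / 2" by (simp add: \<alpha>1 powr_minus_divide)
    finally show ?thesis .
  qed
  \<comment> \<open>Exponents \<open>1 + e \<le> 2\<close> still dominate \<open>min 1 (x\<^sup>2)\<close>.\<close>
  define e where "e = min \<epsilon> 1"
  have e: "0 < e" "e \<le> 1" "e \<le> \<epsilon>" using \<epsilon> by (auto simp: e_def)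
  have neg_int': "integrable N (\<lambda>x. max 0 (- x) powr (1 + e))"
  proof (rule Bochner_Integration.integrable_bound)
    show "integrable N (\<lambda>x. 1 + max 0 (- x) powr (\<alpha> + \<epsilon>))" using neg_int by simp
    show "AE x in N. norm (max 0 (- x) powr (1 + e)) \<le> norm (1 + max 0 (- x) powr (\<alpha> + \<epsilon>))"
    proof (rule AE_I2)
      fix x :: real
      define y where "y = max 0 (- x)"
      have "y powr (1 + e) \<le> 1 + y powr (\<alpha> + \<epsilon>)"
      proof (cases "y \<le> 1")
        case True
        then have "y powr (1 + e) \<le> 1 powr (1 + e)" using e by (intro powr_mono2) (auto simp: y_def)
        then show ?thesis by (simp add: add_increasing2)
      next
        case False
        then have "y powr (1 + e) \<le> y powr (\<alpha> + \<epsilon>)" using e by (intro powr_mono) (auto simp: \<alpha>1)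
        then show ?thesis by simp
      qed
      then show "norm (max 0 (- x) powr (1 + e)) \<le> norm (1 + max 0 (- x) powr (\<alpha> + \<epsilon>))"
        by (simp add: y_def)
    qed
  qed auto
  obtain u J1 where u: "0 < u" "cmod (char s u) < 1" "3 / 4 < cmod (char s u)" "\<And>j. J1 \<le> j \<Longrightarrow> cos_defect j u \<le> 1"
    using good_frequency by metis
  obtain J2 where J2: "\<And>j. J2 \<le> j \<Longrightarrow> A (Suc j) \<le> 4 * A j" using norming_step by blast
  have "(2::real) powr (1 / (1 + e)) < 2 powr 1" using e by (intro powr_less_mono) auto
  then obtain r :: real where r: "2 powr (1 / (1 + e)) < r" "r < 2" using dense by auto
  have r_pos: "1 < r"
  proof -
    have "1 \<le> (2::real) powr (1 / (1 + e))" using e by (intro ge_one_powr_ge_zero) auto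
    then show ?thesis using r by simp
  qed
  have re: "2 < r powr (1 + e)"
  proof -
    have "2 = (2 powr (1 / (1 + e))) powr (1 + e)" using e by (simp add: powr_powr)
    also have "\<dots> < r powr (1 + e)" using r e by (intro powr_less_mono2) auto
    finally show ?thesis .
  qed
  obtain c J3 where c: "0 < c" "\<And>j. J3 \<le> j \<Longrightarrow> c * r ^ j \<le> A j"
    using norming_lower[of r] r r_pos by (auto simp: \<alpha>1)
  have small: "(\<lambda>j. 2 ^ j / (A j) powr p) \<longlonglongrightarrow> 0" if p: "1 + e \<le> p" for p
  proof (rule Lim_null_comparison)
    define t where "t = 2 / r powr p"
    have "r powr (1 + e) \<le> r powr p" using p r_pos by (intro powr_mono) auto
    with re have "2 < r powr p" by linarith
    moreover have "0 < r powr p" using r_pos by simp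
    ultimately have t: "0 \<le> t" "t < 1" by (simp_all add: t_def pos_divide_less_eq)
    have "(\<lambda>j. 1 / c powr p * t ^ j) \<longlonglongrightarrow> 1 / c powr p * 0"
      using t by (intro tendsto_mult tendsto_const LIMSEQ_realpow_zero)
    then show "(\<lambda>j. 1 / c powr p * t ^ j) \<longlonglongrightarrow> 0" by simp
    have "norm (2 ^ j / (A j) powr p) \<le> 1 / c powr p * t ^ j" if "J3 \<le> j" for j
    proof -
      have "(c * r ^ j) powr p \<le> A j powr p" using c that p e r_pos by (intro powr_mono2) auto
      moreover have "(c * r ^ j) powr p = c powr p * (r powr p) ^ j"
        using c r_pos by (simp add: powr_mult powr_realpow[symmetric] powr_powr mult.commute)
      ultimately have "2 ^ j / (A j) powr p \<le> 2 ^ j / (c powr p * (r powr p) ^ j)"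
        using c r_pos A_pos[of j] by (intro divide_left_mono) auto
      then show ?thesis by (simp add: t_def power_divide)
    qed
    then show "\<forall>\<^sub>F j in sequentially. norm (2 ^ j / (A j) powr p) \<le> 1 / c powr p * t ^ j"
      by (auto simp: eventually_sequentially)
  qed
  have "(\<lambda>j. 2 ^ j / (A j)\<^sup>2) \<longlonglongrightarrow> 0"
  proof -
    have "A j powr 2 = (A j)\<^sup>2" for j using A_pos[of j] by (simp add: powr_numeral)
    then show ?thesis using small[of 2] e by simp
  qed
  note E = exp_char_limit[OF this]
  define R where "R = - ln (cmod (char s u))"
  have R: "0 < R" "R < 1"
  proof -
    have pos: "0 < cmod (char s u)" using u(3) by linarith
    then have "ln (cmod (char s u)) < 0" using u(2) by (rule ln_less_zero)
    then show "0 < R" by (simp add: R_def)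
    have "exp (- 1) \<le> (1 / 2 :: real)"
      using exp_ge_add_one_self[of "1::real"] by (simp add: exp_minus field_simps)
    then have "exp (- 1) < cmod (char s u)" using u by linarith
    then have "ln (exp (- 1)) < ln (cmod (char s u))" using pos by (subst ln_less_cancel_iff) auto
    then show "R < 1" by (simp add: R_def)
  qed
  define v where "v m = u / 2 ^ m" for m :: nat
  have v: "0 < cmod (char s (v m)) \<and> ln (cmod (char s (v m))) = - (R / 2 ^ m)" for m
  proof (induction m)
    case 0
    have "0 < cmod (char s u)" using u(3) by linarith
    then show ?case by (simp add: v_def R_def)
  next
    case (Suc m)
    have eq: "cmod (char s (v m)) = cmod (char s (v (Suc m))) ^ 2"
      using char_doubling[of "v m"] by (simp add: v_def \<rho>2 norm_power mult.commute)
    then have pos: "0 < cmod (char s (v (Suc m)))" using Suc by (cases "char s (v (Suc m)) = 0") auto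
    then have "ln (cmod (char s (v m))) = 2 * ln (cmod (char s (v (Suc m))))"
      unfolding eq by (simp add: ln_realpow)
    then have "2 * ln (cmod (char s (v (Suc m)))) = - (R / 2 ^ m)" using Suc by simp
    then have "ln (cmod (char s (v (Suc m)))) = - (R / 2 ^ Suc m)" by simp
    with pos show ?case by blast
  qed
  have C_lim: "(\<lambda>j. cos_defect j (v m)) \<longlonglongrightarrow> R / 2 ^ m" for m
  proof -
    have "(\<lambda>j. exp (- cos_defect j (v m))) \<longlonglongrightarrow> cmod (char s (v m))"
      using tendsto_norm[OF E[of "v m"]] unfolding cmod_exp_cos_defect .
    then have "(\<lambda>j. - ln (exp (- cos_defect j (v m)))) \<longlonglongrightarrow> - ln (cmod (char s (v m)))"
      using v[of m] by (intro tendsto_minus tendsto_ln) auto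
    then show ?thesis using v[of m] by simp
  qed
  define I where "I j w = 2 ^ j * (\<integral>x. sine_defect (w / A j * x) \<partial>N)" for j w
  have sin_int: "integrable N (\<lambda>x. sin (w * x))" for w
    by (rule integrable_const_bound[of _ 1]) auto
  have defect_int: "integrable N (\<lambda>x. sine_defect (w * x))" for w
    unfolding sine_defect_def using sin_int[of w] sin_int[of "2 * w"] by (simp add: mult.assoc)
  have I_lim: "(\<lambda>j. I j (v (Suc m))) \<longlonglongrightarrow> 0" for m
  proof -
    define w where "w = v (Suc m)"
    have w2: "2 * w = v m" by (simp add: w_def v_def)
    define W where "W j = 2 * (of_nat (2 ^ j) * (char N (w / A j) - 1)) - of_nat (2 ^ j) * (char N (2 * w / A j) - 1)" for j
    have "char s (2 * w) = char s w ^ 2" using char_doubling[of "2 * w"] by (simp add: \<rho>2)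
    moreover have "char s w \<noteq> 0" using v[of "Suc m"] by (auto simp: w_def)
    ultimately have one: "char s w ^ 2 / char s (2 * w) = 1" by simp
    have expW: "exp (W j) = exp (of_nat (2 ^ j) * (char N (w / A j) - 1)) ^ 2 / exp (of_nat (2 ^ j) * (char N (2 * w / A j) - 1))" for j
      by (simp only: W_def exp_diff exp_double)
    have "(\<lambda>j. exp (W j)) \<longlonglongrightarrow> char s w ^ 2 / char s (2 * w)"
      unfolding expW using v[of m] by (intro tendsto_divide tendsto_power E) (auto simp: w2)
    then have "(\<lambda>j. exp (W j)) \<longlonglongrightarrow> 1" unfolding one .
    then have Ln_lim: "(\<lambda>j. Ln (exp (W j))) \<longlonglongrightarrow> Ln 1"
      by (intro isCont_tendsto_compose[OF continuous_at_Ln]) auto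
    have ImW: "Im (W j) = I j w" for j
    proof -
      have "Im (W j) = 2 ^ j * (2 * Im (char N (w / A j)) - Im (char N (2 * w / A j)))"
        unfolding W_def by (simp add: algebra_simps del: of_nat_power) (simp add: algebra_simps)
      also have "\<dots> = 2 ^ j * (\<integral>x. 2 * sin (w / A j * x) - sin (2 * w / A j * x) \<partial>N)"
        unfolding Im_char using sin_int[of "w / A j"] sin_int[of "2 * w / A j"] by simp
      also have "\<dots> = I j w" by (simp add: I_def sine_defect_def mult.assoc)
      finally show ?thesis .
    qed
    \<comment> \<open>\<open>W j\<close> itself, and not only its exponential, tends to 0, since its imaginary part is below \<open>\<pi>\<close>.\<close>
    have ev: "\<forall>\<^sub>F j in sequentially. Ln (exp (W j)) = W j"
    proof -
      have "(1::real) \<le> 2 ^ Suc m" by (rule one_le_power) simp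
      then have "R / 2 ^ Suc m \<le> R / 1" using R by (intro divide_left_mono) auto
      then have "R / 2 ^ Suc m < 1" using R by linarith
      then have "\<forall>\<^sub>F j in sequentially. cos_defect j w < 1"
        using C_lim[of "Suc m"] unfolding w_def by (intro order_tendstoD(2))
      then show ?thesis
      proof eventually_elim
        case (elim j)
        have "\<bar>I j w\<bar> = 2 ^ j * \<bar>\<integral>x. sine_defect (w / A j * x) \<partial>N\<bar>" by (simp add: I_def abs_mult)
        also have "\<dots> \<le> 2 ^ j * (\<integral>x. \<bar>sine_defect (w / A j * x)\<bar> \<partial>N)"
          by (intro mult_left_mono integral_abs_bound) auto
        also have "\<dots> \<le> 2 ^ j * (\<integral>x. 2 * (1 - cos (w / A j * x)) \<partial>N)"
          by (intro mult_left_mono integral_mono abs_sine_defect_le integrable_mult_right cosine_integrable integrable_abs defect_int) auto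
        also have "\<dots> = 2 * cos_defect j w" by (simp only: cos_defect_def integral_mult_right_zero mult.left_commute)
        also have "\<dots> < pi" using elim pi_gt3 by simp
        finally have "\<bar>Im (W j)\<bar> < pi" by (simp add: ImW)
        then show ?case by (intro Ln_exp) auto
      qed
    qed
    have "W \<longlonglongrightarrow> 0" using Lim_transform_eventually[OF Ln_lim ev] by simp
    then have "(\<lambda>j. Im (W j)) \<longlonglongrightarrow> Im 0" by (rule tendsto_Im)
    then show ?thesis by (simp add: ImW w_def)
  qed
  have gap_int: "integrable N (\<lambda>x. sine_gap n (w * x))" for n w
    unfolding sine_gap_def using sin_int[of w] sin_int[of "w / 2 ^ n"] by simp
  have gap_lim: "(\<lambda>j. 2 ^ j * (\<integral>x. sine_gap n (u / A j * x) \<partial>N)) \<longlonglongrightarrow> 0" for n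
  proof (induction n)
    case (Suc n)
    have "2 ^ j * (\<integral>x. sine_gap (Suc n) (u / A j * x) \<partial>N)
        = 2 ^ j * (\<integral>x. sine_gap n (u / A j * x) \<partial>N) + 2 ^ n * I j (v (Suc n))" for j
    proof -
      have eq: "u / A j * x / 2 ^ Suc n = v (Suc n) / A j * x" for x
        by (simp add: v_def mult_ac)
      have "(\<integral>x. sine_gap (Suc n) (u / A j * x) \<partial>N)
          = (\<integral>x. sine_gap n (u / A j * x) + 2 ^ n * sine_defect (v (Suc n) / A j * x) \<partial>N)"
        by (simp only: sine_gap_Suc eq)
      also have "\<dots> = (\<integral>x. sine_gap n (u / A j * x) \<partial>N) + 2 ^ n * (\<integral>x. sine_defect (v (Suc n) / A j * x) \<partial>N)"
        using gap_int[of n "u / A j"] defect_int[of "v (Suc n) / A j"] by simp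
      finally show ?thesis by (simp add: I_def algebra_simps)
    qed
    moreover have "(\<lambda>j. 2 ^ j * (\<integral>x. sine_gap n (u / A j * x) \<partial>N) + 2 ^ n * I j (v (Suc n))) \<longlonglongrightarrow> 0 + 2 ^ n * 0"
      by (intro tendsto_intros Suc I_lim)
    ultimately show ?case by simp
  qed (simp add: sine_gap_0)
  have cos_sum_int: "integrable N (\<lambda>x. cosine_sum n (w * x))" for n w
  proof -
    have "integrable N (\<lambda>x. 2 ^ m * (1 - cos (w * x / 2 ^ m)))" for m
      using cosine_integrable[of "w / 2 ^ m"] by (intro integrable_mult_right) simp
    then show ?thesis unfolding cosine_sum_def by (intro Bochner_Integration.integrable_sum)
  qed
  have cos_sum_lim: "(\<lambda>j. 2 ^ j * (\<integral>x. cosine_sum n (u / A j * x) \<partial>N)) \<longlonglongrightarrow> real n * R" for n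
  proof -
    have "2 ^ j * (\<integral>x. cosine_sum n (u / A j * x) \<partial>N) = (\<Sum>m<n. 2 ^ m * cos_defect j (v m))" for j
    proof -
      have eq: "1 - cos (u / A j * x / 2 ^ m) = 1 - cos (v m / A j * x)" for x m
        by (simp add: v_def mult_ac)
      have int: "integrable N (\<lambda>x. 2 ^ m * (1 - cos (v m / A j * x)))" for m
        by (intro integrable_mult_right cosine_integrable)
      have "(\<integral>x. cosine_sum n (u / A j * x) \<partial>N) = (\<Sum>m<n. 2 ^ m * (\<integral>x. 1 - cos (v m / A j * x) \<partial>N))"
        unfolding cosine_sum_def eq
        by (subst Bochner_Integration.integral_sum, rule int) (simp only: integral_mult_right_zero)
      then show ?thesis by (simp add: cos_defect_def sum_distrib_left mult_ac)
    qed
    moreover have "(\<lambda>j. \<Sum>m<n. 2 ^ m * cos_defect j (v m)) \<longlonglongrightarrow> (\<Sum>m<n. 2 ^ m * (R / 2 ^ m))"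
      by (intro tendsto_intros C_lim)
    ultimately show ?thesis by simp
  qed
  define m1 where "m1 = (\<integral>x. max 0 (- x) powr (1 + e) \<partial>N)"
  have bound: "real n * R \<le> 64 * R + 1344" for n
  proof -
    have ratio: "(\<lambda>j. A (j + n) / A j) \<longlonglongrightarrow> 2 ^ n"
    proof (induction n)
      case 0
      have "A j / A j = 1" for j using A_pos[of j] by simp
      then show ?case by simp
    next
      case (Suc n)
      have "(\<lambda>j. A (Suc (j + n)) / A (j + n)) \<longlonglongrightarrow> 2 powr (1 / \<alpha>)"
        using LIMSEQ_ignore_initial_segment[OF norming_growth, of n] .
      from tendsto_mult[OF this Suc] have "(\<lambda>j. A (Suc (j + n)) / A (j + n) * (A (j + n) / A j)) \<longlonglongrightarrow> 2 ^ Suc n"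
        by (simp add: \<alpha>1)
      moreover have "(\<lambda>j. A (Suc (j + n)) / A (j + n) * (A (j + n) / A j)) = (\<lambda>j. A (j + Suc n) / A j)"
      proof
        fix j show "A (Suc (j + n)) / A (j + n) * (A (j + n) / A j) = A (j + Suc n) / A j"
          using A_pos[of "j + n"] by simp
      qed
      ultimately show ?case by metis
    qed
    have "\<forall>\<^sub>F j in sequentially. A (j + n) / A j < 2 * 2 ^ n"
      by (rule order_tendstoD(2)[OF ratio]) simp
    moreover have "\<forall>\<^sub>F j in sequentially. max J1 J2 \<le> j" by (rule eventually_ge_at_top)
    ultimately have "\<forall>\<^sub>F j in sequentially. 2 ^ j * (\<integral>x. cosine_sum n (u / A j * x) \<partial>N)
        \<le> 64 * cos_defect j (v 0) + 20 * (2 ^ j * (\<integral>x. sine_gap n (u / A j * x) \<partial>N)) + 1344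
          + 82 * 2 ^ n * u powr (1 + e) * m1 * (2 ^ j / A j powr (1 + e))"
    proof eventually_elim
      case (elim j)
      define y where "y x = u / A j * x" for x
      define F where "F = {x. 2 ^ n < \<bar>y x\<bar>}"
      have [measurable]: "F \<in> sets borel" unfolding F_def y_def by measurable
      have ua: "0 < u / A j" using u A_pos[of j] by simp
      have maxy: "max 0 (- y x) powr (1 + e) = u powr (1 + e) / A j powr (1 + e) * max 0 (- x) powr (1 + e)" for x
      proof -
        have "max 0 (- y x) = u / A j * max 0 (- x)"
        proof (cases "x \<le> 0")
          case True
          then have "y x \<le> 0" unfolding y_def using ua by (intro mult_nonneg_nonpos) auto
          then show ?thesis using True by (simp add: y_def)
        next
          case False
          then have "0 \<le> y x" unfolding y_def using ua by (intro mult_nonneg_nonneg) auto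
          then show ?thesis using False by simp
        qed
        then show ?thesis using u A_pos[of j] by (simp add: powr_mult powr_divide)
      qed
      have "(\<integral>x. cosine_sum n (y x) \<partial>N)
          \<le> (\<integral>x. 64 * (1 - cos (y x)) + 20 * sine_gap n (y x) + 42 * 2 ^ n * indicator F x
              + 82 * 2 ^ n * max 0 (- y x) powr (1 + e) \<partial>N)"
      proof (rule integral_mono)
        show "integrable N (\<lambda>x. cosine_sum n (y x))" unfolding y_def by (rule cos_sum_int)
        have "integrable N (indicator F :: real \<Rightarrow> real)"
          by (rule integrable_const_bound[of _ 1]) (auto simp: indicator_def)
        then show "integrable N (\<lambda>x. 64 * (1 - cos (y x)) + 20 * sine_gap n (y x) + 42 * 2 ^ n * indicator F x
              + 82 * 2 ^ n * max 0 (- y x) powr (1 + e))"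
          unfolding maxy unfolding y_def
          by (intro Bochner_Integration.integrable_add integrable_mult_right cosine_integrable gap_int neg_int')
        show "cosine_sum n (y x) \<le> 64 * (1 - cos (y x)) + 20 * sine_gap n (y x) + 42 * 2 ^ n * indicator F x
              + 82 * 2 ^ n * max 0 (- y x) powr (1 + e)" for x
          using cosine_sum_le[OF e(1,2), of n "y x"] by (simp add: F_def indicator_def)
      qed
      also have "\<dots> = 64 * (\<integral>x. 1 - cos (y x) \<partial>N) + 20 * (\<integral>x. sine_gap n (y x) \<partial>N) + 42 * 2 ^ n * prob F
              + 82 * 2 ^ n * (u powr (1 + e) / A j powr (1 + e) * m1)"
      proof -
        have i1: "integrable N (\<lambda>x. 64 * (1 - cos (y x)))" unfolding y_def by (intro integrable_mult_right cosine_integrable)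
        have i2: "integrable N (\<lambda>x. 20 * sine_gap n (y x))" unfolding y_def by (intro integrable_mult_right gap_int)
        have "integrable N (indicator F :: real \<Rightarrow> real)"
          by (rule integrable_const_bound[of _ 1]) (auto simp: indicator_def)
        then have i3: "integrable N (\<lambda>x. 42 * 2 ^ n * indicator F x :: real)" by (rule integrable_mult_right)
        have i4: "integrable N (\<lambda>x. 82 * 2 ^ n * (u powr (1 + e) / A j powr (1 + e) * max 0 (- x) powr (1 + e)))"
          by (intro integrable_mult_right neg_int')
        show ?thesis
          unfolding maxy m1_def
          by (simp only: Bochner_Integration.integral_add Bochner_Integration.integrable_add i1 i2 i3 i4
              integral_mult_right_zero Bochner_Integration.integral_indicator space_eq_univ Int_UNIV_right)
      qed
      finally have le: "(\<integral>x. cosine_sum n (y x) \<partial>N)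
          \<le> 64 * (\<integral>x. 1 - cos (y x) \<partial>N) + 20 * (\<integral>x. sine_gap n (y x) \<partial>N) + 42 * 2 ^ n * prob F
              + 82 * 2 ^ n * (u powr (1 + e) / A j powr (1 + e) * m1)" .
      have "prob F \<le> prob {x. A (j + n) / (2 * u) \<le> \<bar>x\<bar>}"
      proof (rule finite_measure_mono)
        show "F \<subseteq> {x. A (j + n) / (2 * u) \<le> \<bar>x\<bar>}"
        proof
          fix x assume "x \<in> F"
          then have "2 ^ n * A j < u * \<bar>x\<bar>" using u A_pos[of j] by (simp add: F_def y_def abs_mult field_simps)
          moreover have "A (j + n) \<le> 2 * 2 ^ n * A j" using elim(1) A_pos[of j] by (simp add: field_simps)
          ultimately have "A (j + n) \<le> 2 * (u * \<bar>x\<bar>)" by linarith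
          then show "x \<in> {x. A (j + n) / (2 * u) \<le> \<bar>x\<bar>}" using u by (simp add: field_simps)
        qed
      qed simp
      also have "\<dots> \<le> 32 * (1 / 2) ^ (j + n)"
        by (rule tail_prob[OF u(1), of "max J1 J2"]) (use u(4) J2 elim in auto)
      finally have F: "prob F \<le> 32 * (1 / 2) ^ (j + n)" .
      have "2 ^ j * (42 * 2 ^ n * prob F) \<le> 2 ^ j * (42 * 2 ^ n * (32 * (1 / 2) ^ (j + n)))"
        using F by (intro mult_left_mono) auto
      also have "\<dots> = 1344" by (simp add: power_add power_divide)
      finally have "2 ^ j * (42 * 2 ^ n * prob F) \<le> 1344" .
      moreover have "2 ^ j * (\<integral>x. cosine_sum n (y x) \<partial>N)
          \<le> 2 ^ j * (64 * (\<integral>x. 1 - cos (y x) \<partial>N) + 20 * (\<integral>x. sine_gap n (y x) \<partial>N) + 42 * 2 ^ n * prob F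
              + 82 * 2 ^ n * (u powr (1 + e) / A j powr (1 + e) * m1))"
        using le by (intro mult_left_mono) auto
      moreover have "cos_defect j (v 0) = 2 ^ j * (\<integral>x. 1 - cos (y x) \<partial>N)" by (simp add: cos_defect_def v_def y_def)
      ultimately show ?case by (simp add: y_def algebra_simps)
    qed
    moreover have "(\<lambda>j. 64 * cos_defect j (v 0) + 20 * (2 ^ j * (\<integral>x. sine_gap n (u / A j * x) \<partial>N)) + 1344
          + 82 * 2 ^ n * u powr (1 + e) * m1 * (2 ^ j / A j powr (1 + e)))
        \<longlonglongrightarrow> 64 * (R / 2 ^ 0) + 20 * 0 + 1344 + 82 * 2 ^ n * u powr (1 + e) * m1 * 0"
      by (intro tendsto_intros C_lim gap_lim small) simp
    ultimately show ?thesis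
      using tendsto_le[OF sequentially_bot _ cos_sum_lim[of n]] by fastforce
  qed
  obtain n :: nat where "(64 * R + 1344) / R < real n" using reals_Archimedean2 by blast
  then have "64 * R + 1344 < real n * R" using R by (simp add: field_simps)
  with bound[of n] show False by simp
qed

end

section \<open>The uniform limit\<close>

theorem theorem2p2p3:
  fixes M :: "'w measure"
    and \<nu> :: "nat pmf measure"
    and Q :: "nat \<Rightarrow> 'w \<Rightarrow> nat pmf"
    and Z :: "nat \<Rightarrow> 'w \<Rightarrow> nat"
    and \<alpha> \<epsilon> :: real
    and c k :: nat
  assumes process: "branching_process_random_env M \<nu> Q Z"
    and start: "AE \<omega> in M. Z 0 \<omega> = 1"
    and lin_frac: "AE q in \<nu>. linear_fractional q"
    and supercrit: "supercritical \<nu>"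
    and intermediate_int: "integrable \<nu> (\<lambda>q. log_mean q * exp (- log_mean q))"
    and intermediate: "(LINT q|\<nu>. log_mean q * exp (- log_mean q)) = 0"
    and alpha: "0 < \<alpha>" "\<alpha> \<le> 2"
    and attraction:
      "(\<alpha> = 2 \<and> integrable (tilted_law \<nu>) (\<lambda>q. (log_mean q)\<^sup>2)) \<or>
       (\<exists>s. strictly_stable \<alpha> s \<and>
          in_domain_of_attraction (distr (tilted_law \<nu>) borel log_mean) s)"
    and eps: "0 < \<epsilon>"
    and log_moment:
      "integrable (tilted_law \<nu>) (\<lambda>q. \<bar>ln (1 - pmf q 0)\<bar> powr (\<alpha> + \<epsilon>))"
    and k: "1 \<le> k" "k \<le> c"
  shows "(\<lambda>n. cond_prob M (\<lambda>\<omega>. Z n \<omega> = k) (\<lambda>\<omega>. 1 \<le> Z n \<omega> \<and> Z n \<omega> \<le> c))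
           \<longlonglongrightarrow> 1 / real c"
proof -
  interpret B: branching_process_random_env M \<nu> Q Z by (rule process)
  interpret V: prob_space \<nu> by (rule B.prob_space_env_law)
  define \<mu> where "\<mu> = tilted_law \<nu>"
  have log_mean_\<nu> [measurable]: "log_mean \<in> borel_measurable \<nu>" by measurable
  have exp_int: "integrable \<nu> (\<lambda>q. exp (- log_mean q))"
  proof (rule Bochner_Integration.integrable_bound)
    show "integrable \<nu> (\<lambda>q. exp 1 + \<bar>log_mean q * exp (- log_mean q)\<bar>)"
      using intermediate_int by simp
    show "AE q in \<nu>. norm (exp (- log_mean q)) \<le> norm (exp 1 + \<bar>log_mean q * exp (- log_mean q)\<bar>)"
    proof (rule AE_I2)
      fix q
      define x where "x = log_mean q"
      have "exp (- x) \<le> exp 1 + \<bar>x * exp (- x)\<bar>"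
      proof (cases "\<bar>x\<bar> \<le> 1")
        case True
        then have "exp (- x) \<le> exp 1" by simp
        then show ?thesis by (simp add: add_increasing2)
      next
        case False
        then have "1 * exp (- x) \<le> \<bar>x\<bar> * exp (- x)" by (intro mult_right_mono) auto
        then show ?thesis by (simp add: abs_mult add_increasing)
      qed
      then show "norm (exp (- log_mean q)) \<le> norm (exp 1 + \<bar>log_mean q * exp (- log_mean q)\<bar>)"
        by (simp add: x_def)
    qed
  qed measurable
  define \<gamma> where "\<gamma> = (LINT q|\<nu>. exp (- log_mean q))"
  have \<gamma>: "0 < \<gamma>"
  proof -
    have "0 \<le> \<gamma>" unfolding \<gamma>_def by (intro integral_nonneg_AE) auto
    moreover have "\<gamma> \<noteq> 0"
    proof
      assume "\<gamma> = 0"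
      then have "AE q in \<nu>. exp (- log_mean q) = 0"
        unfolding \<gamma>_def using exp_int by (subst (asm) integral_nonneg_eq_0_iff_AE) auto
      then show False using V.AE_const[of False] by simp
    qed
    ultimately show ?thesis by simp
  qed
  have \<mu>: "\<mu> = density \<nu> (\<lambda>q. ennreal (exp (- log_mean q) / \<gamma>))"
    by (simp add: \<mu>_def tilted_law_def \<gamma>_def)
  have sets_\<mu> [measurable_cong]: "sets \<mu> = sets offspring_space" by (simp add: \<mu>)
  have AE_\<mu>: "(AE q in \<mu>. P q) \<longleftrightarrow> (AE q in \<nu>. P q)" for P
    unfolding \<mu> using \<gamma> by (subst AE_density) auto
  have prob_\<mu>: "prob_space \<mu>"
  proof (rule prob_spaceI)
    have "emeasure \<mu> (space \<mu>) = (\<integral>\<^sup>+q. ennreal (exp (- log_mean q) / \<gamma>) \<partial>\<nu>)"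
      unfolding \<mu> using sets.top[of offspring_space] by (subst emeasure_density) (auto intro!: nn_integral_cong)
    also have "\<dots> = ennreal (LINT q|\<nu>. exp (- log_mean q) / \<gamma>)"
      using exp_int \<gamma> by (intro nn_integral_eq_integral) auto
    also have "(LINT q|\<nu>. exp (- log_mean q) / \<gamma>) = 1" using \<gamma> by (simp add: \<gamma>_def)
    finally show "emeasure \<mu> (space \<mu>) = 1" by simp
  qed
  have lf_\<mu>: "AE q in \<mu>. linear_fractional q" using lin_frac by (simp add: AE_\<mu>)
  have rs: "random_step \<mu> log_mean log_survival"
  proof (intro random_step.intro prob_\<mu> random_step_axioms.intro)
    show "AE q in \<mu>. 0 \<le> log_survival q" "AE q in \<mu>. - log_survival q \<le> log_mean q"
      using lf_\<mu> by (auto elim!: eventually_mono intro: linear_fractional_bounds)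
  qed measurable
  interpret R: random_step \<mu> log_mean log_survival by (rule rs)
  have X_int: "integrable \<mu> log_mean"
    unfolding \<mu> using intermediate_int \<gamma> by (subst integrable_density) (auto simp: mult.commute)
  have X_mean: "(LINT q|\<mu>. log_mean q) = 0"
    unfolding \<mu> using intermediate \<gamma> by (subst integral_density) (auto simp: mult.commute)
  have nondeg: "\<not> (AE q in \<mu>. log_mean q = 0)"
  proof
    assume "AE q in \<mu>. log_mean q = 0"
    then have AE: "AE q in \<nu>. log_mean q = 0" by (simp add: AE_\<mu>)
    have "(\<integral>\<^sup>+q. ennreal (log_mean q) \<partial>\<nu>) = (\<integral>\<^sup>+q. 0 \<partial>\<nu>)"
      by (rule nn_integral_cong_AE) (use AE in eventually_elim, simp)
    then show False using supercrit by (simp add: supercritical_def)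
  qed
  \<comment> \<open>If no environment could kill an individual, \<open>X\<close> would be nonnegative and centred, hence null.\<close>
  have \<kappa>: "0 < (LINT q|\<mu>. 1 - exp (- log_survival q))"
  proof -
    have int: "integrable \<mu> (\<lambda>q. 1 - exp (- log_survival q))"
      by (rule R.integrable_const_bound[of _ 1]) (use R.\<xi>_nonneg in auto)
    have "0 \<le> (LINT q|\<mu>. 1 - exp (- log_survival q))"
      by (intro integral_nonneg_AE) (use R.\<xi>_nonneg in auto)
    moreover have "(LINT q|\<mu>. 1 - exp (- log_survival q)) \<noteq> 0"
    proof
      assume "(LINT q|\<mu>. 1 - exp (- log_survival q)) = 0"
      then have "AE q in \<mu>. 1 - exp (- log_survival q) = 0"
        using int R.\<xi>_nonneg by (subst (asm) integral_nonneg_eq_0_iff_AE) auto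
      then have "AE q in \<mu>. 0 \<le> log_mean q"
        using R.X_lower by eventually_elim simp
      then have "AE q in \<mu>. log_mean q = 0"
        using X_mean X_int by (subst (asm) integral_nonneg_eq_0_iff_AE) auto
      then show False using nondeg by simp
    qed
    ultimately show ?thesis by simp
  qed
  have \<xi>_int: "integrable \<mu> (\<lambda>q. \<bar>log_survival q\<bar> powr (\<alpha> + \<epsilon>))"
    using log_moment by (simp add: \<mu>_def log_survival_def)
  have "1 < \<alpha> \<and> (\<forall>q. 1 \<le> q \<longrightarrow> q < \<alpha> \<longrightarrow> integrable \<mu> (\<lambda>w. \<bar>log_mean w\<bar> powr q))
     \<and> (\<forall>\<delta>>0. \<exists>c>0. \<exists>y1. \<forall>y\<ge>y1. c * y powr (- (\<alpha> + \<delta>)) \<le> (\<integral>w. min 1 ((log_mean w / y)\<^sup>2) \<partial>\<mu>))"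
    using attraction
  proof (elim disjE exE conjE)
    assume \<alpha>2: "\<alpha> = 2" and "integrable (tilted_law \<nu>) (\<lambda>q. (log_mean q)\<^sup>2)"
    then have sq: "integrable \<mu> (\<lambda>q. (log_mean q)\<^sup>2)" by (simp add: \<mu>_def)
    have "integrable \<mu> (\<lambda>w. \<bar>log_mean w\<bar> powr q)" if q: "1 \<le> q" "q < \<alpha>" for q
    proof (rule Bochner_Integration.integrable_bound)
      show "integrable \<mu> (\<lambda>w. 1 + (log_mean w)\<^sup>2)" using sq by simp
      show "AE w in \<mu>. norm (\<bar>log_mean w\<bar> powr q) \<le> norm (1 + (log_mean w)\<^sup>2)"
      proof (rule AE_I2)
        fix w
        define x where "x = \<bar>log_mean w\<bar>"
        have "x powr q \<le> 1 + x\<^sup>2"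
        proof (cases "x \<le> 1")
          case True
          then have "x powr q \<le> 1 powr q" using q by (intro powr_mono2) (auto simp: x_def)
          then show ?thesis by (simp add: add_increasing2)
        next
          case False
          then have "x powr q \<le> x powr 2" using q \<alpha>2 by (intro powr_mono) auto
          also have "x powr 2 = x\<^sup>2" using False by (simp add: powr_numeral)
          finally show ?thesis by simp
        qed
        then show "norm (\<bar>log_mean w\<bar> powr q) \<le> norm (1 + (log_mean w)\<^sup>2)" by (simp add: x_def)
      qed
    qed measurable
    moreover have "\<exists>c>0. \<exists>y1. \<forall>y\<ge>y1. c * y powr (- (\<alpha> + \<delta>)) \<le> (\<integral>w. min 1 ((log_mean w / y)\<^sup>2) \<partial>\<mu>)"
      if \<delta>: "0 < \<delta>" for \<delta>
    proof -
      define d where "d = (\<integral>w. min 1 ((log_mean w)\<^sup>2) \<partial>\<mu>)"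
      have D_int: "integrable \<mu> (\<lambda>w. min 1 ((log_mean w / y)\<^sup>2))" for y
        by (rule R.integrable_const_bound[of _ 1]) auto
      have d: "0 < d"
      proof -
        have "0 \<le> d" unfolding d_def by (intro integral_nonneg_AE) auto
        moreover have "d \<noteq> 0"
        proof
          assume "d = 0"
          then have "AE w in \<mu>. min 1 ((log_mean w)\<^sup>2) = 0"
            using D_int[of 1] unfolding d_def by (subst (asm) integral_nonneg_eq_0_iff_AE) auto
          then have "AE w in \<mu>. log_mean w = 0" by eventually_elim (auto simp: min_def split: if_splits)
          then show False using nondeg by simp
        qed
        ultimately show ?thesis by simp
      qed
      have "d * y powr (- (\<alpha> + \<delta>)) \<le> (\<integral>w. min 1 ((log_mean w / y)\<^sup>2) \<partial>\<mu>)" if y: "1 \<le> y" for y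
      proof -
        have "y powr (- (\<alpha> + \<delta>)) \<le> y powr (- 2)" using y \<delta> \<alpha>2 by (intro powr_mono) auto
        also have "\<dots> = 1 / y\<^sup>2" using y by (simp add: powr_minus powr_numeral inverse_eq_divide)
        finally have "d * y powr (- (\<alpha> + \<delta>)) \<le> d * (1 / y\<^sup>2)" using d by (intro mult_left_mono) auto
        also have "\<dots> = (\<integral>w. min 1 ((log_mean w)\<^sup>2) * (1 / y\<^sup>2) \<partial>\<mu>)" by (simp add: d_def)
        also have "\<dots> \<le> (\<integral>w. min 1 ((log_mean w / y)\<^sup>2) \<partial>\<mu>)"
        proof (rule integral_mono[OF _ D_int])
          show "integrable \<mu> (\<lambda>w. min 1 ((log_mean w)\<^sup>2) * (1 / y\<^sup>2))" using D_int[of 1] by simp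
          fix w
          have y2: "1 \<le> y\<^sup>2" using y by (simp add: one_le_power)
          have "min 1 ((log_mean w)\<^sup>2) * (1 / y\<^sup>2) = min 1 ((log_mean w)\<^sup>2) / y\<^sup>2" by simp
          also have "\<dots> \<le> (log_mean w)\<^sup>2 / y\<^sup>2" by (intro divide_right_mono) auto
          finally have "min 1 ((log_mean w)\<^sup>2) * (1 / y\<^sup>2) \<le> (log_mean w / y)\<^sup>2" by (simp add: power_divide)
          moreover have "min 1 ((log_mean w)\<^sup>2) * (1 / y\<^sup>2) \<le> 1 * (1 / 1)"
            using y2 by (intro mult_mono divide_left_mono) auto
          ultimately show "min 1 ((log_mean w)\<^sup>2) * (1 / y\<^sup>2) \<le> min 1 ((log_mean w / y)\<^sup>2)" by simp
        qed
        finally show ?thesis .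
      qed
      with d show ?thesis by blast
    qed
    ultimately show ?thesis using \<alpha>2 by simp
  next
    fix s
    assume s: "strictly_stable \<alpha> s"
      and "in_domain_of_attraction (distr (tilted_law \<nu>) borel log_mean) s"
    define N where "N = distr \<mu> borel log_mean"
    have "in_domain_of_attraction N s"
      using \<open>in_domain_of_attraction (distr (tilted_law \<nu>) borel log_mean) s\<close> by (simp add: N_def \<mu>_def)
    then obtain a :: "nat \<Rightarrow> real" where a: "\<And>n. 0 < a n"
      and conv: "weak_conv_m (\<lambda>n. distr (Pi\<^sub>M {..<n} (\<lambda>_. N)) borel (\<lambda>x. (\<Sum>i<n. x i) / a n)) s"
      unfolding in_domain_of_attraction_def by blast
    have N_real: "real_distribution N"
      unfolding N_def by (rule R.real_distribution_distr) measurable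
    have mono: "strict_mono (\<lambda>j. 2 ^ j :: nat)" by (simp add: strict_mono_def)
    have att: "attracted_law N \<alpha> s (\<lambda>j. a (2 ^ j))"
    proof (intro attracted_law.intro attracted_law_axioms.intro N_real)
      show "weak_conv_m (\<lambda>j. distr (Pi\<^sub>M {..<2 ^ j :: nat} (\<lambda>_. N)) borel (\<lambda>x. (\<Sum>i<2 ^ j. x i) / a (2 ^ j))) s"
        unfolding weak_conv_m_def weak_conv_def
      proof (intro allI impI)
        fix x assume "isCont (cdf s) x"
        with conv have "(\<lambda>n. cdf (distr (Pi\<^sub>M {..<n} (\<lambda>_. N)) borel (\<lambda>x. (\<Sum>i<n. x i) / a n)) x) \<longlonglongrightarrow> cdf s x"
          unfolding weak_conv_m_def weak_conv_def by blast
        from LIMSEQ_subseq_LIMSEQ[OF this mono]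
        show "(\<lambda>j. cdf (distr (Pi\<^sub>M {..<2 ^ j :: nat} (\<lambda>_. N)) borel (\<lambda>x. (\<Sum>i<2 ^ j. x i) / a (2 ^ j))) x) \<longlonglongrightarrow> cdf s x"
          by (simp add: o_def)
      qed
      show "integrable N (\<lambda>x. x)" unfolding N_def using X_int by (subst integrable_distr_eq) auto
      show "(\<integral>x. x \<partial>N) = 0" unfolding N_def using X_mean by (subst integral_distr) auto
      show "\<not> (AE x in N. x = 0)" unfolding N_def using nondeg by (subst AE_distr_iff) auto
    qed (use alpha s a in auto)
    interpret A: attracted_law N \<alpha> s "\<lambda>j. a (2 ^ j)" by (rule att)
    have "integrable N (\<lambda>x. max 0 (- x) powr (\<alpha> + \<epsilon>))"
      unfolding N_def
    proof (subst integrable_distr_eq)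
      show "integrable \<mu> (\<lambda>w. max 0 (- log_mean w) powr (\<alpha> + \<epsilon>))"
      proof (rule Bochner_Integration.integrable_bound[OF \<xi>_int])
        show "AE w in \<mu>. norm (max 0 (- log_mean w) powr (\<alpha> + \<epsilon>)) \<le> norm (\<bar>log_survival w\<bar> powr (\<alpha> + \<epsilon>))"
          using R.\<xi>_nonneg R.X_lower
        proof eventually_elim
          case (elim w)
          have "max 0 (- log_mean w) powr (\<alpha> + \<epsilon>) \<le> \<bar>log_survival w\<bar> powr (\<alpha> + \<epsilon>)"
            using elim alpha eps by (intro powr_mono2) auto
          then show ?case by simp
        qed
      qed measurable
    qed measurable
    then have "1 < \<alpha>" by (rule A.index_gt_1[OF eps])
    moreover have "integrable \<mu> (\<lambda>w. \<bar>log_mean w\<bar> powr q)" if "1 \<le> q" "q < \<alpha>" for q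
      using A.moments[OF that] unfolding N_def by (subst (asm) integrable_distr_eq) auto
    moreover have "\<exists>c>0. \<exists>y1. \<forall>y\<ge>y1. c * y powr (- (\<alpha> + \<delta>)) \<le> (\<integral>w. min 1 ((log_mean w / y)\<^sup>2) \<partial>\<mu>)"
      if "0 < \<delta>" for \<delta>
    proof -
      have "(\<integral>x. min 1 ((x / y)\<^sup>2) \<partial>N) = (\<integral>w. min 1 ((log_mean w / y)\<^sup>2) \<partial>\<mu>)" for y
        unfolding N_def by (rule integral_distr) measurable
      then show ?thesis using A.spread[OF that] by simp
    qed
    ultimately show ?thesis by blast
  qed
  then have "(\<Sum>n. (R.geom_step ^^ n) (\<lambda>_. 1) 1) = \<infinity>"
    using X_int X_mean eps \<xi>_int by (intro R.geom_step_recurrent[of \<alpha> \<epsilon>]) auto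
  then show ?thesis
    using B.uniform_limit_of_green_infinite[OF start lin_frac exp_int rs[unfolded \<mu>_def]] \<kappa> k
    by (simp add: \<mu>_def)
qed

end
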